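(* Let $d,p\in\mathbb N$, $\mathbf a,\mathbf b\in\mathbb R^d$ and $T>0$, and suppose that the matrices $\kappa(s,t)$ (defined in the context) are positive definite for all $0\le s<t$. Then the process $(\mathbf U_t)_{t\in[0,T)}$ defined by $$\mathbf U_t:=\mathbf n_{\mathbf a,\mathbf b}(0,t)+\Gamma(t,T)\int_0^t\Gamma(u,T)^{-1}\Sigma(u)\,\mathrm d\mathbf B_u,\qquad t\in[0,T),$$ is a strong solution of the linear stochastic differential equation $$\mathrm d\mathbf U_t=\Big[\big(Q(t)-\Sigma(t)\Sigma(t)^\top E(T,t)^\top\Gamma(t,T)^{-1}\big)\mathbf U_t+\Sigma(t)\Sigma(t)^\top\big(\Gamma(t,T)^\top\big)^{-1}\mathbf m^-_{\mathbf b}(t,T)+\mathbf r(t)\Big]\mathrm dt+\Sigma(t)\,\mathrm d\mathbf B_t$$ for $t\in[0,T)$ with initial condition $\mathbf U_0=\mathbf a$, and strong uniqueness holds for this stochastic differential equation.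
   Context: $Q:\mathbb R_+\to\mathbb R^{d\times d}$, $\Sigma:\mathbb R_+\to\mathbb R^{d\times p}$, $\mathbf r:\mathbb R_+\to\mathbb R^d$ are continuous functions, and $(\mathbf B_t)_{t\ge0}$ is a $p$-dimensional standard Wiener process on a filtered probability space satisfying the usual conditions (the filtration being constructed by the help of $\mathbf B$). Evolution matrices: $E(t,s)\in\mathbb R^{d\times d}$, $s,t\ge0$, is the unique solution of $\partial_1E(t,s)=Q(t)E(t,s)$, $E(s,s)=I_d$. One has $E(t,s)E(s,r)=E(t,r)$ and $E(t,s)^{-1}=E(s,t)$. For $0\le s\le t$: $\kappa(s,t):=\int_s^tE(t,u)\Sigma(u)\Sigma(u)^\top E(t,u)^\top\,\mathrm du$ and $\Gamma(s,t):=E(s,t)\kappa(s,t)=\int_s^tE(s,u)\Sigma(u)\Sigma(u)^\top E(t,u)^\top\,\mathrm du$. For $\mathbf x\in\mathbb R^d$, $0\le s\le t$: $\mathbf m^+_{\mathbf x}(s,t):=\mathbf x+\int_s^tE(s,u)\mathbf r(u)\,\mathrm du$ and $\mathbf m^-_{\mathbf x}(s,t):=\mathbf x-\int_s^tE(t,u)\mathbf r(u)\,\mathrm du$. For $0\le s\le t<T$: $$\mathbf n_{\mathbf a,\mathbf b}(s,t):=\Gamma(t,T)\Gamma(s,T)^{-1}\mathbf m^+_{\mathbf a}(s,t)+\Gamma(s,t)^\top\big(\Gamma(s,T)^\top\big)^{-1}\mathbf m^-_{\mathbf b}(t,T).$$ *)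

theory Defs
  imports "HOL-Probability.Probability"
begin

section \<open>Filtrations and Wiener processes\<close>

definition usual_conditions :: "'w measure \<Rightarrow> (real \<Rightarrow> 'w measure) \<Rightarrow> bool" where
  "usual_conditions M F \<longleftrightarrow>
     prob_space M \<and> complete_measure M \<and>
     filtration (space M) F \<and> (\<forall>t. subalgebra M (F t)) \<and>
     null_sets M \<subseteq> sets (F 0) \<and>
     (\<forall>t\<ge>0. sets (F t) = (\<Inter>s\<in>{t<..}. sets (F s)))"

text \<open>The sigma-algebra at time \<open>t\<close> is generated by the initial value \<open>\<xi>\<close>, the driving process up
  to time \<open>t\<close>, and the null sets (Karatzas and Shreve, Section 5.2). Only the \<open>sets\<close> of these
  measures are relevant. If \<open>\<xi>\<close> is constant, this is the augmented filtration of \<open>W\<close> alone.\<close>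

definition augmented_filtration ::
  "'w measure \<Rightarrow> ('w \<Rightarrow> real^'d) \<Rightarrow> (real \<Rightarrow> 'w \<Rightarrow> real^'p) \<Rightarrow> real \<Rightarrow> 'w measure" where
  "augmented_filtration M \<xi> W t = sigma (space M)
     ({\<xi> -` A \<inter> space M | A. A \<in> sets borel} \<union>
      (\<Union>s\<in>{0..t}. {W s -` A \<inter> space M | A. A \<in> sets borel}) \<union>
      null_sets M)"

definition wiener_process ::
  "'w measure \<Rightarrow> (real \<Rightarrow> 'w measure) \<Rightarrow> (real \<Rightarrow> 'w \<Rightarrow> real^'p) \<Rightarrow> bool" where
  "wiener_process M F W \<longleftrightarrow>
     prob_space M \<and>
     (\<forall>t\<ge>0. W t \<in> borel_measurable (F t)) \<and>
     (AE \<omega> in M. W 0 \<omega> = 0) \<and>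
     (AE \<omega> in M. continuous_on {0..} (\<lambda>t. W t \<omega>)) \<and>
     (\<forall>s t. 0 \<le> s \<and> s < t \<longrightarrow>
        prob_space.indep_set M (sets (F s))
          {(\<lambda>\<omega>. W t \<omega> - W s \<omega>) -` A \<inter> space M | A. A \<in> sets borel} \<and>
        prob_space.indep_vars M (\<lambda>_. borel) (\<lambda>i \<omega>. (W t \<omega> - W s \<omega>) $ i) UNIV \<and>
        (\<forall>i. distributed M lborel (\<lambda>\<omega>. (W t \<omega> - W s \<omega>) $ i)
               (\<lambda>x. ennreal (normal_density 0 (sqrt (t - s)) x))))"

text \<open>Being a Wiener process relative to the filtration generated by \<open>\<xi>\<close> and \<open>W\<close> means that \<open>W\<close> is
  a standard Wiener process and that \<open>\<xi>\<close> is independent of \<open>W\<close>.\<close>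

definition wiener_setup ::
  "'w measure \<Rightarrow> ('w \<Rightarrow> real^'d) \<Rightarrow> (real \<Rightarrow> 'w \<Rightarrow> real^'p) \<Rightarrow> bool" where
  "wiener_setup M \<xi> W \<longleftrightarrow>
     \<xi> \<in> borel_measurable M \<and>
     usual_conditions M (augmented_filtration M \<xi> W) \<and>
     wiener_process M (augmented_filtration M \<xi> W) W"

section \<open>The Ito integral\<close>

text \<open>A simple process on \<open>[0,t]\<close> is given by grid points \<open>\<tau> 0 \<le> \<dots> \<le> \<tau> N\<close> and bounded matrix-valued
  random variables \<open>\<eta> i\<close>, known at time \<open>\<tau> i\<close>; it takes the value \<open>\<eta> i\<close> on \<open>(\<tau> i, \<tau> (i + 1)]\<close>.\<close>

definition simple_process ::
  "(real \<Rightarrow> 'w measure) \<Rightarrow> real \<Rightarrow> nat \<Rightarrow> (nat \<Rightarrow> real) \<Rightarrow> (nat \<Rightarrow> 'w \<Rightarrow> real^'p^'d) \<Rightarrow> bool" where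
  "simple_process F t N \<tau> \<eta> \<longleftrightarrow>
     \<tau> 0 = 0 \<and> \<tau> N = t \<and> (\<forall>i<N. \<tau> i \<le> \<tau> (Suc i)) \<and>
     (\<forall>i<N. \<eta> i \<in> borel_measurable (F (\<tau> i)) \<and>
            (\<exists>C. \<forall>\<omega>\<in>space (F (\<tau> i)). norm (\<eta> i \<omega>) \<le> C))"

definition simple_value ::
  "nat \<Rightarrow> (nat \<Rightarrow> real) \<Rightarrow> (nat \<Rightarrow> 'w \<Rightarrow> real^'p^'d) \<Rightarrow> real \<Rightarrow> 'w \<Rightarrow> real^'p^'d" where
  "simple_value N \<tau> \<eta> s \<omega> = (\<Sum>i<N. indicator {\<tau> i<..\<tau> (Suc i)} s *\<^sub>R \<eta> i \<omega>)"

definition simple_integral ::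
  "(real \<Rightarrow> 'w \<Rightarrow> real^'p) \<Rightarrow> nat \<Rightarrow> (nat \<Rightarrow> real) \<Rightarrow> (nat \<Rightarrow> 'w \<Rightarrow> real^'p^'d) \<Rightarrow> 'w \<Rightarrow> real^'d" where
  "simple_integral W N \<tau> \<eta> \<omega> = (\<Sum>i<N. \<eta> i \<omega> *v (W (\<tau> (Suc i)) \<omega> - W (\<tau> i) \<omega>))"

text \<open>\<open>has_ito_integral M F W T H I\<close>: the process \<open>I\<close> is a version, with almost surely continuous
  paths, of the stochastic integral of \<open>H\<close> with respect to \<open>W\<close> on \<open>[0,T)\<close>. The integrand is
  progressively measurable with almost surely square integrable paths, and \<open>I t\<close> is the limit in
  probability of integrals of simple processes which approximate \<open>H\<close> in \<open>L\<^sup>2[0,t]\<close> in probability.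
  The norm on matrices is the Frobenius norm.\<close>

definition has_ito_integral ::
  "'w measure \<Rightarrow> (real \<Rightarrow> 'w measure) \<Rightarrow> (real \<Rightarrow> 'w \<Rightarrow> real^'p) \<Rightarrow> real \<Rightarrow>
   (real \<Rightarrow> 'w \<Rightarrow> real^'p^'d) \<Rightarrow> (real \<Rightarrow> 'w \<Rightarrow> real^'d) \<Rightarrow> bool" where
  "has_ito_integral M F W T H I \<longleftrightarrow>
     (\<forall>t\<in>{0..<T}.
        (\<lambda>(s, \<omega>). H s \<omega>) \<in> borel_measurable (restrict_space borel {0..t} \<Otimes>\<^sub>M F t) \<and>
        (AE \<omega> in M. (\<integral>\<^sup>+s\<in>{0..t}. ennreal ((norm (H s \<omega>))\<^sup>2) \<partial>lborel) < \<infinity>)) \<and>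
     (\<forall>t\<in>{0..<T}. I t \<in> borel_measurable (F t)) \<and>
     (AE \<omega> in M. continuous_on {0..<T} (\<lambda>t. I t \<omega>)) \<and>
     (\<forall>t\<in>{0..<T}. \<exists>N \<tau> \<eta>.
        (\<forall>n. simple_process F t (N n) (\<tau> n) (\<eta> n)) \<and>
        (\<forall>\<epsilon>>0. (\<lambda>n. measure M {\<omega>\<in>space M. ennreal \<epsilon> <
             (\<integral>\<^sup>+s\<in>{0..t}. ennreal ((norm (simple_value (N n) (\<tau> n) (\<eta> n) s \<omega> - H s \<omega>))\<^sup>2) \<partial>lborel)})
           \<longlonglongrightarrow> 0) \<and>
        (\<forall>\<epsilon>>0. (\<lambda>n. measure M {\<omega>\<in>space M. \<epsilon> <
             norm (simple_integral W (N n) (\<tau> n) (\<eta> n) \<omega> - I t \<omega>)})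
           \<longlonglongrightarrow> 0))"

section \<open>Strong solutions and strong uniqueness\<close>

text \<open>Strong solutions on \<open>[0,T)\<close> of \<open>dX = b(t,X) dt + \<sigma>(t,X) dW\<close>, \<open>X 0 = \<xi>\<close>, in the sense of
  Karatzas and Shreve, Definition 5.2.1; to be used under \<open>wiener_setup M \<xi> W\<close>.\<close>

definition strong_solution ::
  "'w measure \<Rightarrow> (real \<Rightarrow> 'w \<Rightarrow> real^'p) \<Rightarrow> real \<Rightarrow> (real \<Rightarrow> real^'d \<Rightarrow> real^'d) \<Rightarrow>
   (real \<Rightarrow> real^'d \<Rightarrow> real^'p^'d) \<Rightarrow> ('w \<Rightarrow> real^'d) \<Rightarrow> (real \<Rightarrow> 'w \<Rightarrow> real^'d) \<Rightarrow> bool" where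
  "strong_solution M W T b \<sigma> \<xi> X \<longleftrightarrow>
     (\<forall>t\<in>{0..<T}. X t \<in> borel_measurable (augmented_filtration M \<xi> W t)) \<and>
     (AE \<omega> in M. continuous_on {0..<T} (\<lambda>t. X t \<omega>)) \<and>
     (AE \<omega> in M. X 0 \<omega> = \<xi> \<omega>) \<and>
     (AE \<omega> in M. \<forall>t\<in>{0..<T}. set_integrable lborel {0..t} (\<lambda>s. b s (X s \<omega>))) \<and>
     (\<exists>J. has_ito_integral M (augmented_filtration M \<xi> W) W T (\<lambda>s \<omega>. \<sigma> s (X s \<omega>)) J \<and>
        (AE \<omega> in M. \<forall>t\<in>{0..<T}.
           X t \<omega> = X 0 \<omega> + (LINT s:{0..t}|lborel. b s (X s \<omega>)) + J t \<omega>))"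

text \<open>Strong uniqueness (Karatzas and Shreve, Definition 5.2.3) quantifies over all probability
  spaces, Wiener processes and initial values; the sample space ranges over the type argument.\<close>

definition strong_uniqueness ::
  "'w itself \<Rightarrow> real \<Rightarrow> (real \<Rightarrow> real^'d \<Rightarrow> real^'d) \<Rightarrow> (real \<Rightarrow> real^'d \<Rightarrow> real^'p^'d) \<Rightarrow> bool" where
  "strong_uniqueness TYPE('w) T b \<sigma> \<longleftrightarrow>
     (\<forall>(M :: 'w measure) (W :: real \<Rightarrow> 'w \<Rightarrow> real^'p) \<xi> X Y.
        wiener_setup M \<xi> W \<and> strong_solution M W T b \<sigma> \<xi> X \<and> strong_solution M W T b \<sigma> \<xi> Y \<longrightarrow>
        (AE \<omega> in M. \<forall>t\<in>{0..<T}. X t \<omega> = Y t \<omega>))"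

section \<open>Deterministic quantities of the linear equation\<close>

definition evolution_matrices ::
  "(real \<Rightarrow> real^'d^'d) \<Rightarrow> (real \<Rightarrow> real \<Rightarrow> real^'d^'d) \<Rightarrow> bool" where
  "evolution_matrices Q E \<longleftrightarrow>
     (\<forall>s\<ge>0. E s s = mat 1 \<and>
        (\<forall>t\<ge>0. ((\<lambda>t. E t s) has_vector_derivative (Q t ** E t s)) (at t within {0..})))"

definition kappa ::
  "(real \<Rightarrow> real \<Rightarrow> real^'d^'d) \<Rightarrow> (real \<Rightarrow> real^'p^'d) \<Rightarrow> real \<Rightarrow> real \<Rightarrow> real^'d^'d" where
  "kappa E \<Sigma> s t =
     integral {s..t} (\<lambda>u. E t u ** \<Sigma> u ** transpose (\<Sigma> u) ** transpose (E t u))"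

definition Gam ::
  "(real \<Rightarrow> real \<Rightarrow> real^'d^'d) \<Rightarrow> (real \<Rightarrow> real^'p^'d) \<Rightarrow> real \<Rightarrow> real \<Rightarrow> real^'d^'d" where
  "Gam E \<Sigma> s t = E s t ** kappa E \<Sigma> s t"

definition m_plus ::
  "(real \<Rightarrow> real \<Rightarrow> real^'d^'d) \<Rightarrow> (real \<Rightarrow> real^'d) \<Rightarrow> real^'d \<Rightarrow> real \<Rightarrow> real \<Rightarrow> real^'d" where
  "m_plus E r x s t = x + integral {s..t} (\<lambda>u. E s u *v r u)"

definition m_minus ::
  "(real \<Rightarrow> real \<Rightarrow> real^'d^'d) \<Rightarrow> (real \<Rightarrow> real^'d) \<Rightarrow> real^'d \<Rightarrow> real \<Rightarrow> real \<Rightarrow> real^'d" where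
  "m_minus E r x s t = x - integral {s..t} (\<lambda>u. E t u *v r u)"

definition n_bridge ::
  "(real \<Rightarrow> real \<Rightarrow> real^'d^'d) \<Rightarrow> (real \<Rightarrow> real^'p^'d) \<Rightarrow> (real \<Rightarrow> real^'d) \<Rightarrow> real \<Rightarrow>
   real^'d \<Rightarrow> real^'d \<Rightarrow> real \<Rightarrow> real \<Rightarrow> real^'d" where
  "n_bridge E \<Sigma> r T a b s t =
     (Gam E \<Sigma> t T ** matrix_inv (Gam E \<Sigma> s T)) *v m_plus E r a s t +
     (transpose (Gam E \<Sigma> s t) ** matrix_inv (transpose (Gam E \<Sigma> s T))) *v m_minus E r b t T"

definition positive_definite :: "real^'d^'d \<Rightarrow> bool" where
  "positive_definite A \<longleftrightarrow> transpose A = A \<and> (\<forall>x. x \<noteq> 0 \<longrightarrow> 0 < x \<bullet> (A *v x))"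

definition bridge_drift ::
  "(real \<Rightarrow> real^'d^'d) \<Rightarrow> (real \<Rightarrow> real \<Rightarrow> real^'d^'d) \<Rightarrow> (real \<Rightarrow> real^'p^'d) \<Rightarrow>
   (real \<Rightarrow> real^'d) \<Rightarrow> real \<Rightarrow> real^'d \<Rightarrow> real \<Rightarrow> real^'d \<Rightarrow> real^'d" where
  "bridge_drift Q E \<Sigma> r T b t x =
     (Q t - \<Sigma> t ** transpose (\<Sigma> t) ** transpose (E T t) ** matrix_inv (Gam E \<Sigma> t T)) *v x +
     (\<Sigma> t ** transpose (\<Sigma> t) ** matrix_inv (transpose (Gam E \<Sigma> t T))) *v m_minus E r b t T +
     r t"

end

theory Submission
  imports Defs
begin

text \<open>For a deterministic integrand \<open>G\<close>, continuous on \<open>[0,T)\<close>, the stochastic integral is the almost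
  sure, locally uniform limit of its step integrals along rapidly refining dyadic grids: a
  Kolmogorov-type maximal inequality, obtained by stopping the integrand, makes the increments
  summable. A truncation estimate for simple integrands identifies every version of the integral with
  this limit. Abel summation on the grids then gives the product rule \<open>d(K I) = K' I dt + K dI\<close> for
  differentiable deterministic \<open>K\<close>.

  On the deterministic side, put \<open>\<Phi>(t) = E(t,0)\<close>, \<open>\<Psi> = \<Phi>\<^sup>-\<^sup>1\<close> and
  \<open>P(t) = \<integral>\<^sub>0\<^sup>t \<Psi> \<Sigma> \<Sigma>\<^sup>T \<Psi>\<^sup>T du\<close>, \<open>R(t) = P(T) - P(t)\<close>. Then \<open>\<Gamma>(t,T) = \<Phi>(t) R(t) \<Phi>(T)\<^sup>T\<close>, and
  \<open>n(0,t) = \<Phi>(t) (a + P(t) v + q(t))\<close> for a constant vector \<open>v\<close>, where \<open>q(t) = \<integral>\<^sub>0\<^sup>t \<Psi> r du\<close>. Hence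
  \<open>\<Gamma>' = A \<Gamma>\<close> and \<open>n' = A n + c\<close> with \<open>A x + c\<close> the drift of the equation, and the product rule with
  \<open>K = \<Gamma>\<close> shows that \<open>n + \<Gamma> I\<close> is a solution. The difference of two solutions solves \<open>D' = A D\<close>,
  \<open>D(0) = 0\<close>, so it vanishes.\<close>

section \<open>Matrices\<close>

text \<open>The obstacle is that the notion of integral fixes neither the version nor its
  approximating simple processes, and gives no hold on single paths: it speaks of convergence in
  probability at each fixed time. The drift, however, has to be computed path by path. Replacing
  every version by one explicit pathwise limit closes this gap. It also serves uniqueness, since two
  solutions may come with different versions of the integral of \<Sigma>.

  The product rule has no bracket term because K is deterministic and of finite variation on compact
  parts of [0,T); on a grid it is an exact algebraic identity. It requires the integrals of G and of
  K G to be limits along the same grids, so the levels are chosen for both at once.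

  Since R(T) = 0, the matrix \<Gamma>(t,T) degenerates as t tends to T, and its inverse cannot be
  extended to T. The constant vector is v = R(0)^(-1) (\<Psi>(T) b - q(T) - a), determined by the
  requirement that \<Phi>(t) (a + P(t) v + q(t)) takes the value b at t = T.\<close>

lemma norm_matrix_vector_mult_le:
  fixes A :: "real^'n^'m"
  shows "norm (A *v x) \<le> norm A * norm x"
proof -
  \<comment> \<open>On nested vectors \<open>norm\<close> is the Frobenius norm, so the
    Cauchy-Schwarz inequality can be applied row by row.\<close>
  have "norm (A *v x) \<le> L2_set (\<lambda>i. norm (A $ i) * norm x) UNIV"
    unfolding norm_vec_def[of "A *v x"]
  proof (rule L2_set_mono)
    fix i
    show "norm ((A *v x) $ i) \<le> norm (A $ i) * norm x"
      by (metis Cauchy_Schwarz_ineq2 matrix_vector_mul_component real_norm_def)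
  qed simp
  also have "\<dots> = norm A * norm x"
    by (simp add: norm_vec_def L2_set_left_distrib)
  finally show ?thesis .
qed

lemma bounded_bilinear_matrix_vector_mult:
  "bounded_bilinear ((*v) :: real^'n^'m \<Rightarrow> real^'n \<Rightarrow> real^'m)"
  by (rule bounded_bilinear.intro)
    (auto simp: matrix_vector_right_distrib matrix_vector_mult_add_rdistrib
      scaleR_matrix_vector_assoc[symmetric] matrix_vector_mult_scaleR
      intro!: exI[of _ 1] norm_matrix_vector_mult_le)

lemma bounded_bilinear_matrix_mult:
  "bounded_bilinear ((**) :: real^'n^'m \<Rightarrow> real^'k^'n \<Rightarrow> real^'k^'m)"
  unfolding bilinear_conv_bounded_bilinear[symmetric] bilinear_def
  by (auto intro!: linearI simp: matrix_add_ldistrib matrix_matrix_mult_def vec_eq_iff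
      algebra_simps sum.distrib sum_distrib_left)

lemma bounded_linear_transpose: "bounded_linear (transpose :: real^'n^'m \<Rightarrow> real^'m^'n)"
  unfolding linear_conv_bounded_linear[symmetric]
  by (rule linearI) (simp_all add: transpose_def vec_eq_iff)

lemmas matrix_vector_mult_continuous_on [continuous_intros] =
  bounded_bilinear.continuous_on[OF bounded_bilinear_matrix_vector_mult]
lemmas matrix_mult_continuous_on [continuous_intros] =
  bounded_bilinear.continuous_on[OF bounded_bilinear_matrix_mult]
lemmas transpose_continuous_on [continuous_intros] =
  bounded_linear.continuous_on[OF bounded_linear_transpose]

lemma borel_measurable_matrix_vector_mult [measurable (raw)]:
  fixes A :: "'a \<Rightarrow> real^'n^'m" and x :: "'a \<Rightarrow> real^'n"
  assumes "A \<in> borel_measurable M" "x \<in> borel_measurable M"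
  shows "(\<lambda>w. A w *v x w) \<in> borel_measurable M"
  by (rule borel_measurable_continuous_Pair[OF assms])
     (auto intro!: continuous_intros)

section \<open>Simple integrals with respect to a Wiener process\<close>

lemma simple_integral_cong:
  assumes "\<And>i. i < N \<Longrightarrow> H i \<omega> = H' i \<omega>"
  shows "simple_integral W N \<tau> H \<omega> = simple_integral W N \<tau> H' \<omega>"
  using assms by (simp add: simple_integral_def)

text \<open>The integral is built for any filtration relative to which \<open>W\<close> is a Wiener
  process; the augmented filtration enters only with the bridge equation.\<close>

locale wiener = prob_space M for M :: "'w measure" +
  fixes F :: "real \<Rightarrow> 'w measure" and W :: "real \<Rightarrow> 'w \<Rightarrow> real^'p"
  assumes filtered: "filtration (space M) F"
    and subalg: "\<And>t. subalgebra M (F t)"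
    and wiener: "wiener_process M F W"
begin

lemma space_F [simp]: "space (F t) = space M"
  using subalg by (simp add: subalgebra_def)

lemma measurable_mono:
  "s \<le> t \<Longrightarrow> X \<in> borel_measurable (F s) \<Longrightarrow> X \<in> borel_measurable (F t)"
  using filtration.sets_F_mono[OF filtered]
  by (auto simp: measurable_def)

lemma measurable_F_M: "X \<in> borel_measurable (F t) \<Longrightarrow> X \<in> borel_measurable M"
  using subalg by (auto intro: measurable_from_subalg)

lemma W_measurable: "0 \<le> s \<Longrightarrow> s \<le> t \<Longrightarrow> W s \<in> borel_measurable (F t)"
  using wiener measurable_mono unfolding wiener_process_def by blast

lemma W_measurable_M: "0 \<le> s \<Longrightarrow> W s \<in> borel_measurable M"
  using W_measurable measurable_F_M by blast

section \<open>Moments and independence of the Wiener increments\<close>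

lemma increment_distributed:
  assumes "0 \<le> s" "s < t"
  shows "distributed M lborel (\<lambda>\<omega>. (W t \<omega> - W s \<omega>) $ i)
    (\<lambda>x. ennreal (normal_density 0 (sqrt (t - s)) x))"
  using assms wiener unfolding wiener_process_def by blast

lemma increment_integrable:
  assumes "0 \<le> s" "s < t"
  shows "integrable M (\<lambda>\<omega>. (W t \<omega> - W s \<omega>) $ i)"
  by (rule distributed_integrable_var[OF increment_distributed[OF assms]])
     (use assms integrable_normal_moment_nz_1[of "sqrt (t - s)" 0] in auto)

lemma increment_expectation:
  assumes "0 \<le> s" "s < t"
  shows "expectation (\<lambda>\<omega>. (W t \<omega> - W s \<omega>) $ i) = 0"
  by (rule normal_distributed_expectation[OF _ increment_distributed[OF assms]])
     (use assms in auto)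

lemma increment_square:
  assumes "0 \<le> s" "s < t"
  shows "integrable M (\<lambda>\<omega>. ((W t \<omega> - W s \<omega>) $ i)\<^sup>2)"
    and "expectation (\<lambda>\<omega>. ((W t \<omega> - W s \<omega>) $ i)\<^sup>2) = t - s"
proof -
  show "integrable M (\<lambda>\<omega>. ((W t \<omega> - W s \<omega>) $ i)\<^sup>2)"
    using distributed_integrable[OF increment_distributed[OF assms], of "\<lambda>x. x\<^sup>2"]
      integrable_normal_moment[of "sqrt (t - s)" 0 2] assms by auto
  show "expectation (\<lambda>\<omega>. ((W t \<omega> - W s \<omega>) $ i)\<^sup>2) = t - s"
    using normal_distributed_variance[OF _ increment_distributed[OF assms], of i] assms
    by (simp add: increment_expectation[OF assms, of i, simplified])
qed

lemma increment_norm_square: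
  assumes "0 \<le> s" "s < t"
  shows "integrable M (\<lambda>\<omega>. (norm (W t \<omega> - W s \<omega>))\<^sup>2)"
    and "expectation (\<lambda>\<omega>. (norm (W t \<omega> - W s \<omega>))\<^sup>2) = real CARD('p) * (t - s)"
proof -
  have eq: "(norm (W t \<omega> - W s \<omega>))\<^sup>2 = (\<Sum>i\<in>UNIV. ((W t \<omega> - W s \<omega>) $ i)\<^sup>2)" for \<omega>
    by (simp add: norm_vec_def L2_set_def sum_nonneg)
  show "integrable M (\<lambda>\<omega>. (norm (W t \<omega> - W s \<omega>))\<^sup>2)"
    unfolding eq using increment_square(1)[OF assms] by (intro Bochner_Integration.integrable_sum)
  show "expectation (\<lambda>\<omega>. (norm (W t \<omega> - W s \<omega>))\<^sup>2) = real CARD('p) * (t - s)"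
    unfolding eq using increment_square[OF assms]
    by (subst Bochner_Integration.integral_sum) auto
qed

text \<open>The preimages of Borel sets under an increment already form a sigma-algebra, which
  absorbs the one generated by \<open>f\<close> of the increment; independence passes to the smaller
  systems.\<close>

lemma indep_increment:
  fixes X :: "'w \<Rightarrow> real" and f :: "real^'p \<Rightarrow> real"
  assumes "0 \<le> s" "s < t" and X: "X \<in> borel_measurable (F s)" and f: "f \<in> borel_measurable borel"
  shows "indep_var borel X borel (\<lambda>\<omega>. f (W t \<omega> - W s \<omega>))"
  unfolding indep_var_eq
proof (intro conjI)
  have D[measurable]: "(\<lambda>\<omega>. W t \<omega> - W s \<omega>) \<in> borel_measurable M"
    using assms by (intro borel_measurable_diff W_measurable_M) auto
  note f[measurable]
  show "random_variable borel X" using X by (rule measurable_F_M)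
  show "random_variable borel (\<lambda>\<omega>. f (W t \<omega> - W s \<omega>))" by measurable
  have ind: "indep_set (sets (F s)) {(\<lambda>\<omega>. W t \<omega> - W s \<omega>) -` A \<inter> space M | A. A \<in> sets borel}"
    (is "indep_set _ ?D")
    using assms wiener unfolding wiener_process_def by blast
  have 1: "sigma_sets (space M) {X -` A \<inter> space M | A. A \<in> sets borel} \<subseteq> sets (F s)"
    using measurable_sets[OF X]
    by (intro sets.sigma_sets_subset[of _ "F s", unfolded space_F]) auto
  have 2: "sigma_sets (space M) {(\<lambda>\<omega>. f (W t \<omega> - W s \<omega>)) -` A \<inter> space M | A. A \<in> sets borel} \<subseteq> ?D"
  proof -
    have s: "{(\<lambda>\<omega>. f (W t \<omega> - W s \<omega>)) -` A \<inter> space M | A. A \<in> sets borel} \<subseteq> ?D"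
      using measurable_sets_borel[OF f] by (force simp: vimage_def)
    have D: "?D = sets (vimage_algebra (space M) (\<lambda>\<omega>. W t \<omega> - W s \<omega>) borel)"
      by (simp add: sets_vimage_algebra2)
    show "sigma_sets (space M) {(\<lambda>\<omega>. f (W t \<omega> - W s \<omega>)) -` A \<inter> space M | A. A \<in> sets borel} \<subseteq> ?D"
      using sets.sigma_sets_subset[OF s[unfolded D]] unfolding D by simp
  qed
  show "indep_set (sigma_sets (space M) {X -` A \<inter> space M |A. A \<in> sets borel})
     (sigma_sets (space M) {(\<lambda>\<omega>. f (W t \<omega> - W s \<omega>)) -` A \<inter> space M |A. A \<in> sets borel})"
    using ind 1 2 unfolding indep_set_def
    by (elim indep_sets_mono_sets) (auto split: bool.split)
qed

text \<open>The martingale property in the form that removes cross terms from second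
  moments.\<close>

lemma increment_orthogonal:
  assumes st: "0 \<le> s" "s < t" and X: "X \<in> borel_measurable (F s)" and iX: "integrable M X"
  shows "integrable M (\<lambda>\<omega>. X \<omega> * (W t \<omega> - W s \<omega>) $ i)"
    and "expectation (\<lambda>\<omega>. X \<omega> * (W t \<omega> - W s \<omega>) $ i) = 0"
proof -
  have ind: "indep_var borel X borel (\<lambda>\<omega>. (W t \<omega> - W s \<omega>) $ i)"
    by (rule indep_increment[OF st X, of "\<lambda>x. x $ i"]) simp
  show "integrable M (\<lambda>\<omega>. X \<omega> * (W t \<omega> - W s \<omega>) $ i)"
    by (rule indep_var_integrable[OF ind iX increment_integrable[OF st]])
  show "expectation (\<lambda>\<omega>. X \<omega> * (W t \<omega> - W s \<omega>) $ i) = 0"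
    unfolding indep_var_lebesgue_integral[OF ind iX increment_integrable[OF st]]
      increment_expectation[OF st] by simp
qed

lemma increment_product:
  assumes st: "0 \<le> s" "s < t" and X: "X \<in> borel_measurable (F s)" and iX: "integrable M X"
  shows "integrable M (\<lambda>\<omega>. X \<omega> * (norm (W t \<omega> - W s \<omega>))\<^sup>2)"
    and "expectation (\<lambda>\<omega>. X \<omega> * (norm (W t \<omega> - W s \<omega>))\<^sup>2) = real CARD('p) * (t - s) * expectation X"
proof -
  have ind: "indep_var borel X borel (\<lambda>\<omega>. (norm (W t \<omega> - W s \<omega>))\<^sup>2)"
    by (rule indep_increment[OF st X, of "\<lambda>x. (norm x)\<^sup>2"]) simp
  show "integrable M (\<lambda>\<omega>. X \<omega> * (norm (W t \<omega> - W s \<omega>))\<^sup>2)"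
    by (rule indep_var_integrable[OF ind iX increment_norm_square(1)[OF st]])
  show "expectation (\<lambda>\<omega>. X \<omega> * (norm (W t \<omega> - W s \<omega>))\<^sup>2) = real CARD('p) * (t - s) * expectation X"
    unfolding indep_var_lebesgue_integral[OF ind iX increment_norm_square(1)[OF st]]
      increment_norm_square(2)[OF st] by simp
qed

text \<open>The conclusion carries \<open>0 \<le> \<rho> n\<close> through the induction because
  \<open>W\<close> is adapted at nonnegative times only.\<close>

lemma simple_integral_measurable:
  assumes "\<And>j. j < n \<Longrightarrow> \<rho> j \<le> \<rho> (Suc j)" "0 \<le> \<rho> 0"
    and "\<And>j. j < n \<Longrightarrow> H j \<in> borel_measurable (F (\<rho> j))"
  shows "simple_integral W n \<rho> H \<in> borel_measurable (F (\<rho> n)) \<and> 0 \<le> \<rho> n"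
  using assms
proof (induction n)
  case 0
  then show ?case by (simp add: simple_integral_def[abs_def])
next
  case (Suc n)
  have IH: "simple_integral W n \<rho> H \<in> borel_measurable (F (\<rho> n))" "0 \<le> \<rho> n"
    using Suc by auto
  have le: "\<rho> n \<le> \<rho> (Suc n)" using Suc.prems by simp
  have [measurable]: "simple_integral W n \<rho> H \<in> borel_measurable (F (\<rho> (Suc n)))"
    "H n \<in> borel_measurable (F (\<rho> (Suc n)))"
    "W (\<rho> n) \<in> borel_measurable (F (\<rho> (Suc n)))"
    "W (\<rho> (Suc n)) \<in> borel_measurable (F (\<rho> (Suc n)))"
    using IH Suc.prems le by (auto intro: measurable_mono[OF le] W_measurable order_trans[OF _ le])
  have "simple_integral W (Suc n) \<rho> H = (\<lambda>\<omega>. simple_integral W n \<rho> H \<omega> +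
      H n \<omega> *v (W (\<rho> (Suc n)) \<omega> - W (\<rho> n) \<omega>))"
    by (simp add: simple_integral_def fun_eq_iff)
  then show ?case using IH le by simp
qed

text \<open>In the induction the cross term between the partial integral and the next summand has
  mean zero, so only squares remain. Bounding \<open>H n \<omega> *v D \<omega>\<close> by the
  product of the norms turns the Ito isometry into an inequality; its price is the factor
  \<open>CARD('p)\<close>, the second moment of an increment per unit of time.\<close>

lemma simple_integral_L2:
  assumes mono: "\<And>j. j < n \<Longrightarrow> \<rho> j \<le> \<rho> (Suc j)" and "0 \<le> \<rho> 0"
    and H: "\<And>j. j < n \<Longrightarrow> H j \<in> borel_measurable (F (\<rho> j))"
    and bdd: "\<And>j \<omega>. j < n \<Longrightarrow> \<omega> \<in> space M \<Longrightarrow> norm (H j \<omega>) \<le> C"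
  shows "integrable M (\<lambda>\<omega>. (norm (simple_integral W n \<rho> H \<omega>))\<^sup>2) \<and>
    expectation (\<lambda>\<omega>. (norm (simple_integral W n \<rho> H \<omega>))\<^sup>2)
      \<le> real CARD('p) * (\<Sum>j<n. (\<rho> (Suc j) - \<rho> j) * expectation (\<lambda>\<omega>. (norm (H j \<omega>))\<^sup>2))"
  using assms
proof (induction n)
  case 0
  then show ?case by (simp add: simple_integral_def)
next
  case (Suc n)
  define S where "S = simple_integral W n \<rho> H"
  define D where "D = (\<lambda>\<omega>. W (\<rho> (Suc n)) \<omega> - W (\<rho> n) \<omega>)"
  have le: "\<rho> n \<le> \<rho> (Suc n)" using Suc.prems by simp
  have S[measurable]: "S \<in> borel_measurable (F (\<rho> n))" and pos: "0 \<le> \<rho> n"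
    using simple_integral_measurable[of n \<rho> H] Suc.prems unfolding S_def by auto
  have Hm[measurable]: "H n \<in> borel_measurable (F (\<rho> n))" using Suc.prems by simp
  have IH: "integrable M (\<lambda>\<omega>. (norm (S \<omega>))\<^sup>2)"
    "expectation (\<lambda>\<omega>. (norm (S \<omega>))\<^sup>2)
      \<le> real CARD('p) * (\<Sum>j<n. (\<rho> (Suc j) - \<rho> j) * expectation (\<lambda>\<omega>. (norm (H j \<omega>))\<^sup>2))"
    using Suc unfolding S_def by auto
  have step: "simple_integral W (Suc n) \<rho> H \<omega> = S \<omega> + H n \<omega> *v D \<omega>" for \<omega>
    by (simp add: simple_integral_def S_def D_def)
  show ?case
  \<comment> \<open>Grid steps may have length zero, where no normal density exists; the increment
    then vanishes identically.\<close>
  proof (cases "\<rho> n = \<rho> (Suc n)")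
    case True
    then show ?thesis using IH by (simp add: step D_def)
  next
    case False
    then have lt: "\<rho> n < \<rho> (Suc n)" using le by simp
    note SM[measurable] = measurable_F_M[OF S] and HM[measurable] = measurable_F_M[OF Hm]
    have DM[measurable]: "D \<in> borel_measurable M"
      unfolding D_def using pos lt by (intro borel_measurable_diff W_measurable_M) auto
    have bH: "norm (H n \<omega>) \<le> C" if "\<omega> \<in> space M" for \<omega> using Suc.prems that by simp
    have "integrable M (\<lambda>\<omega>. (norm (H n \<omega>))\<^sup>2)"
      by (rule integrable_const_bound[of _ "C\<^sup>2"]) (auto intro!: AE_I2 power_mono bH)
    note HD = increment_product[OF pos lt _ this, folded D_def]
    \<comment> \<open>\<open>X i\<close> is the inner product of \<open>S\<close> with the i-th
      column of \<open>H n\<close>, that is, the weight of the i-th coordinate of the increment in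
      the cross term. It is known at time \<open>\<rho> n\<close>.\<close>
    define X where "X = (\<lambda>i \<omega>. S \<omega> \<bullet> (H n \<omega> *v axis i 1))"
    have X: "X i \<in> borel_measurable (F (\<rho> n))" for i
      unfolding X_def by measurable
    \<comment> \<open>\<open>H n\<close> is bounded and x \<le> x^2 + 1, so square integrability of
      \<open>S\<close> yields integrability of \<open>X i\<close>.\<close>
    have nX: "norm (X i \<omega>) \<le> \<bar>C\<bar> * (norm (S \<omega>)^2 + 1)" if "\<omega> \<in> space M" for i \<omega>
    proof -
      have "norm (X i \<omega>) \<le> norm (S \<omega>) * norm (H n \<omega> *v axis i 1)"
        unfolding X_def real_norm_def by (rule Cauchy_Schwarz_ineq2)
      also have "\<dots> \<le> norm (S \<omega>) * (norm (H n \<omega>) * norm (axis i (1::real)))"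
        by (intro mult_left_mono norm_matrix_vector_mult_le) simp
      also have "\<dots> = norm (H n \<omega>) * norm (S \<omega>)" by simp
      also have "\<dots> \<le> \<bar>C\<bar> * (norm (S \<omega>)^2 + 1)"
      proof (rule mult_mono)
        show "norm (H n \<omega>) \<le> \<bar>C\<bar>"
          using bH[OF that] by simp
        show "norm (S \<omega>) \<le> norm (S \<omega>)^2 + 1"
          using zero_le_power2[of "norm (S \<omega>) - 1/2"] by (simp add: power2_eq_square algebra_simps)
      qed auto
      finally show ?thesis .
    qed
    have iX: "integrable M (X i)" for i
    proof (rule Bochner_Integration.integrable_bound)
      show "integrable M (\<lambda>\<omega>. \<bar>C\<bar> * (norm (S \<omega>)^2 + 1))" using IH by auto
      show "X i \<in> borel_measurable M" using X by (rule measurable_F_M)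
    qed (use nX in \<open>force intro!: AE_I2\<close>)
    note cross = increment_orthogonal[OF pos lt X iX, folded D_def]
    have inner: "S \<omega> \<bullet> (H n \<omega> *v D \<omega>) = (\<Sum>i\<in>UNIV. X i \<omega> * D \<omega> $ i)" for \<omega>
      unfolding X_def dot_lmul_matrix[symmetric]
      by (simp add: inner_axis) (simp add: inner_vec_def)
    have icross: "integrable M (\<lambda>\<omega>. S \<omega> \<bullet> (H n \<omega> *v D \<omega>))"
      "expectation (\<lambda>\<omega>. S \<omega> \<bullet> (H n \<omega> *v D \<omega>)) = 0"
      unfolding inner using cross unfolding D_def
      by (auto intro!: Bochner_Integration.integrable_sum simp: Bochner_Integration.integral_sum)
    have leHD: "(norm (H n \<omega> *v D \<omega>))\<^sup>2 \<le> (norm (H n \<omega>))\<^sup>2 * (norm (D \<omega>))\<^sup>2" for \<omega>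
      unfolding power_mult_distrib[symmetric] by (intro power_mono norm_matrix_vector_mult_le) simp
    have iHD: "integrable M (\<lambda>\<omega>. (norm (H n \<omega> *v D \<omega>))\<^sup>2)"
      using HD(1)
    proof (rule Bochner_Integration.integrable_bound)
      show "(\<lambda>\<omega>. (norm (H n \<omega> *v D \<omega>))\<^sup>2) \<in> borel_measurable M" by measurable
    qed (use leHD in \<open>auto intro!: AE_I2 simp: D_def\<close>)
    have expand: "(norm (simple_integral W (Suc n) \<rho> H \<omega>))\<^sup>2 =
        (norm (S \<omega>))\<^sup>2 + 2 * (S \<omega> \<bullet> (H n \<omega> *v D \<omega>)) + (norm (H n \<omega> *v D \<omega>))\<^sup>2" for \<omega>
      unfolding step by (simp add: power2_norm_eq_inner inner_add inner_commute)
    have "expectation (\<lambda>\<omega>. (norm (H n \<omega> *v D \<omega>))\<^sup>2) \<le>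
        real CARD('p) * (\<rho> (Suc n) - \<rho> n) * expectation (\<lambda>\<omega>. (norm (H n \<omega>))\<^sup>2)"
      using integral_mono[OF iHD HD(1)] leHD HD(2) unfolding D_def by simp
    then have "expectation (\<lambda>\<omega>. (norm (simple_integral W (Suc n) \<rho> H \<omega>))\<^sup>2)
      \<le> real CARD('p) * (\<Sum>j<Suc n. (\<rho> (Suc j) - \<rho> j) * expectation (\<lambda>\<omega>. (norm (H j \<omega>))\<^sup>2))"
      unfolding expand using IH icross iHD by (simp add: algebra_simps)
    then show ?thesis unfolding expand using IH icross iHD by auto
  qed
qed

text \<open>Replacing \<open>H j\<close> by \<open>indicator (A j) *\<^sub>R H j\<close> with \<open>A j\<close> known at time \<open>\<rho> j\<close> gives another
  simple integral: stopping and truncating thus reduce to Chebyshev's inequality.\<close>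

lemma simple_integral_Chebyshev:
  assumes mono: "\<And>j. j < n \<Longrightarrow> \<rho> j \<le> \<rho> (Suc j)" and "0 \<le> \<rho> 0"
    and H: "\<And>j. j < n \<Longrightarrow> H j \<in> borel_measurable (F (\<rho> j))"
    and bdd: "\<And>j \<omega>. j < n \<Longrightarrow> \<omega> \<in> space M \<Longrightarrow> norm (H j \<omega>) \<le> C"
    and total: "\<And>\<omega>. \<omega> \<in> space M \<Longrightarrow> (\<Sum>j<n. (\<rho> (Suc j) - \<rho> j) * (norm (H j \<omega>))\<^sup>2) \<le> \<delta>"
    and "0 < \<epsilon>"
  shows "prob {\<omega>\<in>space M. \<epsilon> < norm (simple_integral W n \<rho> H \<omega>)} \<le> real CARD('p) * \<delta> / \<epsilon>\<^sup>2"
proof -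
  let ?S = "simple_integral W n \<rho> H"
  have [measurable]: "?S \<in> borel_measurable M"
    using simple_integral_measurable[of n \<rho> H] assms by (auto intro: measurable_F_M)
  note L2 = simple_integral_L2[OF mono assms(2) H bdd]
  have i: "integrable M (\<lambda>\<omega>. (norm (H j \<omega>))\<^sup>2)" if "j < n" for j
    using H[OF that, THEN measurable_F_M] bdd[OF that]
    by (intro integrable_const_bound[of _ "C\<^sup>2"]) (auto intro!: AE_I2 power_mono)
  have "prob {\<omega>\<in>space M. \<epsilon> < norm (?S \<omega>)} \<le> prob {\<omega>\<in>space M. \<epsilon>\<^sup>2 \<le> (norm (?S \<omega>))\<^sup>2}"
    using \<open>0 < \<epsilon>\<close> by (intro finite_measure_mono) (auto intro!: power_mono)
  also have "\<dots> \<le> expectation (\<lambda>\<omega>. (norm (?S \<omega>))\<^sup>2) / \<epsilon>\<^sup>2"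
    using L2 \<open>0 < \<epsilon>\<close> by (intro integral_Markov_inequality_measure[where A="{}"]) auto
  also have "\<dots> \<le> real CARD('p) * \<delta> / \<epsilon>\<^sup>2"
  proof (rule divide_right_mono)
    have "(\<Sum>j<n. (\<rho> (Suc j) - \<rho> j) * expectation (\<lambda>\<omega>. (norm (H j \<omega>))\<^sup>2)) =
        expectation (\<lambda>\<omega>. \<Sum>j<n. (\<rho> (Suc j) - \<rho> j) * (norm (H j \<omega>))\<^sup>2)"
      using i by (subst Bochner_Integration.integral_sum) auto
    also have "\<dots> \<le> expectation (\<lambda>\<omega>. \<delta>)"
      using i total by (intro integral_mono) auto
    finally have "(\<Sum>j<n. (\<rho> (Suc j) - \<rho> j) * expectation (\<lambda>\<omega>. (norm (H j \<omega>))\<^sup>2)) \<le> \<delta>"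
      by (simp add: prob_space)
    then show "expectation (\<lambda>\<omega>. (norm (?S \<omega>))\<^sup>2) \<le> real CARD('p) * \<delta>"
      using L2 by (meson mult_left_mono of_nat_0_le_iff order_trans)
  qed simp
  finally show ?thesis .
qed

text \<open>A Lenglart-type inequality. Unless the accumulated squares exceed \<delta>, the integral
  agrees with that of an integrand switched off before its own accumulated squares pass \<delta>,
  and Chebyshev's inequality controls the latter.\<close>

lemma simple_integral_truncated:
  assumes mono: "\<And>j. j < n \<Longrightarrow> \<rho> j \<le> \<rho> (Suc j)" and "0 \<le> \<rho> 0"
    and H: "\<And>j. j < n \<Longrightarrow> H j \<in> borel_measurable (F (\<rho> j))"
    and bdd: "\<And>j \<omega>. j < n \<Longrightarrow> \<omega> \<in> space M \<Longrightarrow> norm (H j \<omega>) \<le> C"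
    and "0 < \<epsilon>" "0 \<le> \<delta>"
  shows "prob {\<omega>\<in>space M. \<epsilon> < norm (simple_integral W n \<rho> H \<omega>)} \<le>
    prob {\<omega>\<in>space M. \<delta> < (\<Sum>j<n. (\<rho> (Suc j) - \<rho> j) * (norm (H j \<omega>))\<^sup>2)} +
    real CARD('p) * \<delta> / \<epsilon>\<^sup>2"
proof -
  define V where "V = (\<lambda>k \<omega>. \<Sum>j<k. (\<rho> (Suc j) - \<rho> j) * (norm (H j \<omega>))\<^sup>2)"
  \<comment> \<open>The test uses \<open>V (Suc j)\<close>, which contains the j-th square but
    depends only on \<open>H 0\<close> to \<open>H j\<close>, hence is known at
    \<open>\<rho> j\<close>. The truncated total therefore never passes \<delta>, not even by one
    summand.\<close>
  define H' where "H' = (\<lambda>j \<omega>. (if V (Suc j) \<omega> \<le> \<delta> then 1 else 0) *\<^sub>R H j \<omega>)"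
  have \<rho>le: "\<rho> j \<le> \<rho> k" if "j \<le> k" "k < n" for j k
    using that by (induction k) (auto simp: le_Suc_eq intro: order_trans[OF _ mono])
  have V[measurable]: "V (Suc k) \<in> borel_measurable (F (\<rho> k))" if "k < n" for k
    unfolding V_def
  proof (rule borel_measurable_sum)
    fix j assume "j \<in> {..<Suc k}"
    then have [measurable]: "H j \<in> borel_measurable (F (\<rho> k))"
      using that by (auto intro: measurable_mono[OF \<rho>le H])
    show "(\<lambda>\<omega>. (\<rho> (Suc j) - \<rho> j) * (norm (H j \<omega>))\<^sup>2) \<in> borel_measurable (F (\<rho> k))"
      by measurable
  qed
  have VM[measurable]: "V n \<in> borel_measurable M"
    unfolding V_def
  proof (rule borel_measurable_sum)
    fix j assume "j \<in> {..<n}"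
    then have [measurable]: "H j \<in> borel_measurable M" using H by (auto intro: measurable_F_M)
    show "(\<lambda>\<omega>. (\<rho> (Suc j) - \<rho> j) * (norm (H j \<omega>))\<^sup>2) \<in> borel_measurable M"
      by measurable
  qed
  have H': "H' j \<in> borel_measurable (F (\<rho> j))" if "j < n" for j
    unfolding H'_def using V[OF that] H[OF that] by measurable
  have b': "norm (H' j \<omega>) \<le> \<bar>C\<bar>" if "j < n" "\<omega> \<in> space M" for j \<omega>
    using bdd[OF that] by (auto simp: H'_def)
  have Vmono: "V j \<omega> \<le> V k \<omega>" if "j \<le> k" "k \<le> n" for j k \<omega>
    unfolding V_def using that mono by (intro sum_mono2) auto
  have total: "(\<Sum>j<k. (\<rho> (Suc j) - \<rho> j) * (norm (H' j \<omega>))\<^sup>2) \<le> min \<delta> (V k \<omega>)" if "k \<le> n" for k \<omega>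
    using that
  proof (induction k)
    case (Suc k)
    show ?case
    proof (cases "V (Suc k) \<omega> \<le> \<delta>")
      case True
      then show ?thesis using Suc by (simp add: H'_def V_def)
    next
      case False
      then show ?thesis using Suc Vmono[of k "Suc k" \<omega>] by (auto simp: H'_def)
    qed
  qed (use \<open>0 \<le> \<delta>\<close> in \<open>simp add: V_def\<close>)
  have [measurable]: "simple_integral W n \<rho> H' \<in> borel_measurable M"
    using simple_integral_measurable[of n \<rho> H'] assms H' by (auto intro: measurable_F_M)
  have "prob {\<omega>\<in>space M. \<epsilon> < norm (simple_integral W n \<rho> H \<omega>)} \<le>
    prob ({\<omega>\<in>space M. \<delta> < V n \<omega>} \<union> {\<omega>\<in>space M. \<epsilon> < norm (simple_integral W n \<rho> H' \<omega>)})"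
  proof (rule finite_measure_mono)
    have "simple_integral W n \<rho> H' \<omega> = simple_integral W n \<rho> H \<omega>" if "V n \<omega> \<le> \<delta>" for \<omega>
    proof (rule simple_integral_cong)
      fix j assume "j < n"
      then have "V (Suc j) \<omega> \<le> \<delta>" using Vmono[of "Suc j" n \<omega>] that by simp
      then show "H' j \<omega> = H j \<omega>" by (simp add: H'_def)
    qed
    then show "{\<omega>\<in>space M. \<epsilon> < norm (simple_integral W n \<rho> H \<omega>)} \<subseteq>
      {\<omega>\<in>space M. \<delta> < V n \<omega>} \<union> {\<omega>\<in>space M. \<epsilon> < norm (simple_integral W n \<rho> H' \<omega>)}"
      by (smt (verit, best) UnI1 UnI2 mem_Collect_eq subsetI)
  qed measurable
  also have "\<dots> \<le> prob {\<omega>\<in>space M. \<delta> < V n \<omega>} +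
      prob {\<omega>\<in>space M. \<epsilon> < norm (simple_integral W n \<rho> H' \<omega>)}"
    by (rule measure_Un_le) measurable
  also have "prob {\<omega>\<in>space M. \<epsilon> < norm (simple_integral W n \<rho> H' \<omega>)} \<le> real CARD('p) * \<delta> / \<epsilon>\<^sup>2"
    by (rule simple_integral_Chebyshev[OF mono assms(2) H' b' _ \<open>0 < \<epsilon>\<close>]) (use total[of n] in auto)
  finally show ?thesis by (simp add: V_def)
qed

text \<open>The integrand is switched off once a partial integral has passed \<epsilon>. From then
  on the stopped integral is frozen, so its terminal value alone reveals an earlier passage, and the
  bound for a single time becomes a bound for the maximum.\<close>

lemma simple_integral_maximal:
  assumes mono: "\<And>j. j < n \<Longrightarrow> \<rho> j \<le> \<rho> (Suc j)" and "0 \<le> \<rho> 0"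
    and H: "\<And>j. j < n \<Longrightarrow> H j \<in> borel_measurable (F (\<rho> j))"
    and bdd: "\<And>j \<omega>. j < n \<Longrightarrow> \<omega> \<in> space M \<Longrightarrow> norm (H j \<omega>) \<le> C"
    and "0 < \<epsilon>"
  shows "prob {\<omega>\<in>space M. \<exists>k\<le>n. \<epsilon> < norm (simple_integral W k \<rho> H \<omega>)} \<le>
    real CARD('p) * ((\<rho> n - \<rho> 0) * C\<^sup>2) / \<epsilon>\<^sup>2"
proof -
  let ?S = "\<lambda>k. simple_integral W k \<rho> H"
  define H' where "H' = (\<lambda>j \<omega>. (if \<forall>i\<le>j. norm (?S i \<omega>) \<le> \<epsilon> then 1 else 0) *\<^sub>R H j \<omega>)"
  have \<rho>le: "\<rho> j \<le> \<rho> k" if "j \<le> k" "k < n" for j k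
    using that by (induction k) (auto simp: le_Suc_eq intro: order_trans[OF _ mono])
  have S: "?S k \<in> borel_measurable (F (\<rho> j))" if "k \<le> j" "j < n" for k j
    using simple_integral_measurable[of k \<rho> H] assms that by (auto intro: measurable_mono[OF \<rho>le])
  have H': "H' j \<in> borel_measurable (F (\<rho> j))" if "j < n" for j
  proof -
    have [measurable]: "Measurable.pred (F (\<rho> j)) (\<lambda>\<omega>. norm (?S i \<omega>) \<le> \<epsilon>)" if "i \<in> {..j}" for i
    proof -
      have [measurable]: "?S i \<in> borel_measurable (F (\<rho> j))" using S that \<open>j < n\<close> by simp
      show ?thesis by measurable
    qed
    have [measurable]: "Measurable.pred (F (\<rho> j)) (\<lambda>\<omega>. \<forall>i\<in>{..j}. norm (?S i \<omega>) \<le> \<epsilon>)"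
      by measurable
    have [measurable]: "H j \<in> borel_measurable (F (\<rho> j))" using H that .
    have "H' j = (\<lambda>\<omega>. (if \<forall>i\<in>{..j}. norm (?S i \<omega>) \<le> \<epsilon> then 1 else 0) *\<^sub>R H j \<omega>)"
      by (auto simp: H'_def fun_eq_iff)
    also have "\<dots> \<in> borel_measurable (F (\<rho> j))" by measurable
    finally show ?thesis .
  qed
  have b': "norm (H' j \<omega>) \<le> \<bar>C\<bar>" if "j < n" "\<omega> \<in> space M" for j \<omega>
    using bdd[OF that] by (auto simp: H'_def)
  have total: "(\<Sum>j<k. (\<rho> (Suc j) - \<rho> j) * (norm (H' j \<omega>))\<^sup>2) \<le> (\<rho> k - \<rho> 0) * C\<^sup>2"
    if "k \<le> n" "\<omega> \<in> space M" for k \<omega>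
    using that
  proof (induction k)
    case (Suc k)
    have "(norm (H' k \<omega>))\<^sup>2 \<le> C\<^sup>2"
      using b'[of k \<omega>] Suc.prems by (metis Suc_le_lessD abs_norm_cancel abs_le_square_iff)
    then have "(\<rho> (Suc k) - \<rho> k) * (norm (H' k \<omega>))\<^sup>2 \<le> (\<rho> (Suc k) - \<rho> k) * C\<^sup>2"
      using mono[of k] Suc.prems by (intro mult_left_mono) auto
    with Suc show ?case by (simp add: algebra_simps)
  qed simp
  have [measurable]: "simple_integral W n \<rho> H' \<in> borel_measurable M"
    using simple_integral_measurable[of n \<rho> H'] assms H' by (auto intro: measurable_F_M)
  have stop: "\<exists>j\<le>k. \<epsilon> < norm (?S j \<omega>) \<Longrightarrow> \<epsilon> < norm (simple_integral W k \<rho> H' \<omega>)" for k \<omega>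
  proof (induction k)
    case 0
    then show ?case using \<open>0 < \<epsilon>\<close> by (simp add: simple_integral_def)
  next
    case (Suc k)
    show ?case
    proof (cases "\<forall>i\<le>k. norm (?S i \<omega>) \<le> \<epsilon>")
      case True
      then have "simple_integral W (Suc k) \<rho> H' \<omega> = ?S (Suc k) \<omega>"
        by (intro simple_integral_cong) (auto simp: H'_def)
      moreover have "\<epsilon> < norm (?S (Suc k) \<omega>)" using True Suc.prems by (metis le_SucE not_le)
      ultimately show ?thesis using Suc by simp
    next
      case False
      then have "\<exists>i\<le>k. \<epsilon> < norm (?S i \<omega>)" by (auto simp: not_le)
      moreover have "simple_integral W (Suc k) \<rho> H' \<omega> = simple_integral W k \<rho> H' \<omega>"
        using False by (auto simp: simple_integral_def H'_def)
      ultimately show ?thesis using Suc.IH by simp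
    qed
  qed
  have "prob {\<omega>\<in>space M. \<exists>k\<le>n. \<epsilon> < norm (?S k \<omega>)} \<le>
      prob {\<omega>\<in>space M. \<epsilon> < norm (simple_integral W n \<rho> H' \<omega>)}"
    using stop by (intro finite_measure_mono) (auto, measurable)
  also have "\<dots> \<le> real CARD('p) * ((\<rho> n - \<rho> 0) * C\<^sup>2) / \<epsilon>\<^sup>2"
    by (rule simple_integral_Chebyshev[OF mono assms(2) H' b' _ \<open>0 < \<epsilon>\<close>]) (use total[of n] in auto)
  finally show ?thesis .
qed

end

section \<open>Step integrals along dyadic grids\<close>

text \<open>A pathwise object: \<open>w\<close> is a single path and \<open>A\<close> a
  deterministic choice of values. Stopping by \<open>min t\<close> makes it a function of continuous
  time, for which uniform convergence can be discussed.\<close>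

definition step_integral ::
  "(real \<Rightarrow> real^'p) \<Rightarrow> nat \<Rightarrow> (nat \<Rightarrow> real) \<Rightarrow> (nat \<Rightarrow> real^'p^'d) \<Rightarrow> real \<Rightarrow> real^'d" where
  "step_integral w N \<tau> A t = (\<Sum>i<N. A i *v (w (min t (\<tau> (Suc i))) - w (min t (\<tau> i))))"

lemma grid_le:
  fixes \<tau> :: "nat \<Rightarrow> real"
  assumes "\<And>i. i < N \<Longrightarrow> \<tau> i \<le> \<tau> (Suc i)" "i \<le> j" "j \<le> N"
  shows "\<tau> i \<le> \<tau> j"
  using assms(2,3)
proof (induction j)
  case (Suc j)
  then show ?case using assms(1)[of j] by (cases "i = Suc j") auto
qed simp

text \<open>Cells are open on the left, to match \<open>simple_value\<close>.\<close>

lemma grid_cell: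
  fixes \<tau> :: "nat \<Rightarrow> real"
  assumes "\<tau> 0 < s" "s \<le> \<tau> N"
  shows "\<exists>i<N. \<tau> i < s \<and> s \<le> \<tau> (Suc i)"
  using assms
proof (induction N)
  case (Suc N)
  then show ?case by (cases "s \<le> \<tau> N") (auto simp: less_Suc_eq not_le)
qed simp

text \<open>Inside a cell only one summand moves: the earlier ones are complete and the later ones
  have not started.\<close>

lemma step_integral_increment:
  assumes mono: "\<And>i. i < N \<Longrightarrow> \<tau> i \<le> \<tau> (Suc i)"
    and i: "i < N" "\<tau> i \<le> u" "u \<le> v" "v \<le> \<tau> (Suc i)"
  shows "step_integral w N \<tau> A v - step_integral w N \<tau> A u = A i *v (w v - w u)"
proof -
  let ?d = "\<lambda>l. A l *v (w (min v (\<tau> (Suc l))) - w (min v (\<tau> l))) -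
      A l *v (w (min u (\<tau> (Suc l))) - w (min u (\<tau> l)))"
  have "step_integral w N \<tau> A v - step_integral w N \<tau> A u = (\<Sum>l<N. ?d l)"
    by (simp add: step_integral_def sum_subtractf)
  also have "\<dots> = (\<Sum>l\<in>{i}. ?d l)"
  proof (rule sum.mono_neutral_right)
    show "\<forall>l\<in>{..<N} - {i}. ?d l = 0"
    proof
      fix l assume l: "l \<in> {..<N} - {i}"
      consider "l < i" | "i < l" using l by force
      then show "?d l = 0"
      proof cases
        case 1
        then have "\<tau> l \<le> \<tau> i" "\<tau> (Suc l) \<le> \<tau> i"
          using grid_le[of N \<tau> l i] grid_le[of N \<tau> "Suc l" i] mono i by auto
        then have "min v (\<tau> l) = \<tau> l" "min u (\<tau> l) = \<tau> l"
            "min v (\<tau> (Suc l)) = \<tau> (Suc l)" "min u (\<tau> (Suc l)) = \<tau> (Suc l)"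
          using i by auto
        then show ?thesis by simp
      next
        case 2
        then have "\<tau> (Suc i) \<le> \<tau> l" "\<tau> (Suc i) \<le> \<tau> (Suc l)"
          using grid_le[of N \<tau> "Suc i" l] grid_le[of N \<tau> "Suc i" "Suc l"] mono l by auto
        then have "min v (\<tau> l) = v" "min u (\<tau> l) = u" "min v (\<tau> (Suc l)) = v" "min u (\<tau> (Suc l)) = u"
          using i by auto
        then show ?thesis by simp
      qed
    qed
  qed (use i in auto)
  also have "\<dots> = A i *v (w v - w u)"
    using i by (auto simp: min_def algebra_simps)
  finally show ?thesis .
qed

lemma step_integral_0: "(\<And>i. i \<le> N \<Longrightarrow> 0 \<le> \<tau> i) \<Longrightarrow> step_integral w N \<tau> A 0 = 0"
  by (simp add: step_integral_def min_def)

lemma step_integral_continuous_on: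
  assumes "continuous_on {0..} w" "\<And>i. i \<le> N \<Longrightarrow> 0 \<le> \<tau> i"
  shows "continuous_on {0..} (step_integral w N \<tau> A)"
  unfolding step_integral_def[abs_def]
  using assms
  by (intro continuous_intros continuous_on_compose2[OF assms(1)]) auto

text \<open>Links the two notions: stopping the grid at \<open>t\<close>, rather than the path,
  gives a simple integral on [0,t].\<close>

lemma simple_integral_stopped:
  "simple_integral W N (\<lambda>i. min t (\<tau> i)) \<eta> \<omega> = step_integral (\<lambda>s. W s \<omega>) N \<tau> (\<lambda>i. \<eta> i \<omega>) t"
  by (simp add: simple_integral_def step_integral_def)

lemma simple_value_eq:
  assumes mono: "\<And>i. i < N \<Longrightarrow> \<tau> i \<le> \<tau> (Suc i)"
    and i: "i < N" "\<tau> i < s" "s \<le> \<tau> (Suc i)"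
  shows "simple_value N \<tau> \<eta> s \<omega> = \<eta> i \<omega>"
proof -
  have "simple_value N \<tau> \<eta> s \<omega> = (\<Sum>l\<in>{i}. indicator {\<tau> l<..\<tau> (Suc l)} s *\<^sub>R \<eta> l \<omega>)"
    unfolding simple_value_def
  proof (rule sum.mono_neutral_right)
    show "\<forall>l\<in>{..<N} - {i}. indicator {\<tau> l<..\<tau> (Suc l)} s *\<^sub>R \<eta> l \<omega> = 0"
    proof
      fix l assume l: "l \<in> {..<N} - {i}"
      consider "l < i" | "i < l" using l by force
      then show "indicator {\<tau> l<..\<tau> (Suc l)} s *\<^sub>R \<eta> l \<omega> = 0"
      proof cases
        case 1
        then have "\<tau> (Suc l) \<le> \<tau> i"
          using grid_le[of N \<tau> "Suc l" i] mono i by auto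
        then show ?thesis using i by simp
      next
        case 2
        then have "\<tau> (Suc i) \<le> \<tau> l"
          using grid_le[of N \<tau> "Suc i" l] mono l by auto
        then show ?thesis using i by simp
      qed
    qed
  qed (use i in auto)
  then show ?thesis using i by simp
qed

section \<open>Nested dyadic grids and their refinement levels\<close>

definition dyadic :: "real \<Rightarrow> nat \<Rightarrow> nat \<Rightarrow> real" where
  "dyadic T m i = T * real i / 2 ^ m"

lemma dyadic_0 [simp]: "dyadic T m 0 = 0"
  by (simp add: dyadic_def)

lemma dyadic_top [simp]: "dyadic T m (2 ^ m) = T"
  by (simp add: dyadic_def)

lemma dyadic_nonneg: "0 \<le> T \<Longrightarrow> 0 \<le> dyadic T m i"
  by (simp add: dyadic_def)

lemma dyadic_mono: "0 \<le> T \<Longrightarrow> i \<le> j \<Longrightarrow> dyadic T m i \<le> dyadic T m j"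
  by (simp add: dyadic_def divide_right_mono mult_left_mono)

lemma dyadic_Suc: "dyadic T m (Suc i) = dyadic T m i + T / 2 ^ m"
  by (simp add: dyadic_def field_simps)

lemma dyadic_refine: "dyadic T m i = dyadic T (m + k) (i * 2 ^ k)"
  by (simp add: dyadic_def power_add)

text \<open>\<open>j div 2 ^ (m' - m)\<close> is the index of the coarse cell from which the fine
  cell \<open>j\<close> descends.\<close>

lemma dyadic_cell:
  assumes "0 \<le> T" "m \<le> m'" "j < 2 ^ m'"
  shows "j div 2 ^ (m' - m) < 2 ^ m"
    and "dyadic T m (j div 2 ^ (m' - m)) \<le> dyadic T m' j"
    and "dyadic T m' (Suc j) \<le> dyadic T m (Suc (j div 2 ^ (m' - m)))"
proof -
  define k where "k = m' - m"
  have m': "m' = m + k" using assms by (simp add: k_def)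
  show "j div 2 ^ (m' - m) < 2 ^ m"
    using assms(3) unfolding k_def[symmetric] m' by (simp add: power_add less_mult_imp_div_less)
  show "dyadic T m (j div 2 ^ (m' - m)) \<le> dyadic T m' j"
    unfolding k_def[symmetric] m' dyadic_refine[of T m _ k] using assms(1) by (intro dyadic_mono) auto
  have "Suc j \<le> Suc (j div 2 ^ k) * 2 ^ k"
    using dividend_less_div_times[of "2 ^ k" j] by (simp add: Suc_le_eq)
  then show "dyadic T m' (Suc j) \<le> dyadic T m (Suc (j div 2 ^ (m' - m)))"
    unfolding k_def[symmetric] m' dyadic_refine[of T m _ k] using assms(1) by (intro dyadic_mono) (simp_all only: diff_add_inverse)
qed

definition dyadic_integral ::
  "(real \<Rightarrow> real^'p) \<Rightarrow> real \<Rightarrow> (real \<Rightarrow> real^'p^'d) \<Rightarrow> nat \<Rightarrow> real \<Rightarrow> real^'d" where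
  "dyadic_integral w T G m = step_integral w (2 ^ m) (dyadic T m) (\<lambda>i. G (dyadic T m i))"

text \<open>On a finer grid each cell inherits its coefficient from its coarse ancestor. Step
  integrals of two different levels thus become comparable on one grid, and their difference is
  again a simple integral.\<close>

lemma dyadic_integral_refine:
  assumes "0 \<le> T" "m \<le> m'" "k \<le> 2 ^ m'"
  shows "dyadic_integral (\<lambda>s. W s \<omega>) T G m (dyadic T m' k) =
    simple_integral W k (dyadic T m') (\<lambda>j _. G (dyadic T m (j div 2 ^ (m' - m)))) \<omega>"
  using assms(3)
proof (induction k)
  case 0
  show ?case
    using assms(1) by (simp add: dyadic_integral_def step_integral_0 dyadic_nonneg simple_integral_def)
next
  case (Suc k)
  have "dyadic_integral (\<lambda>s. W s \<omega>) T G m (dyadic T m' (Suc k)) -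
      dyadic_integral (\<lambda>s. W s \<omega>) T G m (dyadic T m' k) =
      G (dyadic T m (k div 2 ^ (m' - m))) *v (W (dyadic T m' (Suc k)) \<omega> - W (dyadic T m' k) \<omega>)"
    unfolding dyadic_integral_def
    using dyadic_cell[OF assms(1,2), of k] Suc.prems assms(1)
    by (intro step_integral_increment) (auto intro: dyadic_mono)
  with Suc show ?case by (simp add: simple_integral_def algebra_simps)
qed

text \<open>The integrand is only continuous on \<open>[0,T)\<close>, so the level \<open>m n\<close> of the \<open>n\<close>-th grid is chosen to
  control its oscillation on \<open>[0, T (1 - 2\<^sup>-\<^sup>n)]\<close> only.\<close>

definition fine_levels :: "real \<Rightarrow> (real \<Rightarrow> 'a::real_normed_vector) \<Rightarrow> (nat \<Rightarrow> nat) \<Rightarrow> bool" where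
  "fine_levels T G m \<longleftrightarrow> (\<forall>n s u. 0 \<le> s \<longrightarrow> s \<le> u \<longrightarrow> u \<le> T * (1 - (1/2)^n) \<longrightarrow>
     u - s \<le> T / 2 ^ m n \<longrightarrow> norm (G u - G s) \<le> (1/4)^n)"

lemma fine_levelsD:
  "fine_levels T G m \<Longrightarrow> 0 \<le> s \<Longrightarrow> s \<le> u \<Longrightarrow> u \<le> T * (1 - (1/2)^n) \<Longrightarrow>
     u - s \<le> T / 2 ^ m n \<Longrightarrow> norm (G u - G s) \<le> (1/4)^n"
  unfolding fine_levels_def by blast

text \<open>Lets several integrands share their levels, by passing to maxima.\<close>

lemma fine_levels_mono:
  assumes "fine_levels T G m" "\<And>n. m n \<le> m' n" "0 \<le> T"
  shows "fine_levels T G m'"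
proof -
  have "T / 2 ^ m' n \<le> T / 2 ^ m n" for n
    using assms(2)[of n] assms(3) by (intro divide_left_mono power_increasing) auto
  then show ?thesis
    using assms(1) unfolding fine_levels_def by (meson order_trans)
qed

text \<open>Uniform continuity on the compact interval from 0 to \<open>T * (1 - (1/2)^n)\<close>
  provides one level for each \<open>n\<close>.\<close>

lemma fine_levels_exist:
  assumes "0 < T" and cont: "continuous_on {0..<T} G"
  shows "\<exists>m. fine_levels T G m"
proof -
  have "\<exists>k. \<forall>s u. 0 \<le> s \<longrightarrow> s \<le> u \<longrightarrow> u \<le> T * (1 - (1/2)^n) \<longrightarrow>
     u - s \<le> T / 2 ^ k \<longrightarrow> norm (G u - G s) \<le> (1/4)^n" for n
  proof -
    have "T * (1 - (1/2)^n) < T" using \<open>0 < T\<close> by (simp add: algebra_simps)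
    then have "continuous_on {0..T * (1 - (1/2)^n)} G"
      by (intro continuous_on_subset[OF cont]) auto
    then have "uniformly_continuous_on {0..T * (1 - (1/2)^n)} G"
      by (rule compact_uniformly_continuous) simp
    then obtain d where d: "d > 0" "\<And>x x'. x \<in> {0..T * (1 - (1/2)^n)} \<Longrightarrow> x' \<in> {0..T * (1 - (1/2)^n)} \<Longrightarrow>
        dist x' x < d \<Longrightarrow> dist (G x') (G x) < (1/4)^n"
      unfolding uniformly_continuous_on_def by (metis zero_less_divide_1_iff zero_less_numeral zero_less_power)
    obtain k where "(1/2)^k < d / T"
      using real_arch_pow_inv[of "d / T" "1/2"] d \<open>0 < T\<close> by auto
    then have k: "T / 2 ^ k < d" using \<open>0 < T\<close> by (simp add: field_simps)
    show ?thesis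
    proof (intro exI allI impI)
      fix s u assume "0 \<le> s" "s \<le> u" "u \<le> T * (1 - (1/2)^n)" "u - s \<le> T / 2 ^ k"
      then show "norm (G u - G s) \<le> (1/4)^n"
        using d(2)[of s u] k by (auto simp: dist_norm)
    qed
  qed
  then show ?thesis unfolding fine_levels_def by metis
qed

text \<open>The Weierstrass test for the telescoping series. The bound is asked for only eventually,
  which is the form that the Borel-Cantelli lemma delivers.\<close>

lemma uniformly_convergent_on_increments:
  fixes f :: "nat \<Rightarrow> 'a \<Rightarrow> 'b::banach"
  assumes "\<forall>\<^sub>F n in sequentially. \<forall>x\<in>A. norm (f (Suc n) x - f n x) \<le> b n" "summable b"
  shows "uniformly_convergent_on A f"
proof -
  obtain l where "uniform_limit A (\<lambda>n x. \<Sum>i<n. f (Suc i) x - f i x) l sequentially"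
    using Weierstrass_m_test'_ev[OF assms] unfolding uniformly_convergent_on_def by blast
  moreover have "uniform_limit A (\<lambda>_::nat. f 0) (f 0) sequentially"
    by (rule uniform_limit_const)
  ultimately have "uniform_limit A (\<lambda>n x. f 0 x + (\<Sum>i<n. f (Suc i) x - f i x)) (\<lambda>x. f 0 x + l x) sequentially"
    by (intro uniform_limit_add)
  moreover have "f 0 x + (\<Sum>i<n. f (Suc i) x - f i x) = f n x" for n x
    unfolding sum_lessThan_telescope[of "\<lambda>i. f i x" n] by simp
  ultimately have "uniform_limit A f (\<lambda>x. f 0 x + l x) sequentially"
    by simp
  then show ?thesis unfolding uniformly_convergent_on_def by blast
qed

context wiener
begin

lemma AE_continuous: "AE \<omega> in M. continuous_on {0..} (\<lambda>t. W t \<omega>)"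
  using wiener unfolding wiener_process_def by blast

lemma step_integral_measurable:
  assumes "\<And>i. i \<le> N \<Longrightarrow> 0 \<le> \<tau> i" "0 \<le> t"
  shows "(\<lambda>\<omega>. step_integral (\<lambda>s. W s \<omega>) N \<tau> A t) \<in> borel_measurable (F t)"
  unfolding step_integral_def
proof (rule borel_measurable_sum)
  fix i assume "i \<in> {..<N}"
  then have [measurable]: "W (min t (\<tau> (Suc i))) \<in> borel_measurable (F t)"
      "W (min t (\<tau> i)) \<in> borel_measurable (F t)"
    using assms by (auto intro!: W_measurable)
  show "(\<lambda>\<omega>. A i *v (W (min t (\<tau> (Suc i))) \<omega> - W (min t (\<tau> i)) \<omega>)) \<in> borel_measurable (F t)"
    by measurable
qed

lemma dyadic_integral_measurable:
  "0 \<le> T \<Longrightarrow> 0 \<le> t \<Longrightarrow>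
    (\<lambda>\<omega>. dyadic_integral (\<lambda>s. W s \<omega>) T G m t) \<in> borel_measurable (F t)"
  unfolding dyadic_integral_def by (intro step_integral_measurable) (auto intro: dyadic_nonneg)

text \<open>\<open>2^k - 2^(k-n)\<close> is the index of the time \<open>T * (1 - (1/2)^n)\<close>
  on level \<open>k\<close>. Up to this time the two step integrands differ by at most
  \<open>2 * (1/4)^n\<close>, so the maximal inequality at threshold \<open>(1/2)^n\<close> gives 4
  p T (1/16)^n / (1/4)^n with p = \<open>CARD('p)\<close>. The rate \<open>(1/4)^n\<close> in
  \<open>fine_levels\<close> is small enough to make thresholds and probabilities summable
  together.\<close>

lemma dyadic_integral_maximal:
  fixes G :: "real \<Rightarrow> real^'p^'d"
  assumes "0 < T" and fine: "fine_levels T G m" and k: "m n \<le> k" "m (Suc n) \<le> k" "n \<le> k"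
  shows "prob {\<omega>\<in>space M. \<exists>j\<le>2^k - 2^(k-n). (1/2)^n <
      norm (dyadic_integral (\<lambda>s. W s \<omega>) T G (m (Suc n)) (dyadic T k j) -
        dyadic_integral (\<lambda>s. W s \<omega>) T G (m n) (dyadic T k j))}
    \<le> 4 * real CARD('p) * T * (1/4)^n"
proof -
  define K :: nat where "K = 2^k - 2^(k-n)"
  define H where "H = (\<lambda>j (\<omega>::'w). G (dyadic T (m (Suc n)) (j div 2 ^ (k - m (Suc n)))) -
      G (dyadic T (m n) (j div 2 ^ (k - m n))))"
  have K: "K \<le> 2^k" "dyadic T k K = T * (1 - (1/2)^n)"
  proof -
    have "(2::real)^k = 2^n * 2^(k-n)" using k(3) by (simp flip: power_add)
    then show "dyadic T k K = T * (1 - (1/2)^n)"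
      by (simp add: K_def dyadic_def of_nat_diff power_one_over field_simps)
  qed (simp add: K_def)
  have eq: "dyadic_integral (\<lambda>s. W s \<omega>) T G (m (Suc n)) (dyadic T k j) -
        dyadic_integral (\<lambda>s. W s \<omega>) T G (m n) (dyadic T k j) =
      simple_integral W j (dyadic T k) H \<omega>" if "j \<le> K" for j \<omega>
    using dyadic_integral_refine[of T _ k j W \<omega> G] k that K \<open>0 < T\<close>
    by (simp add: simple_integral_def H_def sum_subtractf matrix_vector_mult_diff_rdistrib)
  \<comment> \<open>Used for \<open>l = n\<close> and \<open>l = Suc n\<close>; the time window of
    \<open>l\<close> contains that of \<open>n\<close>.\<close>
  have le: "norm (G (dyadic T k j) - G (dyadic T (m l) (j div 2 ^ (k - m l)))) \<le> (1/4)^l"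
    if "m l \<le> k" "j < K" "n \<le> l" for l j
  proof (rule fine_levelsD[OF fine])
    have j: "j < 2 ^ k" using that K by simp
    note c = dyadic_cell[OF less_imp_le[OF \<open>0 < T\<close>] \<open>m l \<le> k\<close> j]
    show "0 \<le> dyadic T (m l) (j div 2 ^ (k - m l))" using \<open>0 < T\<close> by (simp add: dyadic_nonneg)
    show "dyadic T (m l) (j div 2 ^ (k - m l)) \<le> dyadic T k j" by (rule c)
    have "dyadic T k j \<le> dyadic T k K" using that \<open>0 < T\<close> by (intro dyadic_mono) auto
    also have "\<dots> \<le> T * (1 - (1/2)^l)"
      unfolding K using \<open>0 < T\<close> \<open>n \<le> l\<close> by (intro mult_left_mono) (auto intro: power_decreasing)
    finally show "dyadic T k j \<le> T * (1 - (1/2)^l)" .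
    show "dyadic T k j - dyadic T (m l) (j div 2 ^ (k - m l)) \<le> T / 2 ^ m l"
      using c(3) dyadic_Suc[of T k j] dyadic_Suc[of T "m l" "j div 2 ^ (k - m l)"] 
        divide_pos_pos[OF \<open>0 < T\<close>, of "2 ^ k"] by auto
  qed
  have H: "norm (H j \<omega>) \<le> 2 * (1/4)^n" if "j < K" for j \<omega>
  proof -
    have "H j \<omega> = (G (dyadic T k j) - G (dyadic T (m n) (j div 2 ^ (k - m n)))) -
      (G (dyadic T k j) - G (dyadic T (m (Suc n)) (j div 2 ^ (k - m (Suc n)))))"
      by (simp add: H_def)
    also have "norm \<dots> \<le> (1/4)^n + (1/4)^Suc n"
      by (rule order_trans[OF norm_triangle_ineq4]) (intro add_mono le that k order_refl, simp)
    also have "\<dots> \<le> 2 * (1/4)^n" by simp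
    finally show ?thesis .
  qed
  have "prob {\<omega>\<in>space M. \<exists>j\<le>K. (1/2)^n < norm (simple_integral W j (dyadic T k) H \<omega>)}
      \<le> real CARD('p) * ((dyadic T k K - dyadic T k 0) * (2 * (1/4)^n)\<^sup>2) / ((1/2)^n)\<^sup>2"
    using \<open>0 < T\<close> H by (intro simple_integral_maximal) (auto intro: dyadic_mono simp: H_def)
  also have "\<dots> \<le> real CARD('p) * (T * (2 * (1/4)^n)\<^sup>2) / ((1/2)^n)\<^sup>2"
    using K(2) \<open>0 < T\<close> by (intro divide_right_mono mult_left_mono mult_right_mono) auto
  also have "\<dots> = 4 * real CARD('p) * T * (1/4)^n"
  proof -
    have "((1/2)^n)\<^sup>2 = (1/4 :: real)^n" by (simp add: power_divide power_mult[symmetric] power2_eq_square flip: power_mult_distrib)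
    moreover have "(2 * (1/4)^n)\<^sup>2 = 4 * (1/4 :: real)^n * (1/4)^n" by (simp add: power2_eq_square)
    ultimately show ?thesis by simp
  qed
  also have "{\<omega>\<in>space M. \<exists>j\<le>K. (1/2)^n < norm (simple_integral W j (dyadic T k) H \<omega>)} =
    {\<omega>\<in>space M. \<exists>j\<le>2^k - 2^(k-n). (1/2)^n <
      norm (dyadic_integral (\<lambda>s. W s \<omega>) T G (m (Suc n)) (dyadic T k j) -
        dyadic_integral (\<lambda>s. W s \<omega>) T G (m n) (dyadic T k j))}"
    unfolding K_def[symmetric] by (intro Collect_cong) (metis eq)
  finally show ?thesis .
qed

text \<open>The preceding bound is independent of \<open>k\<close>, so it survives the increasing
  union of the exceptional events over all finer grids. Off this union the estimate holds at the
  grid points of all fine levels, and continuity extends it to every time. Continuity stays a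
  premise on the single path since it holds only almost surely.\<close>

lemma dyadic_integral_sup:
  fixes G :: "real \<Rightarrow> real^'p^'d"
  assumes "0 < T" and fine: "fine_levels T G m"
  shows "\<exists>A\<in>events. prob A \<le> 4 * real CARD('p) * T * (1/4)^n \<and>
    (\<forall>\<omega>\<in>space M - A. continuous_on {0..} (\<lambda>t. W t \<omega>) \<longrightarrow> (\<forall>t\<in>{0..T * (1 - (1/2)^n)}.
      norm (dyadic_integral (\<lambda>s. W s \<omega>) T G (m (Suc n)) t -
        dyadic_integral (\<lambda>s. W s \<omega>) T G (m n) t) \<le> (1/2)^n))"
proof -
  define D where "D = (\<lambda>t \<omega>. dyadic_integral (\<lambda>s. W s \<omega>) T G (m (Suc n)) t -
        dyadic_integral (\<lambda>s. W s \<omega>) T G (m n) t)"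
  \<comment> \<open>From level \<open>k0\<close> on, a grid refines both coarse grids and has the
    end of the time window as a grid point.\<close>
  define k0 where "k0 = max n (max (m n) (m (Suc n)))"
  define A where "A = (\<lambda>i. {\<omega>\<in>space M. \<exists>j\<le>2^(i + k0) - 2^(i + k0 - n). (1/2)^n < norm (D (dyadic T (i + k0) j) \<omega>)})"
  have D[measurable]: "D t \<in> borel_measurable M" if "0 \<le> t" for t
    unfolding D_def using that \<open>0 < T\<close>
    by (intro borel_measurable_diff measurable_F_M[OF dyadic_integral_measurable]) auto
  have A[measurable]: "A i \<in> events" for i
  proof -
    have [measurable]: "D (dyadic T (i + k0) j) \<in> borel_measurable M" for j
      using \<open>0 < T\<close> by (intro D dyadic_nonneg) simp
    show ?thesis unfolding A_def by measurable
  qed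
  have bound: "prob (A i) \<le> 4 * real CARD('p) * T * (1/4)^n" for i
    unfolding A_def D_def using assms by (intro dyadic_integral_maximal) (auto simp: k0_def)
  have "A i \<subseteq> A (Suc i)" for i
  proof
    fix \<omega> assume "\<omega> \<in> A i"
    then obtain j where j: "\<omega> \<in> space M" "j \<le> 2^(i + k0) - 2^(i + k0 - n)"
        "(1/2)^n < norm (D (dyadic T (i + k0) j) \<omega>)"
      unfolding A_def by auto
    have "Suc (i + k0) - n = Suc (i + k0 - n)" by (simp add: k0_def)
    then have "j * 2 \<le> 2^(Suc i + k0) - 2^(Suc i + k0 - n)"
      using j(2) by simp
    moreover have "dyadic T (i + k0) j = dyadic T (Suc i + k0) (j * 2)"
      using dyadic_refine[of T "i + k0" j 1] by simp
    ultimately show "\<omega> \<in> A (Suc i)"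
      unfolding A_def using j by auto
  qed
  then have "incseq A" by (rule incseq_SucI)
  then have "(\<lambda>i. prob (A i)) \<longlonglongrightarrow> prob (\<Union>i. A i)"
    by (intro finite_Lim_measure_incseq) auto
  then have "prob (\<Union>i. A i) \<le> 4 * real CARD('p) * T * (1/4)^n"
    by (rule LIMSEQ_le_const2) (use bound in auto)
  moreover have "norm (D t \<omega>) \<le> (1/2)^n"
    if \<omega>: "\<omega> \<in> space M - (\<Union>i. A i)" "continuous_on {0..} (\<lambda>t. W t \<omega>)" and t: "t \<in> {0..T * (1 - (1/2)^n)}"
    for \<omega> t
  proof -
    \<comment> \<open>\<open>dyadic T k (q k)\<close> is the last point of level \<open>k\<close> up
      to \<open>t\<close>. It approaches \<open>t\<close> from below and so stays in the time
      window.\<close>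
    define q where "q = (\<lambda>k. nat \<lfloor>t * 2^k / T\<rfloor>)"
    have q: "real (q k) \<le> t * 2^k / T" "t * 2^k / T < real (q k) + 1" for k
      using t \<open>0 < T\<close> by (auto simp: q_def)
    have le: "dyadic T k (q k) \<le> t" "t - T / 2^k < dyadic T k (q k)" for k
    proof -
      show "dyadic T k (q k) \<le> t"
        using q[of k] \<open>0 < T\<close> by (simp add: dyadic_def field_simps)
      have "t < (T * real (q k) + T) / 2^k"
        using q(2)[of k] \<open>0 < T\<close> by (simp add: field_simps)
      then show "t - T / 2^k < dyadic T k (q k)"
        by (simp add: dyadic_def add_divide_distrib)
    qed
    have lim: "(\<lambda>i. dyadic T (i + k0) (q (i + k0))) \<longlonglongrightarrow> t"
    proof (rule tendsto_sandwich[where h="\<lambda>_. t"])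
      have "(\<lambda>k. t - T * (1/2)^k) \<longlonglongrightarrow> t - T * 0"
        by (intro tendsto_intros LIMSEQ_realpow_zero) auto
      then show "(\<lambda>i. t - T * (1/2)^(i + k0)) \<longlonglongrightarrow> t"
        by (intro LIMSEQ_ignore_initial_segment) simp
    qed (use le in \<open>auto intro!: always_eventually intro: less_imp_le simp: power_one_over\<close>)
    have cD: "continuous_on {0..} (\<lambda>t. D t \<omega>)"
      unfolding D_def dyadic_integral_def using \<omega> \<open>0 < T\<close>
      by (intro continuous_on_diff step_integral_continuous_on) (auto intro: dyadic_nonneg)
    have "(\<lambda>i. D (dyadic T (i + k0) (q (i + k0))) \<omega>) \<longlonglongrightarrow> D t \<omega>"
      by (rule continuous_on_tendsto_compose[OF cD lim])
        (use t \<open>0 < T\<close> in \<open>auto intro!: always_eventually dyadic_nonneg\<close>)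
    then have "(\<lambda>i. norm (D (dyadic T (i + k0) (q (i + k0))) \<omega>)) \<longlonglongrightarrow> norm (D t \<omega>)"
      by (rule tendsto_norm)
    then show ?thesis
    proof (rule LIMSEQ_le_const2)
      have "norm (D (dyadic T (i + k0) (q (i + k0))) \<omega>) \<le> (1/2)^n" for i
      proof -
        let ?k = "i + k0"
        have "t * 2^?k / T \<le> (1 - (1/2)^n) * 2^?k"
          using mult_right_mono[of "t / T" "1 - (1/2)^n" "2^?k"] t \<open>0 < T\<close>
          by (simp add: pos_divide_le_eq mult.commute)
        also have "\<dots> = real (2^?k - 2^(?k - n))"
        proof -
          have "(2::real)^?k = 2^n * 2^(?k-n)" by (simp add: k0_def flip: power_add)
          then show ?thesis by (simp add: of_nat_diff power_one_over field_simps)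
        qed
        finally have "q ?k \<le> 2^?k - 2^(?k - n)" using q(1)[of ?k] by linarith
        moreover have "\<omega> \<notin> A i" "\<omega> \<in> space M" using \<omega> by auto
        ultimately show ?thesis unfolding A_def by force
      qed
      then show "\<exists>N. \<forall>i\<ge>N. norm (D (dyadic T (i + k0) (q (i + k0))) \<omega>) \<le> (1/2)^n" by blast
    qed
  qed
  ultimately show ?thesis
    unfolding D_def by (intro bexI[of _ "\<Union>i. A i"]) auto
qed

text \<open>By Borel-Cantelli almost every path eventually satisfies all estimates, and every
  \<open>t0\<close> below \<open>T\<close> eventually lies in the window on which they hold.\<close>

lemma dyadic_integral_converges:
  fixes G :: "real \<Rightarrow> real^'p^'d"
  assumes "0 < T" and fine: "fine_levels T G m"
  shows "AE \<omega> in M. \<forall>t0\<in>{0..<T}.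
    uniformly_convergent_on {0..t0} (\<lambda>n. dyadic_integral (\<lambda>s. W s \<omega>) T G (m n))"
proof -
  obtain A where A: "\<And>n. A n \<in> events" "\<And>n. prob (A n) \<le> 4 * real CARD('p) * T * (1/4)^n"
    "\<And>n \<omega> t. \<omega> \<in> space M - A n \<Longrightarrow> continuous_on {0..} (\<lambda>t. W t \<omega>) \<Longrightarrow> t \<in> {0..T * (1 - (1/2)^n)} \<Longrightarrow>
      norm (dyadic_integral (\<lambda>s. W s \<omega>) T G (m (Suc n)) t -
        dyadic_integral (\<lambda>s. W s \<omega>) T G (m n) t) \<le> (1/2)^n"
    using dyadic_integral_sup[OF assms] by metis
  have "summable (\<lambda>n. 4 * real CARD('p) * T * (1/4)^n)"
    by (intro summable_mult summable_geometric) simp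
  then have "summable (\<lambda>n. prob (A n))"
    by (rule summable_comparison_test'[where N=0]) (use A(2) in auto)
  then have "AE \<omega> in M. \<forall>\<^sub>F n in sequentially. \<omega> \<in> space M - A n"
    by (intro borel_cantelli_AE1) (use A(1) in \<open>auto simp: less_top[symmetric]\<close>)
  with AE_continuous show ?thesis
  proof eventually_elim
    case (elim \<omega>)
    show ?case
    proof
      fix t0 assume t0: "t0 \<in> {0..<T}"
      have "(\<lambda>n. T * (1 - (1/2)^n)) \<longlonglongrightarrow> T * (1 - 0)"
        by (intro tendsto_intros LIMSEQ_realpow_zero) auto
      then have "\<forall>\<^sub>F n in sequentially. t0 < T * (1 - (1/2)^n)"
        using t0 by (intro order_tendstoD(1)) auto
      with elim(2) have "\<forall>\<^sub>F n in sequentially. \<forall>t\<in>{0..t0}.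
        norm (dyadic_integral (\<lambda>s. W s \<omega>) T G (m (Suc n)) t -
          dyadic_integral (\<lambda>s. W s \<omega>) T G (m n) t) \<le> (1/2)^n"
        by eventually_elim (use A(3) elim(1) in auto)
      then show "uniformly_convergent_on {0..t0} (\<lambda>n. dyadic_integral (\<lambda>s. W s \<omega>) T G (m n))"
        by (rule uniformly_convergent_on_increments) (simp add: summable_geometric)
    qed
  qed
qed

text \<open>Dominated convergence for the indicators of the exceptional events.\<close>

lemma prob_tendsto_0:
  fixes f :: "nat \<Rightarrow> 'w \<Rightarrow> 'b::{second_countable_topology,banach}"
  assumes [measurable]: "\<And>n. f n \<in> borel_measurable M" "g \<in> borel_measurable M"
    and lim: "AE \<omega> in M. (\<lambda>n. f n \<omega>) \<longlonglongrightarrow> g \<omega>" and "0 < \<epsilon>"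
  shows "(\<lambda>n. prob {\<omega>\<in>space M. \<epsilon> < norm (f n \<omega> - g \<omega>)}) \<longlonglongrightarrow> 0"
proof -
  let ?A = "\<lambda>n. {\<omega>\<in>space M. \<epsilon> < norm (f n \<omega> - g \<omega>)}"
  have "(\<lambda>n. expectation (indicator (?A n) :: 'w \<Rightarrow> real)) \<longlonglongrightarrow> expectation (\<lambda>_. 0 :: real)"
  proof (rule integral_dominated_convergence[where w="\<lambda>_. 1"])
    show "AE \<omega> in M. (\<lambda>n. indicator (?A n) \<omega> :: real) \<longlonglongrightarrow> 0"
      using lim
    proof eventually_elim
      case (elim \<omega>)
      have "\<forall>\<^sub>F n in sequentially. norm (f n \<omega> - g \<omega>) < \<epsilon>"
        using tendstoD[OF elim \<open>0 < \<epsilon>\<close>] by (simp add: dist_norm)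
      then have "\<forall>\<^sub>F n in sequentially. indicator (?A n) \<omega> = (0::real)"
        by eventually_elim (auto simp: indicator_def)
      then show ?case by (rule tendsto_eventually)
    qed
  qed (auto simp: indicator_def)
  then show ?thesis by simp
qed

end

section \<open>The Ito integral of a deterministic integrand\<close>

text \<open>Serves to merge the grids of two simple processes; the strict order excludes empty
  cells.\<close>

lemma finite_set_strict_grid:
  fixes P :: "real set"
  assumes "finite P" "P \<noteq> {}"
  shows "\<exists>K \<rho>. (\<forall>k<K. \<rho> k < \<rho> (Suc k)) \<and> \<rho> ` {..K::nat} = P"
proof (intro exI conjI allI impI)
  let ?xs = "sorted_list_of_set P"
  have len: "length ?xs = Suc (card P - 1)" using assms by (simp add: card_gt_0_iff)
  show "?xs ! k < ?xs ! Suc k" if "k < card P - 1" for k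
    using sorted_wrt_nth_less[OF strict_sorted_list_of_set[of P], of k "Suc k"] that len by simp
  have "(!) ?xs ` {..card P - 1} = set ?xs"
    unfolding set_conv_nth len by (auto simp: less_Suc_eq_le image_def)
  then show "(!) ?xs ` {..card P - 1} = P" using assms by simp
qed

text \<open>Continuity is local, and the interval from 0 to the midpoint of \<open>t\<close> and
  \<open>T\<close> is a neighbourhood of \<open>t\<close> within the half-open one.\<close>

lemma continuous_on_half_open:
  fixes f :: "real \<Rightarrow> 'a::topological_space"
  assumes "\<And>t. t \<in> {0..<T} \<Longrightarrow> continuous_on {0..t} f"
  shows "continuous_on {0..<T} f"
  unfolding continuous_on_eq_continuous_within
proof
  fix t assume t: "t \<in> {0..<T}"
  define u where "u = (t + T) / 2"
  have u: "t < u" "u < T" "0 \<le> u" using t by (auto simp: u_def)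
  then have "continuous (at t within {0..u}) f"
    using assms[of u] t by (auto simp: continuous_on_eq_continuous_within)
  moreover have "at t within {0..u} = at t within {0..<T}"
    by (rule at_within_nhd[of _ "{..<u}"]) (use u in auto)
  ultimately show "continuous (at t within {0..<T}) f" by simp
qed

text \<open>The rationals approach \<open>t\<close> from the right, which is possible at every point
  of the half-open interval, including 0.\<close>

lemma continuous_eq_on_Rats:
  fixes f g :: "real \<Rightarrow> 'a::t2_space"
  assumes f: "continuous_on {0..<T} f" and g: "continuous_on {0..<T} g"
    and eq: "\<And>q. q \<in> \<rat> \<inter> {0..<T} \<Longrightarrow> f q = g q" and t: "t \<in> {0..<T}"
  shows "f t = g t"
proof -
  have "\<exists>q. \<forall>n. q n \<in> \<rat> \<and> t < q n \<and> q n < min T (t + 1 / real (Suc n))"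
  proof (intro choice allI)
    fix n :: nat
    show "\<exists>q. q \<in> \<rat> \<and> t < q \<and> q < min T (t + 1 / real (Suc n))"
      using Rats_dense_in_real[of t "min T (t + 1 / real (Suc n))"] t by auto
  qed
  then obtain q where q: "\<And>n. q n \<in> \<rat>" "\<And>n. t < q n" "\<And>n. q n < min T (t + 1 / real (Suc n))"
    by blast
  have "(\<lambda>n. t + 1 / real (Suc n)) \<longlonglongrightarrow> t + 0"
    by (intro tendsto_add tendsto_const LIMSEQ_Suc lim_1_over_n)
  then have lim: "q \<longlonglongrightarrow> t"
    by (intro tendsto_sandwich[of "\<lambda>_. t" q sequentially "\<lambda>n. t + 1 / real (Suc n)"])
       (use q in \<open>auto intro!: always_eventually intro: less_imp_le\<close>)
  have ev: "\<forall>\<^sub>F n in sequentially. q n \<in> {0..<T}"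
    by (rule always_eventually) (use q t in \<open>auto intro: less_imp_le order.strict_trans1\<close>)
  have "(\<lambda>n. f (q n)) \<longlonglongrightarrow> f t" "(\<lambda>n. g (q n)) \<longlonglongrightarrow> g t"
    using continuous_on_tendsto_compose[OF f lim t ev] continuous_on_tendsto_compose[OF g lim t ev]
    by auto
  moreover have "f (q n) = g (q n)" for n
    using q t by (intro eq) (auto intro: less_imp_le order.strict_trans1)
  ultimately show ?thesis using LIMSEQ_unique by simp
qed

lemma AE_eq_continuous:
  fixes X Y :: "real \<Rightarrow> 'w \<Rightarrow> 'a::t2_space"
  assumes "AE \<omega> in M. continuous_on {0..<T} (\<lambda>t. X t \<omega>)" "AE \<omega> in M. continuous_on {0..<T} (\<lambda>t. Y t \<omega>)"
    and "\<And>t. t \<in> {0..<T} \<Longrightarrow> AE \<omega> in M. X t \<omega> = Y t \<omega>"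
  shows "AE \<omega> in M. \<forall>t\<in>{0..<T}. X t \<omega> = Y t \<omega>"
proof -
  have "countable (\<rat> \<inter> {0..<T})" using countable_rat by blast
  then have "AE \<omega> in M. \<forall>q\<in>\<rat> \<inter> {0..<T}. X q \<omega> = Y q \<omega>"
    using assms(3) by (auto simp: AE_ball_countable)
  with assms(1,2) show ?thesis
    by eventually_elim (use continuous_eq_on_Rats in blast)
qed

lemma dyadic_simple_process:
  fixes G :: "real \<Rightarrow> real^'p^'d"
  assumes "0 \<le> T" "0 \<le> t" "t \<le> T"
  shows "simple_process F t (2^m) (\<lambda>i. min t (dyadic T m i)) (\<lambda>i _. G (dyadic T m i))"
  unfolding simple_process_def using assms dyadic_mono[of T _ _ m]
  by (auto simp: min_def intro: order_trans)

text \<open>Every positive \<open>s\<close> lies in the cell at whose left end \<open>G\<close> is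
  evaluated, so the integrand errs by at most \<open>(1/4)^n\<close>, whose square is
  \<open>(1/16)^n\<close>.\<close>

lemma dyadic_simple_error:
  fixes G :: "real \<Rightarrow> real^'p^'d"
  assumes "0 < T" and fine: "fine_levels T G m" and t: "0 \<le> t" "t \<le> T * (1 - (1/2)^n)"
  shows "(\<integral>\<^sup>+s\<in>{0..t}. ennreal ((norm (simple_value (2 ^ m n) (\<lambda>i. min t (dyadic T (m n) i))
    (\<lambda>i _. G (dyadic T (m n) i)) s \<omega> - G s))\<^sup>2) \<partial>lborel) \<le> ennreal (t * (1/16)^n)"
proof -
  let ?v = "\<lambda>s. simple_value (2 ^ m n) (\<lambda>i. min t (dyadic T (m n) i)) (\<lambda>i _. G (dyadic T (m n) i)) s \<omega>"
  have tT: "t \<le> T" using t(2) \<open>0 < T\<close> by (smt (verit) mult_left_le zero_le_power divide_nonneg_nonneg)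
  have le: "norm (?v s - G s) \<le> (1/4)^n" if s: "0 < s" "s \<le> t" for s
  proof -
    have "\<exists>i<2 ^ m n. min t (dyadic T (m n) i) < s \<and> s \<le> min t (dyadic T (m n) (Suc i))"
      by (rule grid_cell) (use s tT t in auto)
    then obtain i where i: "i < 2 ^ m n" "min t (dyadic T (m n) i) < s" "s \<le> min t (dyadic T (m n) (Suc i))"
      by blast
    have "?v s = G (dyadic T (m n) i)"
      by (rule simple_value_eq[OF _ i])
        (use dyadic_mono[of T _ _ "m n"] \<open>0 < T\<close> in \<open>auto simp: min_le_iff_disj\<close>)
    moreover have "norm (G s - G (dyadic T (m n) i)) \<le> (1/4)^n"
      by (rule fine_levelsD[OF fine])
        (use i s t \<open>0 < T\<close> dyadic_Suc[of T "m n" i] in \<open>auto simp: dyadic_nonneg\<close>)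
    ultimately show ?thesis by (simp add: norm_minus_commute)
  qed
  have "(\<integral>\<^sup>+s\<in>{0..t}. ennreal ((norm (?v s - G s))\<^sup>2) \<partial>lborel) \<le>
    (\<integral>\<^sup>+s. ennreal ((1/16)^n) * indicator {0..t} s \<partial>lborel)"
  proof (rule nn_integral_mono_AE)
    show "AE s in lborel. ennreal ((norm (?v s - G s))\<^sup>2) * indicator {0..t} s
        \<le> ennreal ((1/16)^n) * indicator {0..t} s"
      \<comment> \<open>The point 0 lies in no cell, and \<open>simple_value\<close> is 0 there by
        default; it has measure zero.\<close>
      using AE_lborel_singleton[of "0::real"]
    proof eventually_elim
      case (elim s)
      have "(norm (?v s - G s))\<^sup>2 \<le> ((1/4)^n)\<^sup>2" if "s \<in> {0..t}"
        using le[of s] that elim by (intro power_mono) auto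
      then show ?case
        by (auto simp: indicator_def ennreal_leI power2_eq_square simp flip: power_mult_distrib)
    qed
  qed
  also have "\<dots> = ennreal (t * (1/16)^n)"
    using t by (subst nn_integral_cmult_indicator) (auto simp: ennreal_mult' mult.commute)
  finally show ?thesis .
qed

text \<open>\<open>lim\<close> assigns a value also on the null set where convergence fails, so the
  limit is a function on the whole sample space and measurable at time \<open>t\<close>.\<close>

definition dyadic_limit ::
  "(real \<Rightarrow> 'w \<Rightarrow> real^'p) \<Rightarrow> real \<Rightarrow> (real \<Rightarrow> real^'p^'d) \<Rightarrow> (nat \<Rightarrow> nat) \<Rightarrow> real \<Rightarrow> 'w \<Rightarrow> real^'d" where
  "dyadic_limit W T G m t \<omega> = lim (\<lambda>n. dyadic_integral (\<lambda>s. W s \<omega>) T G (m n) t)"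

context wiener
begin

text \<open>Two simple processes can be subtracted only on a common grid. Rewriting preserves
  adaptedness because a value known at the start of a coarse cell is known at every later grid
  point.\<close>

lemma simple_process_refine:
  fixes \<eta> :: "nat \<Rightarrow> 'w \<Rightarrow> real^'p^'d"
  assumes sp: "simple_process F t N \<tau> \<eta>"
    and \<rho>: "\<rho> 0 = 0" "\<rho> K = t" "\<And>k. k < K \<Longrightarrow> \<rho> k < \<rho> (Suc k)" and sub: "\<tau> ` {..N} \<subseteq> \<rho> ` {..K}"
  shows "\<exists>h. (\<forall>k<K. h k \<in> borel_measurable (F (\<rho> k)) \<and> (\<exists>C. \<forall>\<omega>\<in>space M. norm (h k \<omega>) \<le> C)) \<and>
    (\<forall>\<omega>. simple_integral W N \<tau> \<eta> \<omega> = simple_integral W K \<rho> h \<omega>) \<and>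
    (\<forall>k<K. \<forall>s\<in>{\<rho> k<..\<rho> (Suc k)}. \<forall>\<omega>. simple_value N \<tau> \<eta> s \<omega> = h k \<omega>)"
proof -
  have \<tau>: "\<tau> 0 = 0" "\<tau> N = t" "\<And>i. i < N \<Longrightarrow> \<tau> i \<le> \<tau> (Suc i)"
    and \<eta>: "\<And>i. i < N \<Longrightarrow> \<eta> i \<in> borel_measurable (F (\<tau> i))"
      "\<And>i. i < N \<Longrightarrow> \<exists>C. \<forall>\<omega>\<in>space M. norm (\<eta> i \<omega>) \<le> C"
    using sp unfolding simple_process_def by auto
  have \<rho>mono: "\<rho> i \<le> \<rho> j" if "i \<le> j" "j \<le> K" for i j
    by (rule grid_le[OF _ that]) (use \<rho>(3) in \<open>auto intro: less_imp_le\<close>)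
  have "\<exists>i<N. \<tau> i \<le> \<rho> k \<and> \<rho> (Suc k) \<le> \<tau> (Suc i)" if k: "k < K" for k
  proof -
    have "\<rho> 0 \<le> \<rho> k" "\<rho> k < \<rho> (Suc k)" "\<rho> (Suc k) \<le> \<rho> K" using \<rho>mono \<rho>(3) k by auto
    then have "\<exists>i<N. \<tau> i < \<rho> (Suc k) \<and> \<rho> (Suc k) \<le> \<tau> (Suc i)"
      by (intro grid_cell) (use \<tau> \<rho> in auto)
    then obtain i where i: "i < N" "\<tau> i < \<rho> (Suc k)" "\<rho> (Suc k) \<le> \<tau> (Suc i)" by blast
    \<comment> \<open>\<open>\<tau> i\<close> is itself a point of the finer grid; lying strictly
      before \<open>\<rho> (Suc k)\<close>, it cannot lie after \<open>\<rho> k\<close>.\<close>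
    obtain l where l: "l \<le> K" "\<tau> i = \<rho> l" using sub i(1) by (metis atMost_iff image_subset_iff imageE less_imp_le)
    have "l \<le> k" using \<rho>mono[of "Suc k" l] l i by (metis not_less not_less_eq_eq)
    then have "\<tau> i \<le> \<rho> k" using \<rho>mono[of l k] l k by simp
    with i show ?thesis by blast
  qed
  then obtain c where c: "\<And>k. k < K \<Longrightarrow> c k < N" "\<And>k. k < K \<Longrightarrow> \<tau> (c k) \<le> \<rho> k"
      "\<And>k. k < K \<Longrightarrow> \<rho> (Suc k) \<le> \<tau> (Suc (c k))"
    by metis
  have \<tau>0: "0 \<le> \<tau> i" if "i \<le> N" for i using grid_le[of N \<tau> 0 i] \<tau> that by simp
  have \<tau>t: "\<tau> i \<le> t" if "i \<le> N" for i using grid_le[of N \<tau> i N] \<tau> that by simp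
  have "step_integral (\<lambda>s. W s \<omega>) N \<tau> (\<lambda>i. \<eta> i \<omega>) (\<rho> k) = simple_integral W k \<rho> (\<lambda>k. \<eta> (c k)) \<omega>"
    if "k \<le> K" for k \<omega>
    using that
  proof (induction k)
    case 0
    then show ?case using step_integral_0[of N \<tau>] \<tau>0 \<rho> by (simp add: simple_integral_def)
  next
    case (Suc k)
    have "step_integral (\<lambda>s. W s \<omega>) N \<tau> (\<lambda>i. \<eta> i \<omega>) (\<rho> (Suc k)) -
        step_integral (\<lambda>s. W s \<omega>) N \<tau> (\<lambda>i. \<eta> i \<omega>) (\<rho> k) =
        \<eta> (c k) \<omega> *v (W (\<rho> (Suc k)) \<omega> - W (\<rho> k) \<omega>)"
      by (rule step_integral_increment) (use \<tau> c[of k] \<rho>(3)[of k] Suc.prems in auto)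
    with Suc show ?case by (simp add: simple_integral_def algebra_simps)
  qed
  from this[of K] have int: "simple_integral W N \<tau> \<eta> \<omega> = simple_integral W K \<rho> (\<lambda>k. \<eta> (c k)) \<omega>" for \<omega>
    using \<tau>t by (simp add: \<rho> step_integral_def simple_integral_def)
  show ?thesis
  proof (intro exI[of _ "\<lambda>k. \<eta> (c k)"] conjI allI impI ballI)
    fix k s \<omega> assume "k < K" "s \<in> {\<rho> k<..\<rho> (Suc k)}"
    then show "simple_value N \<tau> \<eta> s \<omega> = \<eta> (c k) \<omega>"
      using c[of k] by (intro simple_value_eq \<tau>) auto
  next
    fix k assume "k < K"
    then show "\<eta> (c k) \<in> borel_measurable (F (\<rho> k))"
      using measurable_mono[OF c(2) \<eta>(1)] c(1) by blast
  qed (use \<eta> c int in auto)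
qed

text \<open>On the merged grid the difference is one simple integral, whose accumulated squares are
  bounded by the squared L2-distance on [0,t], so that truncation applies. \<open>A\<close> may be
  any event covering the outcomes with distance above \<delta>; this leaves the measurability of the
  distance to the caller.\<close>

lemma simple_integral_difference:
  fixes \<eta> \<eta>' :: "nat \<Rightarrow> 'w \<Rightarrow> real^'p^'d"
  assumes sp: "simple_process F t N \<tau> \<eta>" "simple_process F t N' \<tau>' \<eta>'"
    and "0 < \<epsilon>" "0 \<le> \<delta>" and A: "A \<in> events"
    and sub: "\<And>\<omega>. \<omega> \<in> space M \<Longrightarrow> ennreal \<delta> < (\<integral>\<^sup>+s\<in>{0..t}.
      ennreal ((norm (simple_value N \<tau> \<eta> s \<omega> - simple_value N' \<tau>' \<eta>' s \<omega>))\<^sup>2) \<partial>lborel) \<Longrightarrow> \<omega> \<in> A"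
  shows "prob {\<omega>\<in>space M. \<epsilon> < norm (simple_integral W N \<tau> \<eta> \<omega> - simple_integral W N' \<tau>' \<eta>' \<omega>)}
    \<le> prob A + real CARD('p) * \<delta> / \<epsilon>\<^sup>2"
proof -
  have \<tau>: "\<tau> 0 = 0" "\<tau> N = t" "\<And>i. i < N \<Longrightarrow> \<tau> i \<le> \<tau> (Suc i)"
    and \<tau>': "\<tau>' 0 = 0" "\<tau>' N' = t" "\<And>i. i < N' \<Longrightarrow> \<tau>' i \<le> \<tau>' (Suc i)"
    using sp unfolding simple_process_def by auto
  define P where "P = \<tau> ` {..N} \<union> \<tau>' ` {..N'}"
  obtain K \<rho> where \<rho>: "\<And>k. k < K \<Longrightarrow> \<rho> k < \<rho> (Suc k)" "\<rho> ` {..K} = P"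
    using finite_set_strict_grid[of P] unfolding P_def by auto
  have \<rho>mono: "\<rho> i \<le> \<rho> j" if "i \<le> j" "j \<le> K" for i j
    by (rule grid_le[OF _ that]) (use \<rho>(1) in \<open>auto intro: less_imp_le\<close>)
  have P: "P \<subseteq> {0..t}"
    using grid_le[of N \<tau> 0] grid_le[of N \<tau> _ N] grid_le[of N' \<tau>' 0] grid_le[of N' \<tau>' _ N'] \<tau> \<tau>'
    unfolding P_def by force
  have "0 \<in> P" "t \<in> P" using \<tau> unfolding P_def by (force, force)
  then obtain i j where ij: "i \<le> K" "\<rho> i = 0" "j \<le> K" "\<rho> j = t"
    unfolding \<rho>(2)[symmetric] by (metis atMost_iff imageE)
  have "\<rho> 0 \<in> P" "\<rho> K \<in> P" using \<rho>(2) by auto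
  then have \<rho>0: "\<rho> 0 = 0" and \<rho>K: "\<rho> K = t"
    using \<rho>mono[of 0 i] \<rho>mono[of j K] ij P by (fastforce, fastforce)
  obtain h where h: "\<And>k. k < K \<Longrightarrow> h k \<in> borel_measurable (F (\<rho> k))"
      "\<And>k. k < K \<Longrightarrow> \<exists>C. \<forall>\<omega>\<in>space M. norm (h k \<omega>) \<le> C"
      "\<And>\<omega>. simple_integral W N \<tau> \<eta> \<omega> = simple_integral W K \<rho> h \<omega>"
      "\<And>k s \<omega>. k < K \<Longrightarrow> s \<in> {\<rho> k<..\<rho> (Suc k)} \<Longrightarrow> simple_value N \<tau> \<eta> s \<omega> = h k \<omega>"
    using simple_process_refine[OF sp(1) \<rho>0 \<rho>K \<rho>(1)] \<rho>(2) unfolding P_def by auto metis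
  obtain h' where h': "\<And>k. k < K \<Longrightarrow> h' k \<in> borel_measurable (F (\<rho> k))"
      "\<And>k. k < K \<Longrightarrow> \<exists>C. \<forall>\<omega>\<in>space M. norm (h' k \<omega>) \<le> C"
      "\<And>\<omega>. simple_integral W N' \<tau>' \<eta>' \<omega> = simple_integral W K \<rho> h' \<omega>"
      "\<And>k s \<omega>. k < K \<Longrightarrow> s \<in> {\<rho> k<..\<rho> (Suc k)} \<Longrightarrow> simple_value N' \<tau>' \<eta>' s \<omega> = h' k \<omega>"
    using simple_process_refine[OF sp(2) \<rho>0 \<rho>K \<rho>(1)] \<rho>(2) unfolding P_def by auto metis
  define H where "H = (\<lambda>k \<omega>. h k \<omega> - h' k \<omega>)"
  have H: "H k \<in> borel_measurable (F (\<rho> k))" if "k < K" for k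
    unfolding H_def using h(1) h'(1) that by (intro borel_measurable_diff)
  obtain C C' where C: "\<And>k \<omega>. k < K \<Longrightarrow> \<omega> \<in> space M \<Longrightarrow> norm (h k \<omega>) \<le> C k"
      "\<And>k \<omega>. k < K \<Longrightarrow> \<omega> \<in> space M \<Longrightarrow> norm (h' k \<omega>) \<le> C' k"
    using h(2) h'(2) by metis
  have bdd: "norm (H k \<omega>) \<le> (\<Sum>k<K. \<bar>C k + C' k\<bar>)" if "k < K" "\<omega> \<in> space M" for k \<omega>
  proof -
    have "norm (H k \<omega>) \<le> norm (h k \<omega>) + norm (h' k \<omega>)"
      unfolding H_def by (rule norm_triangle_ineq4)
    also have "\<dots> \<le> \<bar>C k + C' k\<bar>"
      using C(1)[OF that] C(2)[OF that] by simp
    also have "\<dots> \<le> (\<Sum>k<K. \<bar>C k + C' k\<bar>)"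
      using that by (intro member_le_sum) auto
    finally show ?thesis .
  qed
  have diff: "simple_integral W N \<tau> \<eta> \<omega> - simple_integral W N' \<tau>' \<eta>' \<omega> = simple_integral W K \<rho> H \<omega>" for \<omega>
    unfolding h(3) h'(3)
    by (simp add: simple_integral_def H_def sum_subtractf matrix_vector_mult_diff_rdistrib)
  \<comment> \<open>The cells of the merged grid are disjoint subsets of [0,t], and on each of them
    both simple processes are constant in time.\<close>
  have nn: "ennreal (\<Sum>k<K. (\<rho> (Suc k) - \<rho> k) * (norm (H k \<omega>))\<^sup>2) \<le> (\<integral>\<^sup>+s\<in>{0..t}.
      ennreal ((norm (simple_value N \<tau> \<eta> s \<omega> - simple_value N' \<tau>' \<eta>' s \<omega>))\<^sup>2) \<partial>lborel)" for \<omega>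
  proof -
    have "ennreal (\<Sum>k<K. (\<rho> (Suc k) - \<rho> k) * (norm (H k \<omega>))\<^sup>2) =
      (\<Sum>k<K. \<integral>\<^sup>+s. ennreal ((norm (H k \<omega>))\<^sup>2) * indicator {\<rho> k<..\<rho> (Suc k)} s \<partial>lborel)"
    proof (subst sum_ennreal[symmetric])
      show "(\<Sum>k<K. ennreal ((\<rho> (Suc k) - \<rho> k) * (norm (H k \<omega>))\<^sup>2)) =
        (\<Sum>k<K. \<integral>\<^sup>+s. ennreal ((norm (H k \<omega>))\<^sup>2) * indicator {\<rho> k<..\<rho> (Suc k)} s \<partial>lborel)"
      proof (rule sum.cong)
        fix k assume "k \<in> {..<K}"
        then have "\<rho> k \<le> \<rho> (Suc k)" using \<rho>(1)[of k] by simp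
        then show "ennreal ((\<rho> (Suc k) - \<rho> k) * (norm (H k \<omega>))\<^sup>2) =
          (\<integral>\<^sup>+s. ennreal ((norm (H k \<omega>))\<^sup>2) * indicator {\<rho> k<..\<rho> (Suc k)} s \<partial>lborel)"
          by (subst nn_integral_cmult_indicator) (auto simp: ennreal_mult' mult.commute)
      qed simp
    qed (use \<rho>(1) in \<open>auto intro!: mult_nonneg_nonneg simp: less_imp_le\<close>)
    also have "\<dots> = (\<integral>\<^sup>+s. (\<Sum>k<K. ennreal ((norm (H k \<omega>))\<^sup>2) * indicator {\<rho> k<..\<rho> (Suc k)} s) \<partial>lborel)"
      by (subst nn_integral_sum) auto
    also have "\<dots> \<le> (\<integral>\<^sup>+s\<in>{0..t}.
      ennreal ((norm (simple_value N \<tau> \<eta> s \<omega> - simple_value N' \<tau>' \<eta>' s \<omega>))\<^sup>2) \<partial>lborel)"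
    proof (rule nn_integral_mono)
      fix s :: real
      show "(\<Sum>k<K. ennreal ((norm (H k \<omega>))\<^sup>2) * indicator {\<rho> k<..\<rho> (Suc k)} s) \<le>
        ennreal ((norm (simple_value N \<tau> \<eta> s \<omega> - simple_value N' \<tau>' \<eta>' s \<omega>))\<^sup>2) * indicator {0..t} s"
      proof (cases "\<exists>k<K. s \<in> {\<rho> k<..\<rho> (Suc k)}")
        case True
        then obtain k where k: "k < K" "s \<in> {\<rho> k<..\<rho> (Suc k)}" by blast
        have "s \<in> {0..t}" using k \<rho>mono[of 0 k] \<rho>mono[of "Suc k" K] \<rho>0 \<rho>K by auto
        have "(\<Sum>l<K. ennreal ((norm (H l \<omega>))\<^sup>2) * indicator {\<rho> l<..\<rho> (Suc l)} s) =
          (\<Sum>l\<in>{k}. ennreal ((norm (H l \<omega>))\<^sup>2) * indicator {\<rho> l<..\<rho> (Suc l)} s)"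
        proof (rule sum.mono_neutral_right)
          show "\<forall>l\<in>{..<K} - {k}. ennreal ((norm (H l \<omega>))\<^sup>2) * indicator {\<rho> l<..\<rho> (Suc l)} s = 0"
          proof
            fix l assume "l \<in> {..<K} - {k}"
            then have "s \<notin> {\<rho> l<..\<rho> (Suc l)}"
              using k \<rho>mono[of "Suc l" k] \<rho>mono[of "Suc k" l] by (cases "l < k") auto
            then show "ennreal ((norm (H l \<omega>))\<^sup>2) * indicator {\<rho> l<..\<rho> (Suc l)} s = 0" by simp
          qed
        qed (use k in auto)
        also have "\<dots> = ennreal ((norm (H k \<omega>))\<^sup>2) * indicator {\<rho> k<..\<rho> (Suc k)} s"
          by (subst sum.insert) simp_all
        finally show ?thesis
          using k h(4)[OF k] h'(4)[OF k] \<open>s \<in> {0..t}\<close> by (simp add: H_def)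
      next
        case False
        then have "(\<Sum>k<K. ennreal ((norm (H k \<omega>))\<^sup>2) * indicator {\<rho> k<..\<rho> (Suc k)} s) = 0"
          by (intro sum.neutral) auto
        then show ?thesis by (metis zero_le)
      qed
    qed
    finally show ?thesis .
  qed
  have "prob {\<omega>\<in>space M. \<epsilon> < norm (simple_integral W K \<rho> H \<omega>)} \<le>
    prob {\<omega>\<in>space M. \<delta> < (\<Sum>k<K. (\<rho> (Suc k) - \<rho> k) * (norm (H k \<omega>))\<^sup>2)} +
    real CARD('p) * \<delta> / \<epsilon>\<^sup>2"
    by (rule simple_integral_truncated[OF _ _ H bdd]) (use \<rho>(1) \<rho>0 assms in \<open>auto intro: less_imp_le\<close>)
  moreover have "prob {\<omega>\<in>space M. \<delta> < (\<Sum>k<K. (\<rho> (Suc k) - \<rho> k) * (norm (H k \<omega>))\<^sup>2)} \<le> prob A"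
  proof (rule finite_measure_mono[OF _ A], safe)
    fix \<omega> assume "\<omega> \<in> space M" "\<delta> < (\<Sum>k<K. (\<rho> (Suc k) - \<rho> k) * (norm (H k \<omega>))\<^sup>2)"
    then show "\<omega> \<in> A"
      using \<open>0 \<le> \<delta>\<close> by (intro sub less_le_trans[OF _ nn]) (auto simp: ennreal_less_iff)
  qed
  ultimately show ?thesis unfolding diff by simp
qed

section \<open>The dyadic limit as a version of the integral, and its uniqueness\<close>

lemma AE_dyadic_limit:
  fixes G :: "real \<Rightarrow> real^'p^'d"
  assumes "0 < T" "fine_levels T G m"
  shows "AE \<omega> in M. \<forall>t0\<in>{0..<T}. uniform_limit {0..t0}
    (\<lambda>n. dyadic_integral (\<lambda>s. W s \<omega>) T G (m n)) (\<lambda>t. dyadic_limit W T G m t \<omega>) sequentially"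
  using dyadic_integral_converges[OF assms]
  by eventually_elim (simp add: uniformly_convergent_uniform_limit_iff dyadic_limit_def)

lemma AE_dyadic_limit_tendsto:
  fixes G :: "real \<Rightarrow> real^'p^'d"
  assumes "0 < T" "fine_levels T G m" "t \<in> {0..<T}"
  shows "AE \<omega> in M. (\<lambda>n. dyadic_integral (\<lambda>s. W s \<omega>) T G (m n) t) \<longlonglongrightarrow> dyadic_limit W T G m t \<omega>"
  using AE_dyadic_limit[OF assms(1,2)]
  by eventually_elim (use assms(3) in \<open>auto intro: tendsto_uniform_limitI[where S="{0..t}"]\<close>)

lemma AE_dyadic_limit_continuous:
  fixes G :: "real \<Rightarrow> real^'p^'d"
  assumes "0 < T" "fine_levels T G m"
  shows "AE \<omega> in M. continuous_on {0..<T} (\<lambda>t. dyadic_limit W T G m t \<omega>)"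
  using AE_dyadic_limit[OF assms] AE_continuous
proof eventually_elim
  case (elim \<omega>)
  show ?case
  proof (rule continuous_on_half_open)
    fix t assume t: "t \<in> {0..<T}"
    have "continuous_on {0..t} (dyadic_integral (\<lambda>s. W s \<omega>) T G (m n))" for n
      unfolding dyadic_integral_def
      by (rule continuous_on_subset[OF step_integral_continuous_on[OF elim(2)]])
        (use \<open>0 < T\<close> in \<open>auto intro: dyadic_nonneg\<close>)
    then show "continuous_on {0..t} (\<lambda>t. dyadic_limit W T G m t \<omega>)"
      using elim(1) t by (intro uniform_limit_theorem[where F=sequentially]) auto
  qed
qed

lemma dyadic_limit_measurable:
  fixes G :: "real \<Rightarrow> real^'p^'d"
  assumes "0 \<le> T" "0 \<le> t"
  shows "dyadic_limit W T G m t \<in> borel_measurable (F t)"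
  unfolding dyadic_limit_def[abs_def]
  by (intro borel_measurable_lim_metric dyadic_integral_measurable assms)

lemma has_ito_integral_dyadic_limit:
  fixes G :: "real \<Rightarrow> real^'p^'d"
  assumes T: "0 < T" and cont: "continuous_on {0..<T} G" and fine: "fine_levels T G m"
  shows "has_ito_integral M F W T (\<lambda>s _. G s) (dyadic_limit W T G m)"
  unfolding has_ito_integral_def
proof (intro conjI ballI)
  show "AE \<omega> in M. continuous_on {0..<T} (\<lambda>t. dyadic_limit W T G m t \<omega>)"
    by (rule AE_dyadic_limit_continuous[OF T fine])
next
  fix t assume t: "t \<in> {0..<T}"
  have cont_t: "continuous_on {0..t} G" by (rule continuous_on_subset[OF cont]) (use t in auto)
  have G: "G \<in> borel_measurable (restrict_space borel {0..t})"
    by (rule borel_measurable_continuous_on_restrict[OF cont_t])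
  show "(\<lambda>(s, \<omega>). G s) \<in> borel_measurable (restrict_space borel {0..t} \<Otimes>\<^sub>M F t)"
    unfolding split_beta by (rule measurable_compose[OF measurable_fst G])
  have "bounded (G ` {0..t})"
    by (intro compact_imp_bounded compact_continuous_image cont_t) simp
  then obtain C where C: "\<And>s. s \<in> {0..t} \<Longrightarrow> norm (G s) \<le> C"
    unfolding bounded_iff by blast
  have "(\<integral>\<^sup>+s\<in>{0..t}. ennreal ((norm (G s))\<^sup>2) \<partial>lborel) \<le> (\<integral>\<^sup>+s. ennreal (C\<^sup>2) * indicator {0..t} s \<partial>lborel)"
    by (rule nn_integral_mono) (auto simp: indicator_def intro!: ennreal_leI power_mono C)
  also have "\<dots> < \<infinity>" using t by (simp add: nn_integral_cmult ennreal_mult_less_top)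
  finally show "AE \<omega> in M. (\<integral>\<^sup>+s\<in>{0..t}. ennreal ((norm (G s))\<^sup>2) \<partial>lborel) < \<infinity>" by simp
  show I: "dyadic_limit W T G m t \<in> borel_measurable (F t)"
    using T t by (intro dyadic_limit_measurable) auto
  define \<tau> where "\<tau> = (\<lambda>n i. min t (dyadic T (m n) i))"
  define \<eta> where "\<eta> = (\<lambda>n i (_::'w). G (dyadic T (m n) i))"
  have int: "simple_integral W (2 ^ m n) (\<tau> n) (\<eta> n) \<omega> = dyadic_integral (\<lambda>s. W s \<omega>) T G (m n) t" for n \<omega>
    by (simp add: \<tau>_def \<eta>_def simple_integral_stopped dyadic_integral_def)
  have "(\<lambda>n. T * (1 - (1/2)^n)) \<longlonglongrightarrow> T * (1 - 0)"
    by (intro tendsto_intros LIMSEQ_realpow_zero) auto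
  then have ev: "\<forall>\<^sub>F n in sequentially. t < T * (1 - (1/2)^n)"
    using t by (intro order_tendstoD(1)) auto
  show "\<exists>N \<tau> \<eta>. (\<forall>n. simple_process F t (N n) (\<tau> n) (\<eta> n)) \<and>
        (\<forall>\<epsilon>>0. (\<lambda>n. prob {\<omega>\<in>space M. ennreal \<epsilon> <
             (\<integral>\<^sup>+s\<in>{0..t}. ennreal ((norm (simple_value (N n) (\<tau> n) (\<eta> n) s \<omega> - G s))\<^sup>2) \<partial>lborel)})
           \<longlonglongrightarrow> 0) \<and>
        (\<forall>\<epsilon>>0. (\<lambda>n. prob {\<omega>\<in>space M. \<epsilon> <
             norm (simple_integral W (N n) (\<tau> n) (\<eta> n) \<omega> - dyadic_limit W T G m t \<omega>)})
           \<longlonglongrightarrow> 0)"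
  proof (intro exI[of _ "\<lambda>n. 2 ^ m n"] exI[of _ \<tau>] exI[of _ \<eta>] conjI allI impI)
    show "simple_process F t (2 ^ m n) (\<tau> n) (\<eta> n)" for n
      unfolding \<tau>_def \<eta>_def using T t by (intro dyadic_simple_process) auto
  next
    fix \<epsilon> :: real assume "0 < \<epsilon>"
    have "(\<lambda>n. t * (1/16)^n) \<longlonglongrightarrow> t * 0"
      by (intro tendsto_intros LIMSEQ_realpow_zero) auto
    then have "\<forall>\<^sub>F n in sequentially. t * (1/16)^n < \<epsilon>"
      using \<open>0 < \<epsilon>\<close> by (intro order_tendstoD(2)) auto
    \<comment> \<open>For a deterministic integrand the L2-error of the dyadic approximation is
      deterministic too, so these probabilities are eventually zero and not merely small.\<close>
    with ev have "\<forall>\<^sub>F n in sequentially. prob {\<omega>\<in>space M. ennreal \<epsilon> <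
             (\<integral>\<^sup>+s\<in>{0..t}. ennreal ((norm (simple_value (2 ^ m n) (\<tau> n) (\<eta> n) s \<omega> - G s))\<^sup>2) \<partial>lborel)} = 0"
    proof eventually_elim
      case (elim n)
      have "(\<integral>\<^sup>+s\<in>{0..t}. ennreal ((norm (simple_value (2 ^ m n) (\<tau> n) (\<eta> n) s \<omega> - G s))\<^sup>2) \<partial>lborel)
          \<le> ennreal \<epsilon>" for \<omega>
        unfolding \<tau>_def \<eta>_def
        by (rule order_trans[OF dyadic_simple_error[OF T fine]]) (use elim t in \<open>auto intro: ennreal_leI\<close>)
      then show ?case by (simp add: not_less[symmetric])
    qed
    then show "(\<lambda>n. prob {\<omega>\<in>space M. ennreal \<epsilon> <
             (\<integral>\<^sup>+s\<in>{0..t}. ennreal ((norm (simple_value (2 ^ m n) (\<tau> n) (\<eta> n) s \<omega> - G s))\<^sup>2) \<partial>lborel)})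
           \<longlonglongrightarrow> 0"
      by (rule tendsto_eventually)
  next
    fix \<epsilon> :: real assume "0 < \<epsilon>"
    then show "(\<lambda>n. prob {\<omega>\<in>space M. \<epsilon> <
             norm (simple_integral W (2 ^ m n) (\<tau> n) (\<eta> n) \<omega> - dyadic_limit W T G m t \<omega>)}) \<longlonglongrightarrow> 0"
      unfolding int using T t
      by (intro prob_tendsto_0 AE_dyadic_limit_tendsto fine measurable_F_M[OF dyadic_integral_measurable]
          measurable_F_M[OF I]) auto
  qed
qed

text \<open>Makes the exceptional set in the comparison of approximations an event. Joint
  measurability is available once \<open>G\<close> is extended by zero outside [0,t], which leaves
  the integral unchanged.\<close>

lemma simple_error_measurable:
  fixes \<eta> :: "nat \<Rightarrow> 'w \<Rightarrow> real^'p^'d"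
  assumes sp: "simple_process F t N \<tau> \<eta>" and cont: "continuous_on {0..t} G"
  shows "(\<lambda>\<omega>. \<integral>\<^sup>+s\<in>{0..t}. ennreal ((norm (simple_value N \<tau> \<eta> s \<omega> - G s))\<^sup>2) \<partial>lborel) \<in> borel_measurable M"
proof -
  have [measurable]: "(\<lambda>s. indicator {0..t} s *\<^sub>R G s) \<in> borel_measurable borel"
    by (rule borel_measurable_continuous_on_indicator[OF _ cont]) simp
  have \<eta>: "\<eta> i \<in> borel_measurable M" if "i < N" for i
    using sp that unfolding simple_process_def by (blast intro: measurable_F_M)
  have [measurable]: "(\<lambda>z. simple_value N \<tau> \<eta> (snd z) (fst z)) \<in> borel_measurable (M \<Otimes>\<^sub>M lborel)"
    unfolding simple_value_def
  proof (rule borel_measurable_sum)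
    fix i assume "i \<in> {..<N}"
    then have [measurable]: "\<eta> i \<in> borel_measurable M" using \<eta> by simp
    show "(\<lambda>z. indicator {\<tau> i<..\<tau> (Suc i)} (snd z) *\<^sub>R \<eta> i (fst z)) \<in> borel_measurable (M \<Otimes>\<^sub>M lborel)"
      by measurable
  qed
  have "(\<lambda>\<omega>. \<integral>\<^sup>+s. ennreal ((norm (simple_value N \<tau> \<eta> s \<omega> - indicator {0..t} s *\<^sub>R G s))\<^sup>2) *
      indicator {0..t} s \<partial>lborel) \<in> borel_measurable M"
    by (rule lborel.borel_measurable_nn_integral) (unfold split_beta, measurable)
  also have "(\<lambda>\<omega>. \<integral>\<^sup>+s. ennreal ((norm (simple_value N \<tau> \<eta> s \<omega> - indicator {0..t} s *\<^sub>R G s))\<^sup>2) *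
      indicator {0..t} s \<partial>lborel) =
    (\<lambda>\<omega>. \<integral>\<^sup>+s\<in>{0..t}. ennreal ((norm (simple_value N \<tau> \<eta> s \<omega> - G s))\<^sup>2) \<partial>lborel)"
    by (auto intro!: nn_integral_cong simp: indicator_def fun_eq_iff)
  finally show ?thesis .
qed

text \<open>The given approximating sequence and the dyadic one are both close to \<open>G\<close>
  in L2 with high probability, hence close to each other; \<open>simple_integral_difference\<close>
  carries this over to their integrals.\<close>

lemma has_ito_integral_eq_dyadic_limit:
  fixes G :: "real \<Rightarrow> real^'p^'d"
  assumes T: "0 < T" and cont: "continuous_on {0..<T} G" and fine: "fine_levels T G m"
    and I: "has_ito_integral M F W T (\<lambda>s _. G s) I" and t: "t \<in> {0..<T}"
  shows "AE \<omega> in M. I t \<omega> = dyadic_limit W T G m t \<omega>"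
proof -
  let ?L = "dyadic_limit W T G m t"
  let ?S = "\<lambda>n \<omega>. dyadic_integral (\<lambda>s. W s \<omega>) T G (m n) t"
  have [measurable]: "?L \<in> borel_measurable M" "I t \<in> borel_measurable M"
    using T t I by (auto simp: has_ito_integral_def intro: measurable_F_M[OF dyadic_limit_measurable] measurable_F_M)
  have [measurable]: "?S n \<in> borel_measurable M" for n
    using T t by (auto intro: measurable_F_M[OF dyadic_integral_measurable])
  have cont_t: "continuous_on {0..t} G" by (rule continuous_on_subset[OF cont]) (use t in auto)
  obtain N \<tau> \<eta> where sp: "\<And>k. simple_process F t (N k) (\<tau> k) (\<eta> k)"
    and approx: "\<And>\<epsilon>. \<epsilon> > 0 \<Longrightarrow> (\<lambda>k. prob {\<omega>\<in>space M. ennreal \<epsilon> <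
             (\<integral>\<^sup>+s\<in>{0..t}. ennreal ((norm (simple_value (N k) (\<tau> k) (\<eta> k) s \<omega> - G s))\<^sup>2) \<partial>lborel)})
           \<longlonglongrightarrow> 0"
    and lim: "\<And>\<epsilon>. \<epsilon> > 0 \<Longrightarrow> (\<lambda>k. prob {\<omega>\<in>space M. \<epsilon> <
             norm (simple_integral W (N k) (\<tau> k) (\<eta> k) \<omega> - I t \<omega>)}) \<longlonglongrightarrow> 0"
  proof -
    from I t obtain N \<tau> \<eta> where *: "(\<forall>n. simple_process F t (N n) (\<tau> n) (\<eta> n)) \<and>
        (\<forall>\<epsilon>>0. (\<lambda>n. prob {\<omega>\<in>space M. ennreal \<epsilon> <
             (\<integral>\<^sup>+s\<in>{0..t}. ennreal ((norm (simple_value (N n) (\<tau> n) (\<eta> n) s \<omega> - G s))\<^sup>2) \<partial>lborel)})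
           \<longlonglongrightarrow> 0) \<and>
        (\<forall>\<epsilon>>0. (\<lambda>n. prob {\<omega>\<in>space M. \<epsilon> <
             norm (simple_integral W (N n) (\<tau> n) (\<eta> n) \<omega> - I t \<omega>)})
           \<longlonglongrightarrow> 0)"
      unfolding has_ito_integral_def by blast
    show thesis by (rule that[of N \<tau> \<eta>]) (use * in auto)
  qed
  let ?I = "\<lambda>k. simple_integral W (N k) (\<tau> k) (\<eta> k)"
  have [measurable]: "?I k \<in> borel_measurable M" for k
    using simple_integral_measurable[of "N k" "\<tau> k" "\<eta> k"] sp[of k] unfolding simple_process_def
    by (auto intro: measurable_F_M)
  have "(\<lambda>n. T * (1 - (1/2)^n)) \<longlonglongrightarrow> T * (1 - 0)"
    by (intro tendsto_intros LIMSEQ_realpow_zero) auto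
  then have ev: "\<forall>\<^sub>F n in sequentially. t < T * (1 - (1/2)^n)"
    using t by (intro order_tendstoD(1)) auto
  \<comment> \<open>Three events contribute: \<open>I t\<close> against its approximation
    (\<delta>), the dyadic sum against its limit (\<delta>), and the two approximations against each
    other (\<delta> plus the Chebyshev term).\<close>
  have key: "prob {\<omega>\<in>space M. 3 * \<epsilon> < norm (I t \<omega> - ?L \<omega>)} \<le> \<delta> * (3 + real CARD('p) / \<epsilon>\<^sup>2)"
    if "0 < \<epsilon>" "0 < \<delta>" for \<epsilon> \<delta>
  proof -
    have "(\<lambda>n. t * (1/16)^n) \<longlonglongrightarrow> t * 0"
      by (intro tendsto_intros LIMSEQ_realpow_zero) auto
    \<comment> \<open>The bound \<delta>/4 on each squared L2-error is chosen because (x + y)^2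
      \<le> 2 x^2 + 2 y^2 turns two such errors into \<delta>.\<close>
    then have "\<forall>\<^sub>F n in sequentially. t * (1/16)^n < \<delta> / 4"
      using \<open>0 < \<delta>\<close> by (intro order_tendstoD(2)) auto
    moreover have "(\<lambda>n. prob {\<omega>\<in>space M. \<epsilon> < norm (?S n \<omega> - ?L \<omega>)}) \<longlonglongrightarrow> 0"
      using T t \<open>0 < \<epsilon>\<close> by (intro prob_tendsto_0 AE_dyadic_limit_tendsto fine) auto
    then have "\<forall>\<^sub>F n in sequentially. prob {\<omega>\<in>space M. \<epsilon> < norm (?S n \<omega> - ?L \<omega>)} < \<delta>"
      using \<open>0 < \<delta>\<close> by (rule order_tendstoD(2))
    ultimately have "\<forall>\<^sub>F n in sequentially. t < T * (1 - (1/2)^n) \<and> t * (1/16)^n < \<delta> / 4 \<and>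
        prob {\<omega>\<in>space M. \<epsilon> < norm (?S n \<omega> - ?L \<omega>)} < \<delta>"
      using ev by eventually_elim auto
    then obtain n where n: "t < T * (1 - (1/2)^n)" "t * (1/16)^n < \<delta> / 4"
        "prob {\<omega>\<in>space M. \<epsilon> < norm (?S n \<omega> - ?L \<omega>)} < \<delta>"
      by (auto dest: eventually_happens)
    have "\<forall>\<^sub>F k in sequentially. prob {\<omega>\<in>space M. ennreal (\<delta> / 4) <
        (\<integral>\<^sup>+s\<in>{0..t}. ennreal ((norm (simple_value (N k) (\<tau> k) (\<eta> k) s \<omega> - G s))\<^sup>2) \<partial>lborel)} < \<delta>"
      using \<open>0 < \<delta>\<close> by (intro order_tendstoD(2)[OF approx]) auto
    moreover have "\<forall>\<^sub>F k in sequentially. prob {\<omega>\<in>space M. \<epsilon> < norm (?I k \<omega> - I t \<omega>)} < \<delta>"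
      using \<open>0 < \<delta>\<close> \<open>0 < \<epsilon>\<close> by (intro order_tendstoD(2)[OF lim]) auto
    ultimately have "\<forall>\<^sub>F k in sequentially. prob {\<omega>\<in>space M. ennreal (\<delta> / 4) <
        (\<integral>\<^sup>+s\<in>{0..t}. ennreal ((norm (simple_value (N k) (\<tau> k) (\<eta> k) s \<omega> - G s))\<^sup>2) \<partial>lborel)} < \<delta> \<and>
        prob {\<omega>\<in>space M. \<epsilon> < norm (?I k \<omega> - I t \<omega>)} < \<delta>"
      by eventually_elim auto
    then obtain k where k: "prob {\<omega>\<in>space M. ennreal (\<delta> / 4) <
        (\<integral>\<^sup>+s\<in>{0..t}. ennreal ((norm (simple_value (N k) (\<tau> k) (\<eta> k) s \<omega> - G s))\<^sup>2) \<partial>lborel)} < \<delta>"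
        "prob {\<omega>\<in>space M. \<epsilon> < norm (?I k \<omega> - I t \<omega>)} < \<delta>"
      by (auto dest: eventually_happens)
    let ?A = "{\<omega>\<in>space M. ennreal (\<delta> / 4) <
        (\<integral>\<^sup>+s\<in>{0..t}. ennreal ((norm (simple_value (N k) (\<tau> k) (\<eta> k) s \<omega> - G s))\<^sup>2) \<partial>lborel)}"
    let ?v = "\<lambda>s \<omega>. simple_value (N k) (\<tau> k) (\<eta> k) s \<omega>"
    define \<tau>' where "\<tau>' = (\<lambda>i. min t (dyadic T (m n) i))"
    define \<eta>' where "\<eta>' = (\<lambda>i (_::'w). G (dyadic T (m n) i))"
    let ?v' = "\<lambda>s \<omega>. simple_value (2 ^ m n) \<tau>' \<eta>' s \<omega>"
    have sp': "simple_process F t (2 ^ m n) \<tau>' \<eta>'"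
      unfolding \<tau>'_def \<eta>'_def using T t by (intro dyadic_simple_process) auto
    have int': "simple_integral W (2 ^ m n) \<tau>' \<eta>' \<omega> = ?S n \<omega>" for \<omega>
      by (simp add: \<tau>'_def \<eta>'_def simple_integral_stopped dyadic_integral_def)
    note e[measurable] = simple_error_measurable[OF sp cont_t]
    have meas: "?A \<in> events" using e[of k] by measurable
    have "\<omega> \<in> ?A" if \<omega>: "\<omega> \<in> space M" and less: "ennreal \<delta> < (\<integral>\<^sup>+s\<in>{0..t}.
      ennreal ((norm (?v s \<omega> - ?v' s \<omega>))\<^sup>2) \<partial>lborel)" for \<omega>
    proof (rule ccontr)
      assume "\<omega> \<notin> ?A"
      then have 1: "(\<integral>\<^sup>+s\<in>{0..t}. ennreal ((norm (?v s \<omega> - G s))\<^sup>2) \<partial>lborel) \<le> ennreal (\<delta> / 4)"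
        using \<omega> by (simp add: not_less)
      have 2: "(\<integral>\<^sup>+s\<in>{0..t}. ennreal ((norm (?v' s \<omega> - G s))\<^sup>2) \<partial>lborel) \<le> ennreal (\<delta> / 4)"
        unfolding \<tau>'_def \<eta>'_def
        by (rule order_trans[OF dyadic_simple_error[OF T fine]]) (use n t in \<open>auto intro: ennreal_leI\<close>)
      have G[measurable]: "(\<lambda>s. indicator {0..t} s *\<^sub>R G s) \<in> borel_measurable borel"
        by (rule borel_measurable_continuous_on_indicator[OF _ cont_t]) simp
      have v[measurable]: "(\<lambda>s. ?v s \<omega>) \<in> borel_measurable borel" "(\<lambda>s. ?v' s \<omega>) \<in> borel_measurable borel"
        unfolding simple_value_def by measurable
      have eq: "(\<integral>\<^sup>+s\<in>{0..t}. ennreal ((norm (u s - G s))\<^sup>2) \<partial>lborel) =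
        (\<integral>\<^sup>+s\<in>{0..t}. ennreal ((norm (u s - indicator {0..t} s *\<^sub>R G s))\<^sup>2) \<partial>lborel)" for u
        by (auto intro!: nn_integral_cong simp: indicator_def)
      have "(\<integral>\<^sup>+s\<in>{0..t}. ennreal ((norm (?v s \<omega> - ?v' s \<omega>))\<^sup>2) \<partial>lborel) \<le>
        (\<integral>\<^sup>+s. 2 * (ennreal ((norm (?v s \<omega> - indicator {0..t} s *\<^sub>R G s))\<^sup>2) * indicator {0..t} s) +
          2 * (ennreal ((norm (?v' s \<omega> - indicator {0..t} s *\<^sub>R G s))\<^sup>2) * indicator {0..t} s) \<partial>lborel)"
      proof (rule nn_integral_mono)
        fix s
        let ?g = "indicator {0..t} s *\<^sub>R G s"
        have "(norm (?v s \<omega> - ?v' s \<omega>))\<^sup>2 \<le> (norm (?v s \<omega> - ?g) + norm (?v' s \<omega> - ?g))\<^sup>2"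
          using norm_triangle_ineq4[of "?v s \<omega> - ?g" "?v' s \<omega> - ?g"] by (intro power_mono) auto
        also have "\<dots> \<le> 2 * (norm (?v s \<omega> - ?g))\<^sup>2 + 2 * (norm (?v' s \<omega> - ?g))\<^sup>2"
          using sum_squares_bound[of "norm (?v s \<omega> - ?g)" "norm (?v' s \<omega> - ?g)"]
          by (simp add: power2_sum)
        finally have "ennreal ((norm (?v s \<omega> - ?v' s \<omega>))\<^sup>2) \<le>
            2 * ennreal ((norm (?v s \<omega> - ?g))\<^sup>2) + 2 * ennreal ((norm (?v' s \<omega> - ?g))\<^sup>2)"
          by (simp add: ennreal_leI flip: ennreal_plus ennreal_mult'' ennreal_numeral)
        then show "ennreal ((norm (?v s \<omega> - ?v' s \<omega>))\<^sup>2) * indicator {0..t} s \<le>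
          2 * (ennreal ((norm (?v s \<omega> - ?g))\<^sup>2) * indicator {0..t} s) +
          2 * (ennreal ((norm (?v' s \<omega> - ?g))\<^sup>2) * indicator {0..t} s)"
          by (auto simp: indicator_def)
      qed
      also have "\<dots> = 2 * (\<integral>\<^sup>+s\<in>{0..t}. ennreal ((norm (?v s \<omega> - G s))\<^sup>2) \<partial>lborel) +
          2 * (\<integral>\<^sup>+s\<in>{0..t}. ennreal ((norm (?v' s \<omega> - G s))\<^sup>2) \<partial>lborel)"
        unfolding eq using G v by (subst nn_integral_add) (auto simp: nn_integral_cmult)
      also have "\<dots> \<le> 2 * ennreal (\<delta> / 4) + 2 * ennreal (\<delta> / 4)"
        using 1 2 by (intro add_mono mult_left_mono) auto
      also have "\<dots> = ennreal \<delta>"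
        using \<open>0 < \<delta>\<close> by (simp flip: ennreal_plus ennreal_mult'' ennreal_numeral)
      finally show False using less by simp
    qed
    then have "prob {\<omega>\<in>space M. \<epsilon> < norm (?I k \<omega> - simple_integral W (2 ^ m n) \<tau>' \<eta>' \<omega>)}
        \<le> prob ?A + real CARD('p) * \<delta> / \<epsilon>\<^sup>2"
      using \<open>0 < \<epsilon>\<close> \<open>0 < \<delta>\<close>
      by (intro simple_integral_difference[OF sp sp' _ _ meas]) auto
    then have 3: "prob {\<omega>\<in>space M. \<epsilon> < norm (?I k \<omega> - ?S n \<omega>)} \<le> \<delta> + real CARD('p) * \<delta> / \<epsilon>\<^sup>2"
      unfolding int' using k by simp
    have "prob {\<omega>\<in>space M. 3 * \<epsilon> < norm (I t \<omega> - ?L \<omega>)} \<le>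
      prob ({\<omega>\<in>space M. \<epsilon> < norm (?I k \<omega> - I t \<omega>)} \<union> ({\<omega>\<in>space M. \<epsilon> < norm (?I k \<omega> - ?S n \<omega>)} \<union>
        {\<omega>\<in>space M. \<epsilon> < norm (?S n \<omega> - ?L \<omega>)}))"
    proof (rule finite_measure_mono, rule subsetI, rule ccontr)
      fix \<omega> assume \<omega>: "\<omega> \<in> {\<omega>\<in>space M. 3 * \<epsilon> < norm (I t \<omega> - ?L \<omega>)}"
        "\<omega> \<notin> {\<omega>\<in>space M. \<epsilon> < norm (?I k \<omega> - I t \<omega>)} \<union> ({\<omega>\<in>space M. \<epsilon> < norm (?I k \<omega> - ?S n \<omega>)} \<union>
        {\<omega>\<in>space M. \<epsilon> < norm (?S n \<omega> - ?L \<omega>)})"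
      have "I t \<omega> - ?L \<omega> = (?S n \<omega> - ?L \<omega>) + (?I k \<omega> - ?S n \<omega>) - (?I k \<omega> - I t \<omega>)" by simp
      then have "norm (I t \<omega> - ?L \<omega>) = norm ((?S n \<omega> - ?L \<omega>) + (?I k \<omega> - ?S n \<omega>) - (?I k \<omega> - I t \<omega>))"
        by (rule arg_cong)
      then have "norm (I t \<omega> - ?L \<omega>) \<le>
          norm (?S n \<omega> - ?L \<omega>) + norm (?I k \<omega> - ?S n \<omega>) + norm (?I k \<omega> - I t \<omega>)"
        using norm_triangle_ineq4[of "(?S n \<omega> - ?L \<omega>) + (?I k \<omega> - ?S n \<omega>)" "?I k \<omega> - I t \<omega>"]
          norm_triangle_ineq[of "?S n \<omega> - ?L \<omega>" "?I k \<omega> - ?S n \<omega>"] by linarith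
      with \<omega> show False by (simp add: not_less)
    qed measurable
    also have "\<dots> \<le> \<delta> + ((\<delta> + real CARD('p) * \<delta> / \<epsilon>\<^sup>2) + \<delta>)"
    proof (rule order_trans[OF measure_Un_le])
      show "prob {\<omega>\<in>space M. \<epsilon> < norm (?I k \<omega> - I t \<omega>)} +
        prob ({\<omega>\<in>space M. \<epsilon> < norm (?I k \<omega> - ?S n \<omega>)} \<union> {\<omega>\<in>space M. \<epsilon> < norm (?S n \<omega> - ?L \<omega>)})
        \<le> \<delta> + ((\<delta> + real CARD('p) * \<delta> / \<epsilon>\<^sup>2) + \<delta>)"
        by (intro add_mono order_trans[OF measure_Un_le]) (use k 3 n in auto)
    qed measurable
    finally show ?thesis by (simp add: algebra_simps)
  qed
  \<comment> \<open>The factor of \<delta> in \<open>key\<close> depends on \<epsilon> alone, so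
    \<delta> may tend to zero while \<epsilon> is fixed.\<close>
  have zero: "prob {\<omega>\<in>space M. 3 * \<epsilon> < norm (I t \<omega> - ?L \<omega>)} = 0" if "0 < \<epsilon>" for \<epsilon>
  proof -
    let ?c = "3 + real CARD('p) / \<epsilon>\<^sup>2"
    have c: "0 < ?c" by (simp add: add_pos_nonneg)
    have "prob {\<omega>\<in>space M. 3 * \<epsilon> < norm (I t \<omega> - ?L \<omega>)} \<le> 0 + e" if "0 < e" for e
      using key[OF \<open>0 < \<epsilon>\<close>, of "e / ?c"] c that by simp
    then have "prob {\<omega>\<in>space M. 3 * \<epsilon> < norm (I t \<omega> - ?L \<omega>)} \<le> 0"
      by (rule field_le_epsilon)
    then show ?thesis by (simp add: antisym)
  qed
  have "AE \<omega> in M. \<forall>i. \<not> 3 * (1 / real (Suc i)) < norm (I t \<omega> - ?L \<omega>)"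
    unfolding AE_all_countable
  proof
    fix i
    have "emeasure M {\<omega>\<in>space M. 3 * (1 / real (Suc i)) < norm (I t \<omega> - ?L \<omega>)} = 0"
      unfolding emeasure_eq_measure using zero[of "1 / real (Suc i)"] by simp
    then show "AE \<omega> in M. \<not> 3 * (1 / real (Suc i)) < norm (I t \<omega> - ?L \<omega>)"
      by (subst AE_iff_measurable[OF _ refl]) auto
  qed
  then show ?thesis
  proof eventually_elim
    case (elim \<omega>)
    show ?case
    proof (rule ccontr)
      assume "I t \<omega> \<noteq> ?L \<omega>"
      then have "0 < norm (I t \<omega> - ?L \<omega>) / 3" by simp
      then obtain i where "1 / real (Suc i) < norm (I t \<omega> - ?L \<omega>) / 3"
        using nat_approx_posE by blast
      then show False using elim[rule_format, of i] by simp
    qed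
  qed
qed

lemma has_ito_integral_eq_dyadic_limit_path:
  fixes G :: "real \<Rightarrow> real^'p^'d"
  assumes T: "0 < T" and cont: "continuous_on {0..<T} G" and fine: "fine_levels T G m"
    and I: "has_ito_integral M F W T (\<lambda>s _. G s) I"
  shows "AE \<omega> in M. \<forall>t\<in>{0..<T}. I t \<omega> = dyadic_limit W T G m t \<omega>"
proof (rule AE_eq_continuous)
  show "AE \<omega> in M. continuous_on {0..<T} (\<lambda>t. I t \<omega>)"
    using I unfolding has_ito_integral_def by blast
  show "AE \<omega> in M. continuous_on {0..<T} (\<lambda>t. dyadic_limit W T G m t \<omega>)"
    by (rule AE_dyadic_limit_continuous[OF T fine])
qed (rule has_ito_integral_eq_dyadic_limit[OF assms])

end

section \<open>The product rule\<close>

lemma integral_grid: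
  fixes f :: "real \<Rightarrow> 'a::banach"
  assumes "\<And>i. i < N \<Longrightarrow> \<tau> i \<le> \<tau> (Suc i)" "f integrable_on {\<tau> 0..\<tau> N}"
  shows "integral {\<tau> 0..\<tau> N} f = (\<Sum>i<N. integral {\<tau> i..\<tau> (Suc i)} f)"
  using assms
proof (induction N)
  case (Suc N)
  have le: "\<tau> 0 \<le> \<tau> N" "\<tau> N \<le> \<tau> (Suc N)"
    using grid_le[of "Suc N" \<tau> 0 N] Suc.prems by auto
  have "f integrable_on {\<tau> 0..\<tau> N}"
    by (rule integrable_on_subinterval[OF Suc.prems(2)]) (use le in auto)
  with Suc Henstock_Kurzweil_Integration.integral_combine[OF le Suc.prems(2)] show ?case by simp
qed simp

text \<open>Summation by parts moves the differences from the path, which may have infinite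
  variation, to \<open>K\<close>. Evaluating the step integral at the right end of each cell makes
  the identity exact, without a second-order remainder.\<close>

lemma step_integral_Abel:
  fixes A :: "nat \<Rightarrow> real^'p^'d" and K :: "real \<Rightarrow> real^'d^'d"
  assumes mono: "\<And>i. i < N \<Longrightarrow> \<tau> i \<le> \<tau> (Suc i)" and "\<tau> 0 = 0" "0 \<le> t" "t \<le> \<tau> N"
  shows "step_integral w N \<tau> (\<lambda>i. K (\<tau> i) ** A i) t = K t *v step_integral w N \<tau> A t -
    (\<Sum>i<N. (K (min t (\<tau> (Suc i))) - K (min t (\<tau> i))) *v step_integral w N \<tau> A (min t (\<tau> (Suc i))))"
proof -
  define \<sigma> where "\<sigma> = (\<lambda>i. min t (\<tau> i))"
  define S where "S = step_integral w N \<tau> A"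
  \<comment> \<open>A cell starting after \<open>t\<close> degenerates, both stopped ends being
    \<open>t\<close>; so the coefficient \<open>K (\<tau> i)\<close> can be replaced by
    \<open>K (\<sigma> i)\<close> everywhere.\<close>
  have inc: "(K (\<tau> i) ** A i) *v (w (\<sigma> (Suc i)) - w (\<sigma> i)) = K (\<sigma> i) *v (S (\<sigma> (Suc i)) - S (\<sigma> i))"
    if "i < N" for i
  proof (cases "\<tau> i \<le> t")
    case True
    then have "\<sigma> i = \<tau> i" "\<sigma> i \<le> \<sigma> (Suc i)" "\<sigma> (Suc i) \<le> \<tau> (Suc i)"
      using mono[OF that] by (auto simp: \<sigma>_def)
    then have "S (\<sigma> (Suc i)) - S (\<sigma> i) = A i *v (w (\<sigma> (Suc i)) - w (\<sigma> i))"
      unfolding S_def using that by (intro step_integral_increment mono) auto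
    then show ?thesis using \<open>\<sigma> i = \<tau> i\<close> by (simp add: matrix_vector_mul_assoc)
  next
    case False
    then have "\<sigma> (Suc i) = \<sigma> i" using mono[OF that] by (auto simp: \<sigma>_def)
    then show ?thesis by simp
  qed
  have "step_integral w N \<tau> (\<lambda>i. K (\<tau> i) ** A i) t =
      (\<Sum>i<N. K (\<sigma> i) *v (S (\<sigma> (Suc i)) - S (\<sigma> i)))"
    unfolding step_integral_def using inc by (auto intro!: sum.cong simp: \<sigma>_def)
  also have "\<dots> = (\<Sum>i<N. (K (\<sigma> (Suc i)) *v S (\<sigma> (Suc i)) - K (\<sigma> i) *v S (\<sigma> i)) -
      (K (\<sigma> (Suc i)) - K (\<sigma> i)) *v S (\<sigma> (Suc i)))"
    by (intro sum.cong) (auto simp: matrix_vector_mult_diff_distrib matrix_vector_mult_diff_rdistrib)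
  also have "\<dots> = K (\<sigma> N) *v S (\<sigma> N) - K (\<sigma> 0) *v S (\<sigma> 0) -
      (\<Sum>i<N. (K (\<sigma> (Suc i)) - K (\<sigma> i)) *v S (\<sigma> (Suc i)))"
    by (subst sum_subtractf) (simp only: sum_lessThan_telescope[of "\<lambda>i. K (\<sigma> i) *v S (\<sigma> i)"])
  also have "S (\<sigma> 0) = 0"
    unfolding S_def using assms grid_le[of N \<tau> 0] by (simp add: \<sigma>_def step_integral_0)
  also have "\<sigma> N = t" using assms by (simp add: \<sigma>_def)
  finally show ?thesis by (simp add: S_def \<sigma>_def)
qed

text \<open>On each cell the increment of \<open>K\<close> is the integral of \<open>K'\<close>. The
  error is thus the integral of \<open>K'\<close> applied to the difference between
  \<open>S n\<close> at the right end and \<open>I\<close>, which is small because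
  \<open>S n\<close> is uniformly near \<open>I\<close> and \<open>I\<close> is uniformly
  continuous. The condition \<open>n \<le> m n\<close> makes the mesh tend to zero.\<close>

lemma riemann_sum_tendsto:
  fixes K :: "real \<Rightarrow> real^'d^'d" and I :: "real \<Rightarrow> real^'d"
  assumes "0 \<le> T" "0 \<le> t" "t \<le> T" and K: "\<And>s. s \<in> {0..t} \<Longrightarrow> (K has_vector_derivative K' s) (at s within {0..t})"
    and K': "continuous_on {0..t} K'" and I: "continuous_on {0..t} I"
    and S: "uniform_limit {0..t} S I sequentially" and m: "\<And>n. n \<le> m n"
  shows "(\<lambda>n. \<Sum>i<2^m n. (K (min t (dyadic T (m n) (Suc i))) - K (min t (dyadic T (m n) i))) *v
      S n (min t (dyadic T (m n) (Suc i)))) \<longlonglongrightarrow> integral {0..t} (\<lambda>s. K' s *v I s)"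
    (is "?R \<longlonglongrightarrow> ?J")
proof (rule LIMSEQ_I)
  fix r :: real assume "0 < r"
  have "bounded (K' ` {0..t})"
    by (intro compact_imp_bounded compact_continuous_image K') simp
  then obtain C where C: "C > 0" "\<And>s. s \<in> {0..t} \<Longrightarrow> norm (K' s) \<le> C"
    unfolding bounded_pos by blast
  \<comment> \<open>The total error will be at most \<open>C * (e + e) * t\<close>; the factor
    \<open>t + 1\<close> in place of \<open>t\<close> covers \<open>t = 0\<close>.\<close>
  define e where "e = r / (2 * (C * (t + 1)))"
  have e: "0 < e" "C * (e + e) * t < r"
  proof -
    show "0 < e" using C(1) \<open>0 < r\<close> \<open>0 \<le> t\<close> by (simp add: e_def)
    then have "C * (e + e) * t < C * (e + e) * (t + 1)" using C(1) by simp
    also have "\<dots> = 2 * (C * (t + 1)) * e" by (simp add: algebra_simps)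
    also have "\<dots> = r"
    proof -
      have "0 < C * (t + 1)" using C(1) \<open>0 \<le> t\<close> by simp
      then have "2 * (C * (t + 1)) \<noteq> 0" by linarith
      then show ?thesis unfolding e_def times_divide_eq_right by (rule nonzero_mult_div_cancel_left)
    qed
    finally show "C * (e + e) * t < r" .
  qed
  have "uniformly_continuous_on {0..t} I"
    by (rule compact_uniformly_continuous[OF I]) simp
  then obtain d where d: "0 < d" "\<And>x x'. x \<in> {0..t} \<Longrightarrow> x' \<in> {0..t} \<Longrightarrow> dist x' x < d \<Longrightarrow> dist (I x') (I x) < e"
    using e(1) unfolding uniformly_continuous_on_def by metis
  have "(\<lambda>n. T * (1/2)^n) \<longlonglongrightarrow> T * 0"
    by (intro tendsto_intros LIMSEQ_realpow_zero) auto
  then have "\<forall>\<^sub>F n in sequentially. T * (1/2)^n < d" using d(1) by (intro order_tendstoD(2)) auto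
  moreover have "\<forall>\<^sub>F n in sequentially. \<forall>x\<in>{0..t}. dist (S n x) (I x) < e"
    using uniform_limitD[OF S e(1)] .
  ultimately have "\<forall>\<^sub>F n in sequentially. norm (?R n - ?J) < r"
  proof eventually_elim
    case (elim n)
    define \<sigma> where "\<sigma> = (\<lambda>i. min t (dyadic T (m n) i))"
    have \<sigma>: "\<sigma> i \<le> \<sigma> (Suc i)" "\<sigma> i \<in> {0..t}" "\<sigma> (Suc i) - \<sigma> i < d" for i
    proof -
      have "T / 2 ^ m n \<le> T * (1/2)^n"
        using m[of n] \<open>0 \<le> T\<close> by (simp add: power_one_over divide_simps mult_left_mono)
      then show "\<sigma> (Suc i) - \<sigma> i < d"
        using dyadic_Suc[of T "m n" i] elim(1) \<open>0 \<le> T\<close> d(1) by (auto simp: \<sigma>_def min_def)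
      show "\<sigma> i \<le> \<sigma> (Suc i)" using dyadic_mono[of T i "Suc i" "m n"] \<open>0 \<le> T\<close> by (auto simp: \<sigma>_def)
      show "\<sigma> i \<in> {0..t}" using dyadic_nonneg[of T "m n" i] \<open>0 \<le> T\<close> \<open>0 \<le> t\<close> by (auto simp: \<sigma>_def)
    qed
    have ends: "\<sigma> 0 = 0" "\<sigma> (2 ^ m n) = t" using assms by (auto simp: \<sigma>_def)
    have cKI: "continuous_on {0..t} (\<lambda>s. K' s *v I s)" by (intro continuous_intros K' I)
    have summand: "norm ((K (\<sigma> (Suc i)) - K (\<sigma> i)) *v S n (\<sigma> (Suc i)) - integral {\<sigma> i..\<sigma> (Suc i)} (\<lambda>s. K' s *v I s))
        \<le> C * (e + e) * (\<sigma> (Suc i) - \<sigma> i)" for i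
    proof -
      let ?c = "S n (\<sigma> (Suc i))"
      have sub: "{\<sigma> i..\<sigma> (Suc i)} \<subseteq> {0..t}" using \<sigma>(2)[of i] \<sigma>(2)[of "Suc i"] by auto
      have "(K' has_integral (K (\<sigma> (Suc i)) - K (\<sigma> i))) {\<sigma> i..\<sigma> (Suc i)}"
        using \<sigma>(1) sub by (intro fundamental_theorem_of_calculus has_vector_derivative_within_subset[OF K]) auto
      then have "((\<lambda>s. K' s *v ?c) has_integral ((K (\<sigma> (Suc i)) - K (\<sigma> i)) *v ?c)) {\<sigma> i..\<sigma> (Suc i)}"
        using has_integral_linear[OF _ bounded_bilinear.bounded_linear_left[OF bounded_bilinear_matrix_vector_mult]]
        by (auto simp: o_def)
      moreover have "((\<lambda>s. K' s *v I s) has_integral integral {\<sigma> i..\<sigma> (Suc i)} (\<lambda>s. K' s *v I s)) {\<sigma> i..\<sigma> (Suc i)}"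
        by (intro integrable_integral integrable_continuous_real continuous_on_subset[OF cKI sub])
      ultimately have "((\<lambda>s. K' s *v ?c - K' s *v I s) has_integral
          ((K (\<sigma> (Suc i)) - K (\<sigma> i)) *v ?c - integral {\<sigma> i..\<sigma> (Suc i)} (\<lambda>s. K' s *v I s))) {\<sigma> i..\<sigma> (Suc i)}"
        by (rule has_integral_diff)
      moreover have "norm (K' s *v ?c - K' s *v I s) \<le> C * (e + e)" if s: "s \<in> {\<sigma> i..\<sigma> (Suc i)}" for s
      proof -
        have "norm (?c - I s) \<le> dist ?c (I (\<sigma> (Suc i))) + dist (I (\<sigma> (Suc i))) (I s)"
          using dist_triangle[of ?c "I s" "I (\<sigma> (Suc i))"] by (simp add: dist_norm)
        also have "\<dots> \<le> e + e"
        proof (rule add_mono)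
          show "dist ?c (I (\<sigma> (Suc i))) \<le> e" using elim(2) \<sigma>(2)[of "Suc i"] by (auto intro: less_imp_le)
          show "dist (I (\<sigma> (Suc i))) (I s) \<le> e"
            using d(2)[of s "\<sigma> (Suc i)"] s sub \<sigma>(2,3)[of i] \<sigma>(2)[of "Suc i"] by (auto simp: dist_real_def)
        qed
        finally have "norm (K' s) * norm (?c - I s) \<le> C * (e + e)"
          using C s sub by (intro mult_mono) auto
        then show ?thesis
          using norm_matrix_vector_mult_le[of "K' s" "?c - I s"]
          by (simp add: matrix_vector_mult_diff_distrib)
      qed
      ultimately have "norm ((K (\<sigma> (Suc i)) - K (\<sigma> i)) *v ?c - integral {\<sigma> i..\<sigma> (Suc i)} (\<lambda>s. K' s *v I s))
          \<le> C * (e + e) * measure lborel {\<sigma> i..\<sigma> (Suc i)}"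
        using C(1) e(1) by (intro has_integral_bound_real[where S="{}"]) auto
      then show ?thesis using \<sigma>(1)[of i] by simp
    qed
    have "?R n - ?J = (\<Sum>i<2^m n. (K (\<sigma> (Suc i)) - K (\<sigma> i)) *v S n (\<sigma> (Suc i)) -
        integral {\<sigma> i..\<sigma> (Suc i)} (\<lambda>s. K' s *v I s))"
      using integral_grid[of "2 ^ m n" \<sigma> "\<lambda>s. K' s *v I s"] \<sigma>(1) ends integrable_continuous_real[OF cKI]
      by (simp add: \<sigma>_def sum_subtractf)
    also have "norm \<dots> \<le> (\<Sum>i<2^m n. C * (e + e) * (\<sigma> (Suc i) - \<sigma> i))"
      by (intro sum_norm_le summand)
    also have "\<dots> = C * (e + e) * t"
      unfolding sum_distrib_left[symmetric] sum_lessThan_telescope ends by simp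
    finally show ?case using e(2) by simp
  qed
  then show "\<exists>no. \<forall>n\<ge>no. norm (?R n - ?J) < r" by (simp add: eventually_sequentially)
qed

text \<open>Including \<open>n\<close> itself in the maximum forces the mesh to tend to
  zero.\<close>

lemma common_fine_levels:
  assumes "0 < T" "continuous_on {0..<T} G" "continuous_on {0..<T} H"
  obtains m where "fine_levels T G m" "fine_levels T H m" "\<And>n. n \<le> m n"
proof -
  obtain m m' where "fine_levels T G m" "fine_levels T H m'"
    using fine_levels_exist assms by metis
  then show thesis
    by (intro that[of "\<lambda>n. max n (max (m n) (m' n))"])
      (use \<open>0 < T\<close> in \<open>auto elim!: fine_levels_mono\<close>)
qed

text \<open>A passage to the limit in \<open>step_integral_Abel\<close> on a single path. Both sides
  are limits along the same grids, which is the purpose of the shared levels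
  \<open>m\<close>.\<close>

lemma (in wiener) dyadic_limit_product:
  fixes G :: "real \<Rightarrow> real^'p^'d" and K :: "real \<Rightarrow> real^'d^'d"
  assumes T: "0 < T" and m: "\<And>n. n \<le> m n"
    and fine: "fine_levels T G m" "fine_levels T (\<lambda>s. K s ** G s) m"
    and K: "\<And>s. s \<in> {0..<T} \<Longrightarrow> (K has_vector_derivative K' s) (at s within {0..<T})"
    and K': "continuous_on {0..<T} K'"
  shows "AE \<omega> in M. \<forall>t\<in>{0..<T}. dyadic_limit W T (\<lambda>s. K s ** G s) m t \<omega> =
    K t *v dyadic_limit W T G m t \<omega> - integral {0..t} (\<lambda>s. K' s *v dyadic_limit W T G m s \<omega>)"
  using AE_dyadic_limit[OF T fine(1)] AE_dyadic_limit[OF T fine(2)] AE_dyadic_limit_continuous[OF T fine(1)]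
proof eventually_elim
  case (elim \<omega>)
  let ?w = "\<lambda>s. W s \<omega>"
  show ?case
  proof
    fix t assume t: "t \<in> {0..<T}"
    then have sub: "{0..t} \<subseteq> {0..<T}" by auto
    have S: "uniform_limit {0..t} (\<lambda>n. dyadic_integral ?w T G (m n)) (\<lambda>t. dyadic_limit W T G m t \<omega>) sequentially"
      using elim(1) t by blast
    have "(\<lambda>n. dyadic_integral ?w T (\<lambda>s. K s ** G s) (m n) t) \<longlonglongrightarrow> dyadic_limit W T (\<lambda>s. K s ** G s) m t \<omega>"
      using elim(2) t by (auto intro: tendsto_uniform_limitI[where S="{0..t}"])
    moreover have "(\<lambda>n. K t *v dyadic_integral ?w T G (m n) t -
      (\<Sum>i<2^m n. (K (min t (dyadic T (m n) (Suc i))) - K (min t (dyadic T (m n) i))) *v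
        dyadic_integral ?w T G (m n) (min t (dyadic T (m n) (Suc i))))) \<longlonglongrightarrow>
      K t *v dyadic_limit W T G m t \<omega> - integral {0..t} (\<lambda>s. K' s *v dyadic_limit W T G m s \<omega>)"
    proof (rule tendsto_diff)
      show "(\<lambda>n. K t *v dyadic_integral ?w T G (m n) t) \<longlonglongrightarrow> K t *v dyadic_limit W T G m t \<omega>"
        using t by (intro bounded_bilinear.tendsto[OF bounded_bilinear_matrix_vector_mult] tendsto_const
            tendsto_uniform_limitI[OF S]) auto
      show "(\<lambda>n. \<Sum>i<2^m n. (K (min t (dyadic T (m n) (Suc i))) - K (min t (dyadic T (m n) i))) *v
        dyadic_integral ?w T G (m n) (min t (dyadic T (m n) (Suc i)))) \<longlonglongrightarrow>
        integral {0..t} (\<lambda>s. K' s *v dyadic_limit W T G m s \<omega>)"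
        using t T sub
        by (intro riemann_sum_tendsto S m continuous_on_subset[OF K' sub] continuous_on_subset[OF elim(3) sub]
            has_vector_derivative_within_subset[OF K sub]) auto
    qed
    moreover have "dyadic_integral ?w T (\<lambda>s. K s ** G s) (m n) t = K t *v dyadic_integral ?w T G (m n) t -
      (\<Sum>i<2^m n. (K (min t (dyadic T (m n) (Suc i))) - K (min t (dyadic T (m n) i))) *v
        dyadic_integral ?w T G (m n) (min t (dyadic T (m n) (Suc i))))" for n
      unfolding dyadic_integral_def using T t
      by (intro step_integral_Abel) (auto intro: dyadic_mono)
    ultimately show "dyadic_limit W T (\<lambda>s. K s ** G s) m t \<omega> =
      K t *v dyadic_limit W T G m t \<omega> - integral {0..t} (\<lambda>s. K' s *v dyadic_limit W T G m s \<omega>)"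
      using LIMSEQ_unique by simp
  qed
qed

section \<open>The deterministic linear equation\<close>

lemma matrix_inv_eq:
  fixes A B :: "real^'n^'n"
  assumes "A ** B = mat 1"
  shows "matrix_inv A = B"
proof -
  have "B ** A = mat 1" using assms by (simp add: matrix_left_right_inverse)
  with assms have "A ** matrix_inv A = mat 1 \<and> matrix_inv A ** A = mat 1"
    unfolding matrix_inv_def by (intro someI[of "\<lambda>A'. A ** A' = mat 1 \<and> A' ** A = mat 1"]) simp
  then have "matrix_inv A = matrix_inv A ** (A ** B)" "(matrix_inv A ** A) ** B = B"
    using assms by simp_all
  then show ?thesis by (simp add: matrix_mul_assoc)
qed

text \<open>Presents the inverse as a quotient of polynomials in the entries, from which its
  continuity can be read off.\<close>

lemma matrix_inv_cramer:
  fixes A :: "real^'n^'n"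
  assumes "invertible A"
  shows "matrix_inv A $ k $ l = det (\<chi> i j. if j = k then axis l 1 $ i else A $ i $ j) / det A"
proof -
  obtain B where B: "A ** B = mat 1" using assms unfolding invertible_def by blast
  have "A *v (B *v axis l 1) = axis l 1" by (simp add: matrix_vector_mul_assoc B)
  then have "B *v axis l 1 = (\<chi> k. det (\<chi> i j. if j = k then axis l 1 $ i else A $ i $ j) / det A)"
    using cramer[of A "B *v axis l 1" "axis l 1"] assms by (simp add: invertible_det_nz)
  then have "(B *v axis l 1) $ k = det (\<chi> i j. if j = k then axis l 1 $ i else A $ i $ j) / det A"
    by simp
  then show ?thesis by (simp add: matrix_inv_eq[OF B] matrix_vector_mul_component inner_axis)
qed

lemma continuous_on_det:
  fixes A :: "'a::topological_space \<Rightarrow> real^'n^'n"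
  assumes "\<And>i j. continuous_on S (\<lambda>x. A x $ i $ j)"
  shows "continuous_on S (\<lambda>x. det (A x))"
  unfolding det_def by (intro continuous_intros assms)

lemma continuous_on_matrix_inv:
  fixes A :: "'a::topological_space \<Rightarrow> real^'n^'n"
  assumes "continuous_on S A" and inv: "\<And>x. x \<in> S \<Longrightarrow> invertible (A x)"
  shows "continuous_on S (\<lambda>x. matrix_inv (A x))"
proof -
  have A: "continuous_on S (\<lambda>x. A x $ i $ j)" for i j
    by (intro continuous_intros assms)
  have "continuous_on S (\<lambda>x. \<chi> k l. det (\<chi> i j. if j = k then axis l 1 $ i else A x $ i $ j) / det (A x))"
  proof (intro continuous_on_vec_lambda continuous_on_divide continuous_on_det)
    fix k l i j
    show "continuous_on S (\<lambda>x. (\<chi> i j. if j = k then axis l 1 $ i else A x $ i $ j) $ i $ j)"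
      using A by (cases "j = k") auto
  qed (use A inv in \<open>auto simp: invertible_det_nz\<close>)
  moreover have "matrix_inv (A x) = (\<chi> k l. det (\<chi> i j. if j = k then axis l 1 $ i else A x $ i $ j) / det (A x))"
    if "x \<in> S" for x
    using matrix_inv_cramer[OF inv[OF that]] by (simp add: vec_eq_iff)
  ultimately show ?thesis by (simp cong: continuous_on_cong)
qed

text \<open>The squared norm of \<open>X\<close> is decreasing after \<open>s\<close> when multiplied by \<open>exp (- 2 C t)\<close>, and increasing
  before \<open>s\<close> when multiplied by \<open>exp (2 C t)\<close>.\<close>

lemma ode_zero:
  fixes X :: "real \<Rightarrow> 'a::real_inner"
  assumes X: "\<And>t. t \<in> {a..b} \<Longrightarrow> (X has_vector_derivative X' t) (at t within {a..b})"
    and bound: "\<And>t. t \<in> {a..b} \<Longrightarrow> norm (X' t) \<le> C * norm (X t)"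
    and s: "s \<in> {a..b}" "X s = 0" and t: "t \<in> {a..b}"
  shows "X t = 0"
proof -
  define f where "f = (\<lambda>t. X t \<bullet> X t)"
  have Xd: "(X has_vector_derivative X' u) (at u)" if "a < u" "u < b" for u
    using X[of u] that by (simp add: at_within_Icc_at)
  have fd: "(f has_real_derivative 2 * (X u \<bullet> X' u)) (at u)" if "a < u" "u < b" for u
    using bounded_bilinear.has_vector_derivative[OF bounded_bilinear_inner Xd[OF that] Xd[OF that]]
    by (simp add: f_def has_real_derivative_iff_has_vector_derivative inner_commute)
  have fb: "\<bar>2 * (X u \<bullet> X' u)\<bar> \<le> 2 * C * f u" if "u \<in> {a..b}" for u
  proof -
    have "\<bar>X u \<bullet> X' u\<bar> \<le> norm (X u) * norm (X' u)" by (rule Cauchy_Schwarz_ineq2)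
    also have "\<dots> \<le> norm (X u) * (C * norm (X u))" using bound[OF that] by (intro mult_left_mono) auto
    finally show ?thesis by (simp add: f_def dot_square_norm power2_eq_square algebra_simps)
  qed
  have cX: "continuous_on {a..b} X"
    using X by (meson continuous_on_eq_continuous_within has_vector_derivative_continuous)
  have cf: "continuous_on {a..b} f" unfolding f_def by (intro continuous_intros cX)
  have gd: "((\<lambda>u. f u * exp (c * u)) has_real_derivative (2 * (X u \<bullet> X' u) + c * f u) * exp (c * u)) (at u)"
    if "a < u" "u < b" for u c
    by (auto intro!: derivative_eq_intros fd[OF that] simp: algebra_simps)
  have "f t \<le> 0"
  proof (cases "s \<le> t")
    case True
    have "f t * exp (- (2 * C) * t) \<le> f s * exp (- (2 * C) * s)"
    proof (rule DERIV_nonpos_imp_decreasing_open[OF True])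
      fix u assume u: "s < u" "u < t"
      then have "(2 * (X u \<bullet> X' u) + - (2 * C) * f u) * exp (- (2 * C) * u) \<le> 0"
        using fb[of u] s t by (intro mult_nonpos_nonneg) auto
      with gd[of u "- (2 * C)"] u s t
      show "\<exists>y. ((\<lambda>u. f u * exp (- (2 * C) * u)) has_real_derivative y) (at u) \<and> y \<le> 0" by auto
    qed (use s t in \<open>auto intro!: continuous_intros continuous_on_subset[OF cf]\<close>)
    then show ?thesis using s by (simp add: f_def mult_le_0_iff)
  next
    case False
    then have "t \<le> s" by simp
    have "f t * exp (2 * C * t) \<le> f s * exp (2 * C * s)"
    proof (rule DERIV_nonneg_imp_increasing_open[OF \<open>t \<le> s\<close>])
      fix u assume u: "t < u" "u < s"
      then have "(2 * (X u \<bullet> X' u) + 2 * C * f u) * exp (2 * C * u) \<ge> 0"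
        using fb[of u] s t by (intro mult_nonneg_nonneg) auto
      with gd[of u "2 * C"] u s t
      show "\<exists>y. ((\<lambda>u. f u * exp (2 * C * u)) has_real_derivative y) (at u) \<and> y \<ge> 0" by auto
    qed (use s t in \<open>auto intro!: continuous_intros continuous_on_subset[OF cf]\<close>)
    then show ?thesis using s by (simp add: f_def mult_le_0_iff)
  qed
  then show ?thesis by (simp add: f_def dot_square_norm)
qed

text \<open>By the fundamental theorem \<open>D\<close> solves D' = A D with value 0 at time 0, and
  \<open>A\<close> is bounded on [0,t].\<close>

lemma integral_equation_zero:
  fixes D :: "real \<Rightarrow> real^'d" and A :: "real \<Rightarrow> real^'d^'d"
  assumes D: "continuous_on {0..<T} D" and A: "continuous_on {0..<T} A"
    and eq: "\<And>t. t \<in> {0..<T} \<Longrightarrow> D t = integral {0..t} (\<lambda>s. A s *v D s)" and t: "t \<in> {0..<T}"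
  shows "D t = 0"
proof -
  have sub: "{0..t} \<subseteq> {0..<T}" using t by auto
  have cAD: "continuous_on {0..t} (\<lambda>s. A s *v D s)"
    by (intro continuous_intros continuous_on_subset[OF D sub] continuous_on_subset[OF A sub])
  have "bounded (A ` {0..t})"
    by (intro compact_imp_bounded compact_continuous_image continuous_on_subset[OF A sub]) simp
  then obtain C where C: "\<And>s. s \<in> {0..t} \<Longrightarrow> norm (A s) \<le> C"
    unfolding bounded_iff by blast
  show ?thesis
  proof (rule ode_zero[where s=0])
    fix u assume u: "u \<in> {0..t}"
    have "((\<lambda>u. integral {0..u} (\<lambda>s. A s *v D s)) has_vector_derivative A u *v D u) (at u within {0..t})"
      by (rule integral_has_vector_derivative[OF cAD u])
    then show "(D has_vector_derivative A u *v D u) (at u within {0..t})"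
      by (rule has_vector_derivative_transform[OF u, rotated]) (use eq sub in auto)
    have "norm (A u *v D u) \<le> norm (A u) * norm (D u)" by (rule norm_matrix_vector_mult_le)
    also have "\<dots> \<le> C * norm (D u)" by (intro mult_right_mono C u) simp
    finally show "norm (A u *v D u) \<le> C * norm (D u)" .
  next
    have "D 0 = integral {0..0} (\<lambda>s. A s *v D s)" by (rule eq) (use t in auto)
    then show "D 0 = 0" by simp
  qed (use t in auto)
qed

lemmas has_vector_derivative_matrix_mult =
  bounded_bilinear.has_vector_derivative[OF bounded_bilinear_matrix_mult]
lemmas has_vector_derivative_matrix_vector_mult =
  bounded_bilinear.has_vector_derivative[OF bounded_bilinear_matrix_vector_mult]

locale linear_bridge =
  fixes Q :: "real \<Rightarrow> real^'d^'d" and \<Sigma> :: "real \<Rightarrow> real^'p^'d" and r :: "real \<Rightarrow> real^'d"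
    and E :: "real \<Rightarrow> real \<Rightarrow> real^'d^'d" and T :: real
  assumes Q: "continuous_on {0..} Q" and \<Sigma>: "continuous_on {0..} \<Sigma>" and r: "continuous_on {0..} r"
    and E: "evolution_matrices Q E"
    and pd: "\<And>s t. 0 \<le> s \<Longrightarrow> s < t \<Longrightarrow> positive_definite (kappa E \<Sigma> s t)"
    and T: "0 < T"
begin

definition \<Phi> :: "real \<Rightarrow> real^'d^'d" where "\<Phi> t = E t 0"
definition \<Psi> :: "real \<Rightarrow> real^'d^'d" where "\<Psi> t = E 0 t"
definition V :: "real \<Rightarrow> real^'d^'d" where
  "V u = \<Psi> u ** \<Sigma> u ** transpose (\<Sigma> u) ** transpose (\<Psi> u)"
definition P :: "real \<Rightarrow> real^'d^'d" where "P t = integral {0..t} V"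
definition R :: "real \<Rightarrow> real^'d^'d" where "R t = P T - P t"
definition q :: "real \<Rightarrow> real^'d" where "q t = integral {0..t} (\<lambda>u. \<Psi> u *v r u)"

section \<open>The evolution matrices, and \<Gamma> in terms of the fundamental matrix\<close>

lemma E_self: "0 \<le> s \<Longrightarrow> E s s = mat 1"
  using E unfolding evolution_matrices_def by blast

lemma E_deriv:
  "0 \<le> s \<Longrightarrow> 0 \<le> t \<Longrightarrow> ((\<lambda>t. E t s) has_vector_derivative Q t ** E t s) (at t within {0..})"
  using E unfolding evolution_matrices_def by blast

text \<open>As functions of \<open>t\<close> both sides solve X' = Q X and agree at
  \<open>s\<close>. Since \<open>t\<close> may precede \<open>s\<close>, uniqueness is used in both
  directions of time, on the interval up to \<open>max s t\<close>.\<close>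

lemma E_chain:
  assumes "0 \<le> s" "0 \<le> t"
  shows "E t s ** \<Phi> s = \<Phi> t"
proof -
  define b where "b = max s t"
  define X where "X = (\<lambda>t. E t s ** \<Phi> s - \<Phi> t)"
  have "bounded (Q ` {0..b})"
    by (intro compact_imp_bounded compact_continuous_image continuous_on_subset[OF Q]) auto
  then obtain C where C: "\<And>s. s \<in> {0..b} \<Longrightarrow> norm (Q s) \<le> C"
    unfolding bounded_iff by blast
  obtain c where c: "c > 0" "\<And>(A::real^'d^'d) (B::real^'d^'d). norm (A ** B) \<le> norm A * norm B * c"
    using bounded_bilinear.pos_bounded[OF bounded_bilinear_matrix_mult] by blast
  have "X t = 0"
  proof (rule ode_zero[where s=s and a=0 and b=b and X'="\<lambda>u. Q u ** X u" and C="C * c"])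
    fix u assume u: "u \<in> {0..b}"
    have "((\<lambda>u. E u s ** \<Phi> s) has_vector_derivative (Q u ** E u s) ** \<Phi> s) (at u within {0..b})"
      using u by (intro bounded_linear.has_vector_derivative[OF
            bounded_bilinear.bounded_linear_left[OF bounded_bilinear_matrix_mult]]
          has_vector_derivative_within_subset[OF E_deriv[OF assms(1)]]) auto
    moreover have "(\<Phi> has_vector_derivative Q u ** \<Phi> u) (at u within {0..b})"
      unfolding \<Phi>_def[abs_def] using u by (intro has_vector_derivative_within_subset[OF E_deriv]) auto
    ultimately have "(X has_vector_derivative (Q u ** E u s) ** \<Phi> s - Q u ** \<Phi> u) (at u within {0..b})"
      unfolding X_def by (rule has_vector_derivative_diff)
    also have "(Q u ** E u s) ** \<Phi> s - Q u ** \<Phi> u = Q u ** X u"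
      unfolding X_def by (simp add: bounded_bilinear.diff_right[OF bounded_bilinear_matrix_mult] matrix_mul_assoc)
    finally show "(X has_vector_derivative Q u ** X u) (at u within {0..b})" .
    have "norm (Q u) * norm (X u) * c \<le> C * norm (X u) * c"
      using C[OF u] c(1) by (intro mult_right_mono) auto
    then show "norm (Q u ** X u) \<le> C * c * norm (X u)"
      using c(2)[of "Q u" "X u"] by (simp add: mult_ac)
  qed (use assms in \<open>auto simp: X_def E_self b_def\<close>)
  then show ?thesis by (simp add: X_def)
qed

lemma \<Psi>\<Phi>: "0 \<le> t \<Longrightarrow> \<Psi> t ** \<Phi> t = mat 1"
  using E_chain[of t 0] by (simp add: \<Psi>_def \<Phi>_def E_self)

lemma \<Phi>\<Psi>: "0 \<le> t \<Longrightarrow> \<Phi> t ** \<Psi> t = mat 1"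
  using \<Psi>\<Phi> by (simp add: matrix_left_right_inverse)

text \<open>Stated for left-associated products, the normal form produced by
  \<open>matrix_mul_assoc\<close>, so that simplification collapses long chains.\<close>

lemma cancel:
  fixes X :: "real^'d^'k"
  assumes "0 \<le> t"
  shows "X ** \<Psi> t ** \<Phi> t = X" "X ** \<Phi> t ** \<Psi> t = X"
    "X ** transpose (\<Phi> t) ** transpose (\<Psi> t) = X" "X ** transpose (\<Psi> t) ** transpose (\<Phi> t) = X"
  using \<Psi>\<Phi>[OF assms] \<Phi>\<Psi>[OF assms]
  by (simp_all add: matrix_mul_assoc[symmetric] flip: matrix_transpose_mul)

lemma cancel_vec: "0 \<le> t \<Longrightarrow> \<Psi> t *v (\<Phi> t *v x) = x" "0 \<le> t \<Longrightarrow> \<Phi> t *v (\<Psi> t *v x) = x"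
  by (simp_all add: matrix_vector_mul_assoc \<Psi>\<Phi> \<Phi>\<Psi>)

lemma E_eq: "0 \<le> s \<Longrightarrow> 0 \<le> t \<Longrightarrow> E t s = \<Phi> t ** \<Psi> s"
  by (metis E_chain cancel(2))

lemma \<Phi>_deriv: "0 \<le> t \<Longrightarrow> (\<Phi> has_vector_derivative Q t ** \<Phi> t) (at t within {0..})"
  unfolding \<Phi>_def[abs_def] by (rule E_deriv) auto

lemma \<Phi>_continuous: "continuous_on {0..} \<Phi>"
  using \<Phi>_deriv by (metis atLeast_iff continuous_on_eq_continuous_within has_vector_derivative_continuous)

text \<open>The differential equation governs the first argument of \<open>E\<close>, whereas
  \<open>\<Psi>\<close> varies the second; continuity therefore comes from that of the inverse of
  \<open>\<Phi>\<close>.\<close>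

lemma \<Psi>_continuous: "continuous_on {0..} \<Psi>"
proof -
  have "continuous_on {0..} (\<lambda>t. matrix_inv (\<Phi> t))"
    by (rule continuous_on_matrix_inv[OF \<Phi>_continuous]) (use \<Phi>\<Psi> \<Psi>\<Phi> in \<open>auto simp: invertible_def\<close>)
  then show ?thesis
    by (rule continuous_on_eq) (use \<Phi>\<Psi> in \<open>auto intro: matrix_inv_eq\<close>)
qed

lemma V_continuous: "continuous_on {0..} V"
  unfolding V_def[abs_def] by (intro continuous_intros \<Psi>_continuous \<Sigma>)

lemma V_integrable: "0 \<le> s \<Longrightarrow> V integrable_on {s..t}"
  by (intro integrable_continuous_real continuous_on_subset[OF V_continuous]) auto

lemma P_deriv:
  assumes "t \<in> {0..<T}"
  shows "(P has_vector_derivative V t) (at t within {0..<T})"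
proof -
  have "((\<lambda>t. integral {0..t} V) has_vector_derivative V t) (at t within {0..T})"
    by (rule integral_has_vector_derivative[OF continuous_on_subset[OF V_continuous]]) (use assms in auto)
  then show ?thesis
    unfolding P_def[abs_def] by (rule has_vector_derivative_within_subset) auto
qed

lemma q_deriv:
  assumes "t \<in> {0..<T}"
  shows "(q has_vector_derivative \<Psi> t *v r t) (at t within {0..<T})"
proof -
  have "continuous_on {0..T} (\<lambda>u. \<Psi> u *v r u)"
    by (rule continuous_on_subset[of "{0..}"]) (auto intro!: continuous_intros \<Psi>_continuous r)
  then have "((\<lambda>t. integral {0..t} (\<lambda>u. \<Psi> u *v r u)) has_vector_derivative \<Psi> t *v r t) (at t within {0..T})"
    by (rule integral_has_vector_derivative) (use assms in auto)
  then show ?thesis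
    unfolding q_def[abs_def] by (rule has_vector_derivative_within_subset) auto
qed

lemma P_sym: "transpose (P t) = P t"
proof (cases "0 \<le> t")
  case True
  have "transpose (V u) = V u" for u
    by (simp add: V_def matrix_transpose_mul matrix_mul_assoc)
  then have "(transpose \<circ> V) = V" by auto
  then show ?thesis
    using integral_linear[OF V_integrable[of 0 t] bounded_linear_transpose] True by (simp add: P_def)
next
  case False
  then show ?thesis by (simp add: P_def transpose_def vec_eq_iff)
qed

lemma R_sym: "transpose (R t) = R t"
  using linear_diff[OF bounded_linear.linear[OF bounded_linear_transpose], of "P T" "P t"] by (simp add: R_def P_sym)

text \<open>\<open>E t u\<close> factors into \<open>\<Phi> t\<close> and \<open>\<Psi> u\<close>,
  and the factors that are constant in \<open>u\<close> leave the integral. What remains is an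
  increment of \<open>P\<close>.\<close>

lemma kappa_eq:
  assumes "0 \<le> s" "s \<le> t"
  shows "kappa E \<Sigma> s t = \<Phi> t ** (P t - P s) ** transpose (\<Phi> t)"
proof -
  have "bounded_linear (\<lambda>X. \<Phi> t ** X ** transpose (\<Phi> t))"
    using bounded_linear_compose[OF bounded_bilinear.bounded_linear_left[OF bounded_bilinear_matrix_mult, of "transpose (\<Phi> t)"]
        bounded_bilinear.bounded_linear_right[OF bounded_bilinear_matrix_mult, of "\<Phi> t"]] by simp
  from integral_linear[OF V_integrable[OF assms(1)] this]
  have "integral {s..t} (\<lambda>u. \<Phi> t ** V u ** transpose (\<Phi> t)) = \<Phi> t ** integral {s..t} V ** transpose (\<Phi> t)"
    by (simp add: o_def)
  moreover have "integral {s..t} V = P t - P s"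
    unfolding P_def using Henstock_Kurzweil_Integration.integral_combine[OF assms V_integrable] by (simp add: algebra_simps)
  moreover have "kappa E \<Sigma> s t = integral {s..t} (\<lambda>u. \<Phi> t ** V u ** transpose (\<Phi> t))"
    unfolding kappa_def
  proof (rule integral_cong)
    fix u assume "u \<in> {s..t}"
    then have "E t u = \<Phi> t ** \<Psi> u" using assms by (intro E_eq) auto
    then show "E t u ** \<Sigma> u ** transpose (\<Sigma> u) ** transpose (E t u) = \<Phi> t ** V u ** transpose (\<Phi> t)"
      by (simp add: V_def matrix_transpose_mul matrix_mul_assoc)
  qed
  ultimately show ?thesis by simp
qed

lemma Gam_eq:
  assumes "0 \<le> s" "s \<le> t"
  shows "Gam E \<Sigma> s t = \<Phi> s ** (P t - P s) ** transpose (\<Phi> t)"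
  using assms by (simp add: Gam_def kappa_eq E_eq matrix_mul_assoc cancel)

text \<open>The positive definite matrix \<open>kappa E \<Sigma> t T\<close> is \<open>R t\<close>
  transformed by the invertible \<open>\<Phi> T\<close>, so \<open>R t\<close> has trivial
  kernel.\<close>

lemma R_invertible:
  assumes "t \<in> {0..<T}"
  shows "R t ** matrix_inv (R t) = mat 1" "matrix_inv (R t) ** R t = mat 1"
proof -
  have pos: "positive_definite (\<Phi> T ** R t ** transpose (\<Phi> T))"
    using pd[of t T] kappa_eq[of t T] assms by (simp add: R_def)
  have "x = 0" if "R t *v x = 0" for x
  proof -
    define y where "y = transpose (\<Psi> T) *v x"
    have x: "transpose (\<Phi> T) *v y = x"
      using cancel(3)[of T "mat 1"] T unfolding y_def matrix_vector_mul_assoc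
      by (simp only: matrix_mul_lid matrix_vector_mul_lid less_imp_le)
    then have "(\<Phi> T ** R t ** transpose (\<Phi> T)) *v y = 0"
      by (simp add: that flip: matrix_vector_mul_assoc)
    then have "y = 0" using pos unfolding positive_definite_def by (metis inner_zero_right less_irrefl)
    then show ?thesis using x by simp
  qed
  then obtain B where "B ** R t = mat 1" using matrix_left_invertible_ker[of "R t"] by blast
  then have "R t ** B = mat 1" by (simp add: matrix_left_right_inverse)
  with \<open>B ** R t = mat 1\<close> matrix_inv_eq[OF this]
  show "R t ** matrix_inv (R t) = mat 1" "matrix_inv (R t) ** R t = mat 1" by auto
qed

lemma R_cancel:
  fixes X :: "real^'d^'k"
  assumes "t \<in> {0..<T}"
  shows "X ** R t ** matrix_inv (R t) = X" "X ** matrix_inv (R t) ** R t = X"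
  using R_invertible[OF assms] by (simp_all add: matrix_mul_assoc[symmetric])

lemma P_continuous: "continuous_on {0..<T} P"
  using P_deriv by (meson continuous_on_eq_continuous_within has_vector_derivative_continuous)

lemma q_continuous: "continuous_on {0..<T} q"
  using q_deriv by (meson continuous_on_eq_continuous_within has_vector_derivative_continuous)

text \<open>\<open>R T\<close> is zero, so the half-open interval is the natural domain; the
  integrand of the bridge inherits this restriction.\<close>

lemma Ri_continuous: "continuous_on {0..<T} (\<lambda>t. matrix_inv (R t))"
  by (rule continuous_on_matrix_inv)
    (use R_invertible in \<open>auto simp: R_def[abs_def] invertible_def intro!: continuous_intros P_continuous\<close>)

lemma Gam_inv:
  assumes "t \<in> {0..<T}"
  shows "matrix_inv (Gam E \<Sigma> t T) = transpose (\<Psi> T) ** matrix_inv (R t) ** \<Psi> t"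
    and "matrix_inv (transpose (Gam E \<Sigma> t T)) = transpose (\<Psi> t) ** matrix_inv (R t) ** \<Psi> T"
proof -
  have Gam: "Gam E \<Sigma> t T = \<Phi> t ** R t ** transpose (\<Phi> T)"
    using assms by (simp add: Gam_eq R_def)
  show "matrix_inv (Gam E \<Sigma> t T) = transpose (\<Psi> T) ** matrix_inv (R t) ** \<Psi> t"
    using assms T by (intro matrix_inv_eq) (simp add: Gam matrix_mul_assoc cancel R_cancel \<Phi>\<Psi>)
  show "matrix_inv (transpose (Gam E \<Sigma> t T)) = transpose (\<Psi> t) ** matrix_inv (R t) ** \<Psi> T"
    using assms T by (intro matrix_inv_eq)
      (simp add: Gam matrix_transpose_mul R_sym matrix_mul_assoc cancel R_cancel \<Phi>\<Psi>)
qed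

section \<open>The drift coefficients and the equations for \<Gamma>(t,T) and n(0,t)\<close>

definition A :: "real \<Rightarrow> real^'d^'d" where
  "A t = Q t - \<Sigma> t ** transpose (\<Sigma> t) ** transpose (\<Psi> t) ** matrix_inv (R t) ** \<Psi> t"

definition c :: "real^'d \<Rightarrow> real \<Rightarrow> real^'d" where
  "c b t = (\<Sigma> t ** transpose (\<Sigma> t) ** transpose (\<Psi> t) ** matrix_inv (R t)) *v
     (\<Psi> T *v b - q T + q t) + r t"

lemma A_continuous: "continuous_on {0..<T} A"
  unfolding A_def[abs_def]
  by (intro continuous_intros Ri_continuous continuous_on_subset[OF Q] continuous_on_subset[OF \<Sigma>]
      continuous_on_subset[OF \<Psi>_continuous]) auto

lemma c_continuous: "continuous_on {0..<T} (c b)"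
  unfolding c_def[abs_def]
  by (intro continuous_intros Ri_continuous q_continuous continuous_on_subset[OF r] continuous_on_subset[OF \<Sigma>]
      continuous_on_subset[OF \<Psi>_continuous]) auto

lemma m_minus_eq:
  assumes "t \<in> {0..<T}"
  shows "\<Psi> T *v m_minus E r b t T = \<Psi> T *v b - q T + q t"
proof -
  have "continuous_on {0..} (\<lambda>u. \<Psi> u *v r u)" by (intro continuous_intros \<Psi>_continuous r)
  then have int: "(\<lambda>u. \<Psi> u *v r u) integrable_on {s..T}" if "0 \<le> s" for s
    using that by (intro integrable_continuous_real) (auto elim: continuous_on_subset)
  have "integral {t..T} (\<lambda>u. E T u *v r u) = integral {t..T} ((*v) (\<Phi> T) \<circ> (\<lambda>u. \<Psi> u *v r u))"
    using assms by (intro integral_cong) (simp add: E_eq matrix_vector_mul_assoc)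
  also have "\<dots> = \<Phi> T *v integral {t..T} (\<lambda>u. \<Psi> u *v r u)"
    using assms by (intro integral_linear int bounded_bilinear.bounded_linear_right[OF bounded_bilinear_matrix_vector_mult]) auto
  also have "integral {t..T} (\<lambda>u. \<Psi> u *v r u) = q T - q t"
    unfolding q_def using Henstock_Kurzweil_Integration.integral_combine[of 0 t T, OF _ _ int] assms
    by (simp add: algebra_simps)
  finally show ?thesis
    using T by (simp add: m_minus_def matrix_vector_mult_diff_distrib cancel_vec)
qed

lemma bridge_drift_eq:
  assumes "t \<in> {0..<T}"
  shows "bridge_drift Q E \<Sigma> r T b t x = A t *v x + c b t"
proof -
  have "E T t = \<Phi> T ** \<Psi> t" using assms by (intro E_eq) auto
  then have "Q t - \<Sigma> t ** transpose (\<Sigma> t) ** transpose (E T t) ** matrix_inv (Gam E \<Sigma> t T) = A t"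
    using assms T by (simp add: Gam_inv A_def matrix_transpose_mul matrix_mul_assoc cancel)
  moreover have "(\<Sigma> t ** transpose (\<Sigma> t) ** matrix_inv (transpose (Gam E \<Sigma> t T))) *v m_minus E r b t T + r t = c b t"
    using assms by (simp add: Gam_inv c_def m_minus_eq[symmetric] matrix_vector_mul_assoc matrix_mul_assoc)
  ultimately show ?thesis by (simp add: bridge_drift_def add.assoc)
qed

text \<open>Differentiating \<open>\<Phi>\<close> contributes the term with \<open>Q\<close>.
  Differentiating \<open>R\<close> contributes minus
  \<open>\<Phi> t ** V t ** transpose (\<Phi> T)\<close>, and \<Phi> V = \<Sigma> \<Sigma>' \<Psi>'
  (primes for transposes) identifies it with the remaining term of \<open>A\<close> applied to
  \<Gamma>.\<close>

lemma Gam_deriv: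
  assumes t: "t \<in> {0..<T}"
  shows "((\<lambda>t. Gam E \<Sigma> t T) has_vector_derivative A t ** Gam E \<Sigma> t T) (at t within {0..<T})"
proof -
  have "(\<Phi> has_vector_derivative Q t ** \<Phi> t) (at t within {0..<T})"
    using t by (intro has_vector_derivative_within_subset[OF \<Phi>_deriv]) auto
  moreover have "(R has_vector_derivative 0 - V t) (at t within {0..<T})"
    unfolding R_def[abs_def] using t by (intro has_vector_derivative_diff has_vector_derivative_const P_deriv)
  ultimately have "((\<lambda>t. \<Phi> t ** R t) has_vector_derivative \<Phi> t ** (0 - V t) + (Q t ** \<Phi> t) ** R t) (at t within {0..<T})"
    by (rule has_vector_derivative_matrix_mult)
  then have "((\<lambda>t. \<Phi> t ** R t ** transpose (\<Phi> T)) has_vector_derivative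
      (\<Phi> t ** (0 - V t) + (Q t ** \<Phi> t) ** R t) ** transpose (\<Phi> T)) (at t within {0..<T})"
    by (rule bounded_linear.has_vector_derivative[OF
          bounded_bilinear.bounded_linear_left[OF bounded_bilinear_matrix_mult]])
  also have "(\<Phi> t ** (0 - V t) + (Q t ** \<Phi> t) ** R t) ** transpose (\<Phi> T) =
      A t ** (\<Phi> t ** R t ** transpose (\<Phi> T))"
  proof -
    note bb = bounded_bilinear_matrix_mult
    have "\<Phi> t ** V t = \<Sigma> t ** transpose (\<Sigma> t) ** transpose (\<Psi> t)"
      using t by (simp add: V_def matrix_mul_assoc \<Phi>\<Psi>)
    then show ?thesis using t
      by (simp add: A_def bounded_bilinear.diff_left[OF bb] bounded_bilinear.diff_right[OF bb]
          bounded_bilinear.zero_right[OF bb] bounded_bilinear.add_left[OF bb]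
          bounded_bilinear.minus_right[OF bb] bounded_bilinear.minus_left[OF bb]
          matrix_mul_assoc cancel R_cancel)
  qed
  finally have "((\<lambda>t. \<Phi> t ** R t ** transpose (\<Phi> T)) has_vector_derivative
      A t ** Gam E \<Sigma> t T) (at t within {0..<T})"
    using t by (simp add: Gam_eq R_def)
  then show ?thesis
    by (rule has_vector_derivative_transform[OF t, rotated]) (auto simp: Gam_eq R_def)
qed

lemma Gam_continuous: "continuous_on {0..<T} (\<lambda>t. Gam E \<Sigma> t T)"
  using Gam_deriv by (metis continuous_on_eq_continuous_within has_vector_derivative_continuous)

lemma integrand_continuous: "continuous_on {0..<T} (\<lambda>u. matrix_inv (Gam E \<Sigma> u T) ** \<Sigma> u)"
proof -
  have "continuous_on {0..<T} (\<lambda>u. transpose (\<Psi> T) ** matrix_inv (R u) ** \<Psi> u ** \<Sigma> u)"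
    by (intro continuous_intros Ri_continuous continuous_on_subset[OF \<Sigma>] continuous_on_subset[OF \<Psi>_continuous]) auto
  then show ?thesis by (rule continuous_on_eq) (simp add: Gam_inv)
qed

text \<open>The identity K G = \<Sigma>, by which the product rule recovers the noise term of the
  equation.\<close>

lemma Gam_integrand:
  "u \<in> {0..<T} \<Longrightarrow> Gam E \<Sigma> u T ** (matrix_inv (Gam E \<Sigma> u T) ** \<Sigma> u) = \<Sigma> u"
  using T by (simp only: Gam_inv) (simp add: Gam_eq R_def[symmetric] matrix_mul_assoc cancel R_cancel \<Phi>\<Psi>)

text \<open>Substituting \<open>R t = R 0 - P t\<close> in the first summand makes the terms with
  \<open>q t\<close> under \<open>P t\<close> cancel, and a vector independent of \<open>t\<close>
  is left.\<close>

lemma n_bridge_eq: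
  assumes t: "t \<in> {0..<T}"
  shows "n_bridge E \<Sigma> r T a b 0 t =
    \<Phi> t *v (a + P t *v (matrix_inv (R 0) *v (\<Psi> T *v b - q T - a)) + q t)"
proof -
  have z: "(0::real) \<in> {0..<T}" using T by simp
  have 0: "\<Phi> 0 = mat 1" "\<Psi> 0 = mat 1" "P 0 = 0" by (auto simp: \<Phi>_def \<Psi>_def E_self P_def)
  have Gt: "Gam E \<Sigma> t T = \<Phi> t ** R t ** transpose (\<Phi> T)"
    using t by (simp add: Gam_eq R_def)
  have G0: "transpose (Gam E \<Sigma> 0 t) = \<Phi> t ** P t"
    using t by (simp add: Gam_eq 0 matrix_transpose_mul P_sym)
  have mp: "m_plus E r a 0 t = a + q t"
    by (simp add: m_plus_def q_def \<Psi>_def)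
  have "(Gam E \<Sigma> t T ** matrix_inv (Gam E \<Sigma> 0 T)) *v m_plus E r a 0 t =
      \<Phi> t *v (R t *v (matrix_inv (R 0) *v (a + q t)))"
    using T by (simp add: Gam_inv[OF z] Gt mp 0 matrix_vector_mul_assoc matrix_mul_assoc cancel)
  moreover have "(transpose (Gam E \<Sigma> 0 t) ** matrix_inv (transpose (Gam E \<Sigma> 0 T))) *v m_minus E r b t T =
      \<Phi> t *v (P t *v (matrix_inv (R 0) *v (\<Psi> T *v b - q T + q t)))"
    using m_minus_eq[OF t, of b, symmetric]
    by (simp add: Gam_inv[OF z] G0 0 matrix_vector_mul_assoc matrix_mul_assoc)
  moreover have "R t *v (matrix_inv (R 0) *v x) = x - P t *v (matrix_inv (R 0) *v x)" for x
  proof -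
    have "R t = R 0 - P t" by (simp add: R_def 0)
    moreover have "R 0 *v (matrix_inv (R 0) *v x) = x"
      using R_invertible(1)[OF z] by (simp add: matrix_vector_mul_assoc)
    ultimately show ?thesis by (simp only: matrix_vector_mult_diff_rdistrib)
  qed
  ultimately show ?thesis
    by (simp add: n_bridge_def matrix_vector_right_distrib matrix_vector_mult_diff_distrib algebra_simps)
qed

lemma n_bridge_0: "n_bridge E \<Sigma> r T a b 0 0 = a"
  using n_bridge_eq[of 0] T by (simp add: P_def q_def \<Phi>_def E_self)

lemma n_bridge_deriv:
  assumes t: "t \<in> {0..<T}"
  shows "(n_bridge E \<Sigma> r T a b 0 has_vector_derivative A t *v n_bridge E \<Sigma> r T a b 0 t + c b t)
    (at t within {0..<T})"
proof -
  define v where "v = matrix_inv (R 0) *v (\<Psi> T *v b - q T - a)"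
  let ?z = "\<lambda>t. a + P t *v v + q t"
  have z: "(0::real) \<in> {0..<T}" using T by simp
  have "(\<Phi> has_vector_derivative Q t ** \<Phi> t) (at t within {0..<T})"
    using t by (intro has_vector_derivative_within_subset[OF \<Phi>_deriv]) auto
  moreover have "((\<lambda>t. P t *v v) has_vector_derivative P t *v 0 + V t *v v) (at t within {0..<T})"
    by (intro has_vector_derivative_matrix_vector_mult P_deriv t has_vector_derivative_const)
  then have "(?z has_vector_derivative 0 + (P t *v 0 + V t *v v) + \<Psi> t *v r t) (at t within {0..<T})"
    by (intro has_vector_derivative_add has_vector_derivative_const q_deriv t)
  ultimately have "((\<lambda>t. \<Phi> t *v ?z t) has_vector_derivative
      \<Phi> t *v (0 + (P t *v 0 + V t *v v) + \<Psi> t *v r t) + (Q t ** \<Phi> t) *v ?z t) (at t within {0..<T})"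
    by (rule has_vector_derivative_matrix_vector_mult)
  also have "\<Phi> t *v (0 + (P t *v 0 + V t *v v) + \<Psi> t *v r t) + (Q t ** \<Phi> t) *v ?z t =
      A t *v (\<Phi> t *v ?z t) + c b t"
  proof -
    let ?S = "\<Sigma> t ** transpose (\<Sigma> t) ** transpose (\<Psi> t)"
    have "R 0 *v v = \<Psi> T *v b - q T - a"
      using R_invertible(1)[OF z] by (simp add: v_def matrix_vector_mul_assoc)
    moreover have "R 0 *v v = R t *v v + P t *v v"
      by (simp add: R_def P_def matrix_vector_mult_diff_rdistrib)
    \<comment> \<open>The splitting \<open>R 0 = R t + P t\<close> decomposes the vector inside
      \<open>c b t\<close>. The part \<open>R t *v v\<close> cancels the inverse of
      \<open>R t\<close> and yields \<Phi> V v; the part \<open>?z t\<close> cancels against the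
      second term of \<open>A\<close>.\<close>
    ultimately have "\<Psi> T *v b - q T + q t = R t *v v + ?z t" by (simp add: algebra_simps)
    moreover have "matrix_inv (R t) *v (R t *v v) = v"
      using R_invertible(2)[OF t] by (simp add: matrix_vector_mul_assoc)
    ultimately have "c b t = ?S *v v + ?S *v (matrix_inv (R t) *v ?z t) + r t"
      by (simp add: c_def matrix_vector_right_distrib flip: matrix_vector_mul_assoc)
    moreover have "A t *v (\<Phi> t *v ?z t) = Q t *v (\<Phi> t *v ?z t) - ?S *v (matrix_inv (R t) *v ?z t)"
      using t cancel_vec(1)[of t "?z t"]
      by (simp add: A_def matrix_vector_mult_diff_rdistrib flip: matrix_vector_mul_assoc)
    moreover have "\<Phi> t *v (V t *v v) = ?S *v v"
      using t by (simp add: V_def matrix_vector_mul_assoc matrix_mul_assoc \<Phi>\<Psi>)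
    moreover have "\<Phi> t *v (\<Psi> t *v r t) = r t" using t by (intro cancel_vec) simp
    ultimately show ?thesis
      by (simp add: matrix_vector_right_distrib flip: matrix_vector_mul_assoc)
  qed
  finally have "((\<lambda>t. \<Phi> t *v ?z t) has_vector_derivative A t *v n_bridge E \<Sigma> r T a b 0 t + c b t)
      (at t within {0..<T})"
    unfolding n_bridge_eq[OF t] v_def .
  then show ?thesis
    by (rule has_vector_derivative_transform[OF t, rotated]) (simp add: n_bridge_eq v_def)
qed

end

section \<open>Solutions of the bridge equation\<close>

lemma wiener_setup_imp_wiener:
  "wiener_setup M \<xi> W \<Longrightarrow> wiener M (augmented_filtration M \<xi> W) W"
  unfolding wiener_setup_def usual_conditions_def wiener_def wiener_axioms_def by blast

text \<open>For the product \<Gamma>(s,T) (\<Gamma>(s,T)^(-1) \<Sigma>(s)) equality with \<Sigma>(s)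
  is known before \<open>T\<close>, and the time window of every level ends before
  \<open>T\<close>.\<close>

lemma fine_levels_cong:
  assumes "0 < T" "\<And>s. s \<in> {0..<T} \<Longrightarrow> G s = H s" "fine_levels T G m"
  shows "fine_levels T H m"
  unfolding fine_levels_def
proof (intro allI impI)
  fix n s u assume *: "0 \<le> s" "s \<le> u" "u \<le> T * (1 - (1/2)^n)" "u - s \<le> T / 2 ^ m n"
  have "T * (1 - (1/2)^n) < T" using \<open>0 < T\<close> by (simp add: algebra_simps)
  then have "s \<in> {0..<T}" "u \<in> {0..<T}" using * by auto
  then show "norm (H u - H s) \<le> (1/4)^n"
    using fine_levelsD[OF assms(3) *] assms(2) by simp
qed

text \<open>Step integrals evaluate the integrand at left ends of cells only, and these lie strictly
  before \<open>T\<close>.\<close>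

lemma dyadic_limit_cong:
  assumes "0 < T" "\<And>s. s \<in> {0..<T} \<Longrightarrow> G s = H s"
  shows "dyadic_limit W T G m = dyadic_limit W T H m"
proof -
  have "G (dyadic T k i) = H (dyadic T k i)" if "i < 2 ^ k" for k i
  proof (rule assms(2))
    have "real i < 2 ^ k" using that by (metis of_nat_less_iff of_nat_numeral of_nat_power)
    then have "T * real i / 2 ^ k < T" using \<open>0 < T\<close> by (simp add: pos_divide_less_eq)
    then show "dyadic T k i \<in> {0..<T}" using \<open>0 < T\<close> by (simp add: dyadic_def)
  qed
  then show ?thesis
    by (simp add: dyadic_limit_def[abs_def] dyadic_integral_def step_integral_def)
qed

lemma AE_eq_ito_integrals:
  fixes G :: "real \<Rightarrow> real^'p^'d"
  assumes W: "wiener_setup M \<xi> W" and "0 < T" "continuous_on {0..<T} G"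
    and "has_ito_integral M (augmented_filtration M \<xi> W) W T (\<lambda>s _. G s) I"
    and "has_ito_integral M (augmented_filtration M \<xi> W) W T (\<lambda>s _. G s) J"
  shows "AE \<omega> in M. \<forall>t\<in>{0..<T}. I t \<omega> = J t \<omega>"
proof -
  interpret wiener M "augmented_filtration M \<xi> W" W by (rule wiener_setup_imp_wiener[OF W])
  obtain m where "fine_levels T G m" using fine_levels_exist assms by metis
  then have "AE \<omega> in M. \<forall>t\<in>{0..<T}. I t \<omega> = dyadic_limit W T G m t \<omega>"
      "AE \<omega> in M. \<forall>t\<in>{0..<T}. J t \<omega> = dyadic_limit W T G m t \<omega>"
    using assms by (auto intro: has_ito_integral_eq_dyadic_limit_path)
  then show ?thesis by eventually_elim simp
qed

text \<open>The noise coefficient does not depend on the state, so both solutions carry an integral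
  of the same deterministic function. These integrals and the terms \<open>c\<close> cancel in the
  difference, which satisfies a homogeneous linear equation on almost every path.\<close>

lemma linear_strong_uniqueness:
  fixes A :: "real \<Rightarrow> real^'d^'d" and \<Sigma> :: "real \<Rightarrow> real^'p^'d"
  assumes T: "0 < T" and A: "continuous_on {0..<T} A" and \<Sigma>: "continuous_on {0..<T} \<Sigma>"
    and drift: "\<And>t x. t \<in> {0..<T} \<Longrightarrow> drift t x = A t *v x + c t"
  shows "strong_uniqueness TYPE('v) T drift (\<lambda>t _. \<Sigma> t)"
  unfolding strong_uniqueness_def
proof (intro allI impI, elim conjE)
  fix M :: "'v measure" and W :: "real \<Rightarrow> 'v \<Rightarrow> real^'p" and \<xi> X Y
  assume W: "wiener_setup M \<xi> W"
    and X: "strong_solution M W T drift (\<lambda>t _. \<Sigma> t) \<xi> X"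
    and Y: "strong_solution M W T drift (\<lambda>t _. \<Sigma> t) \<xi> Y"
  obtain I where I: "has_ito_integral M (augmented_filtration M \<xi> W) W T (\<lambda>s _. \<Sigma> s) I"
    and XI: "AE \<omega> in M. \<forall>t\<in>{0..<T}. X t \<omega> = X 0 \<omega> + (LINT s:{0..t}|lborel. drift s (X s \<omega>)) + I t \<omega>"
    using X unfolding strong_solution_def by blast
  obtain J where J: "has_ito_integral M (augmented_filtration M \<xi> W) W T (\<lambda>s _. \<Sigma> s) J"
    and YJ: "AE \<omega> in M. \<forall>t\<in>{0..<T}. Y t \<omega> = Y 0 \<omega> + (LINT s:{0..t}|lborel. drift s (Y s \<omega>)) + J t \<omega>"
    using Y unfolding strong_solution_def by blast
  have "AE \<omega> in M. continuous_on {0..<T} (\<lambda>t. X t \<omega>)" "AE \<omega> in M. continuous_on {0..<T} (\<lambda>t. Y t \<omega>)"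
    "AE \<omega> in M. X 0 \<omega> = \<xi> \<omega>" "AE \<omega> in M. Y 0 \<omega> = \<xi> \<omega>"
    "AE \<omega> in M. \<forall>t\<in>{0..<T}. set_integrable lborel {0..t} (\<lambda>s. drift s (X s \<omega>))"
    "AE \<omega> in M. \<forall>t\<in>{0..<T}. set_integrable lborel {0..t} (\<lambda>s. drift s (Y s \<omega>))"
    using X Y unfolding strong_solution_def by auto
  with XI YJ AE_eq_ito_integrals[OF W T \<Sigma> I J]
  show "AE \<omega> in M. \<forall>t\<in>{0..<T}. X t \<omega> = Y t \<omega>"
  proof eventually_elim
    case (elim \<omega>)
    define D where "D = (\<lambda>t. X t \<omega> - Y t \<omega>)"
    have "D t = integral {0..t} (\<lambda>s. A s *v D s)" if t: "t \<in> {0..<T}" for t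
    proof -
      \<comment> \<open>Solutions are defined by Lebesgue integrals,
        \<open>integral_equation_zero\<close> by Henstock-Kurzweil ones; for set-integrable
        functions the two agree.\<close>
      note iX = set_borel_integral_eq_integral[OF elim(8)[rule_format, OF t]]
        and iY = set_borel_integral_eq_integral[OF elim(9)[rule_format, OF t]]
      have "X t \<omega> = \<xi> \<omega> + integral {0..t} (\<lambda>s. drift s (X s \<omega>)) + J t \<omega>"
        using elim(1) elim(3) elim(6) iX(2) t by metis
      moreover have "Y t \<omega> = \<xi> \<omega> + integral {0..t} (\<lambda>s. drift s (Y s \<omega>)) + J t \<omega>"
        using elim(2) elim(7) iY(2) t by metis
      ultimately have "D t = integral {0..t} (\<lambda>s. drift s (X s \<omega>)) - integral {0..t} (\<lambda>s. drift s (Y s \<omega>))"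
        by (simp add: D_def)
      also have "\<dots> = integral {0..t} (\<lambda>s. drift s (X s \<omega>) - drift s (Y s \<omega>))"
        by (rule Henstock_Kurzweil_Integration.integral_diff[OF iX(1) iY(1), symmetric])
      also have "\<dots> = integral {0..t} (\<lambda>s. A s *v D s)"
        using t by (intro integral_cong) (simp add: drift D_def matrix_vector_mult_diff_distrib)
      finally show ?thesis .
    qed
    moreover have "continuous_on {0..<T} D"
      unfolding D_def by (intro continuous_intros elim)
    ultimately have "D t = 0" if "t \<in> {0..<T}" for t
      using integral_equation_zero[OF _ A] that by blast
    then show ?case by (simp add: D_def)
  qed
qed

text \<open>The integrated drift is n(0,t) - a plus the integral of A \<Gamma> I; by the product
  rule the noise term is \<Gamma> I minus that same integral. Their sum is U - a.\<close>

lemma (in linear_bridge) bridge_strong_solution: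
  fixes W :: "real \<Rightarrow> 'w \<Rightarrow> real^'p"
  assumes W: "wiener_setup M (\<lambda>_. a) W"
    and I: "has_ito_integral M (augmented_filtration M (\<lambda>_. a) W) W T (\<lambda>u _. matrix_inv (Gam E \<Sigma> u T) ** \<Sigma> u) I"
    and U: "\<And>t \<omega>. t \<in> {0..<T} \<Longrightarrow> \<omega> \<in> space M \<Longrightarrow>
      U t \<omega> = n_bridge E \<Sigma> r T a b 0 t + Gam E \<Sigma> t T *v I t \<omega>"
  shows "strong_solution M W T (bridge_drift Q E \<Sigma> r T b) (\<lambda>t _. \<Sigma> t) (\<lambda>_. a) U"
proof -
  let ?F = "augmented_filtration M (\<lambda>_. a) W"
  interpret wiener M ?F W by (rule wiener_setup_imp_wiener[OF W])
  define K where "K = (\<lambda>t. Gam E \<Sigma> t T)"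
  define G where "G = (\<lambda>u. matrix_inv (Gam E \<Sigma> u T) ** \<Sigma> u)"
  define n where "n = n_bridge E \<Sigma> r T a b 0"
  have cG: "continuous_on {0..<T} G" unfolding G_def by (rule integrand_continuous)
  have cK: "continuous_on {0..<T} K" unfolding K_def by (rule Gam_continuous)
  have cn: "continuous_on {0..<T} n"
    unfolding n_def using n_bridge_deriv
    by (metis continuous_on_eq_continuous_within has_vector_derivative_continuous)
  have KG: "K s ** G s = \<Sigma> s" if "s \<in> {0..<T}" for s
    using Gam_integrand[OF that] by (simp add: K_def G_def)
  have c\<Sigma>: "continuous_on {0..<T} \<Sigma>" by (rule continuous_on_subset[OF \<Sigma>]) auto
  obtain m where m: "fine_levels T G m" "fine_levels T \<Sigma> m" "\<And>n. n \<le> m n"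
    using common_fine_levels[OF T cG c\<Sigma>] by blast
  have fKG: "fine_levels T (\<lambda>s. K s ** G s) m"
    by (rule fine_levels_cong[OF T _ m(2)]) (simp add: KG)
  \<comment> \<open>The witness for the noise term is taken along the levels shared with
    \<open>G\<close>, so that the product rule can relate it to \<open>I\<close>.\<close>
  define J where "J = dyadic_limit W T \<Sigma> m"
  have J: "has_ito_integral M ?F W T (\<lambda>s _. \<Sigma> s) J"
    unfolding J_def by (rule has_ito_integral_dyadic_limit[OF T c\<Sigma> m(2)])
  have JKG: "J = dyadic_limit W T (\<lambda>s. K s ** G s) m"
    unfolding J_def by (rule dyadic_limit_cong[OF T]) (simp add: KG)
  have I': "has_ito_integral M ?F W T (\<lambda>s _. G s) I" using I by (simp add: G_def)
  have meas: "U t \<in> borel_measurable (?F t)" if t: "t \<in> {0..<T}" for t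
  proof -
    have [measurable]: "I t \<in> borel_measurable (?F t)"
      using I t unfolding has_ito_integral_def by blast
    have "(\<lambda>\<omega>. n t + K t *v I t \<omega>) \<in> borel_measurable (?F t)" by measurable
    moreover have "U t \<omega> = n t + K t *v I t \<omega>" if "\<omega> \<in> space (?F t)" for \<omega>
      using U[OF t] that by (simp add: n_def K_def)
    ultimately show ?thesis by (subst measurable_cong) auto
  qed
  have "AE \<omega> in M. \<forall>t\<in>{0..<T}. J t \<omega> = K t *v dyadic_limit W T G m t \<omega> -
      integral {0..t} (\<lambda>s. (A s ** K s) *v dyadic_limit W T G m s \<omega>)"
    unfolding JKG
  proof (rule dyadic_limit_product[OF T m(3) m(1) fKG])
    show "(K has_vector_derivative A s ** K s) (at s within {0..<T})" if "s \<in> {0..<T}" for s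
      unfolding K_def by (rule Gam_deriv[OF that])
    show "continuous_on {0..<T} (\<lambda>s. A s ** K s)" by (intro continuous_intros A_continuous cK)
  qed
  with has_ito_integral_eq_dyadic_limit_path[OF T cG m(1) I'] AE_dyadic_limit_continuous[OF T m(1)]
    AE_space[of M]
  have path: "AE \<omega> in M. continuous_on {0..<T} (\<lambda>t. U t \<omega>) \<and> U 0 \<omega> = a \<and>
    (\<forall>t\<in>{0..<T}. set_integrable lborel {0..t} (\<lambda>s. bridge_drift Q E \<Sigma> r T b s (U s \<omega>))) \<and>
    (\<forall>t\<in>{0..<T}. U t \<omega> = U 0 \<omega> + (LINT s:{0..t}|lborel. bridge_drift Q E \<Sigma> r T b s (U s \<omega>)) + J t \<omega>)"
  proof eventually_elim
    case (elim \<omega>)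
    define x where "x = (\<lambda>t. dyadic_limit W T G m t \<omega>)"
    have cx: "continuous_on {0..<T} x" using elim(2) by (simp add: x_def)
    have Ux: "U t \<omega> = n t + K t *v x t" if "t \<in> {0..<T}" for t
      using U[OF that elim(3)] elim(1) that by (simp add: n_def K_def x_def)
    have Jx: "J t \<omega> = K t *v x t - integral {0..t} (\<lambda>s. (A s ** K s) *v x s)" if "t \<in> {0..<T}" for t
      using elim(4) that by (simp add: x_def)
    have z: "0 \<in> {0..<T}" using T by simp
    have "x 0 = lim (\<lambda>n. 0)"
      unfolding x_def dyadic_limit_def dyadic_integral_def using T
      by (simp add: step_integral_0 dyadic_nonneg)
    then have "x 0 = 0" by simp
    then have U0: "U 0 \<omega> = a"
      using Ux[OF z] by (simp add: n_def n_bridge_0)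
    have drift: "bridge_drift Q E \<Sigma> r T b s (U s \<omega>) = (A s *v n s + c b s) + (A s ** K s) *v x s"
      if "s \<in> {0..<T}" for s
      using that by (simp add: bridge_drift_eq Ux matrix_vector_right_distrib matrix_vector_mul_assoc)
    have c1: "continuous_on {0..<T} (\<lambda>s. A s *v n s + c b s)"
      by (intro continuous_intros A_continuous cn c_continuous)
    have c2: "continuous_on {0..<T} (\<lambda>s. (A s ** K s) *v x s)"
      by (intro continuous_intros A_continuous cK cx)
    have int: "set_integrable lborel {0..t} (\<lambda>s. bridge_drift Q E \<Sigma> r T b s (U s \<omega>))"
      if t: "t \<in> {0..<T}" for t
    proof (rule borel_integrable_atLeastAtMost')
      have "continuous_on {0..t} (\<lambda>s. (A s *v n s + c b s) + (A s ** K s) *v x s)"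
        by (rule continuous_on_subset[OF continuous_on_add[OF c1 c2]]) (use t in auto)
      then show "continuous_on {0..t} (\<lambda>s. bridge_drift Q E \<Sigma> r T b s (U s \<omega>))"
        by (rule continuous_on_eq) (use t drift in auto)
    qed
    have "U t \<omega> = U 0 \<omega> + (LINT s:{0..t}|lborel. bridge_drift Q E \<Sigma> r T b s (U s \<omega>)) + J t \<omega>"
      if t: "t \<in> {0..<T}" for t
    proof -
      have sub: "{0..t} \<subseteq> {0..<T}" using t by auto
      have "(LINT s:{0..t}|lborel. bridge_drift Q E \<Sigma> r T b s (U s \<omega>)) =
          integral {0..t} (\<lambda>s. bridge_drift Q E \<Sigma> r T b s (U s \<omega>))"
        by (rule set_borel_integral_eq_integral[OF int[OF t]])
      also have "\<dots> = integral {0..t} (\<lambda>s. (A s *v n s + c b s) + (A s ** K s) *v x s)"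
        by (rule integral_cong) (use sub drift in auto)
      also have "\<dots> = integral {0..t} (\<lambda>s. A s *v n s + c b s) + integral {0..t} (\<lambda>s. (A s ** K s) *v x s)"
        by (intro Henstock_Kurzweil_Integration.integral_add integrable_continuous_real
            continuous_on_subset[OF c1 sub] continuous_on_subset[OF c2 sub])
      also have "integral {0..t} (\<lambda>s. A s *v n s + c b s) = n t - n 0"
        using t sub unfolding n_def
        by (intro integral_unique fundamental_theorem_of_calculus
            has_vector_derivative_within_subset[OF n_bridge_deriv sub]) auto
      also have "n 0 = a" by (simp add: n_def n_bridge_0)
      finally show ?thesis using Ux[OF t] Jx[OF t] U0 by simp
    qed
    moreover have "continuous_on {0..<T} (\<lambda>t. U t \<omega>)"
      by (rule continuous_on_eq[of _ "\<lambda>t. n t + K t *v x t"]) (auto intro!: continuous_intros cn cK cx simp: Ux)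
    ultimately show ?case using U0 int by blast
  qed
  show ?thesis
    unfolding strong_solution_def
  proof (intro conjI ballI exI[of _ J])
    show "U t \<in> borel_measurable (?F t)" if "t \<in> {0..<T}" for t by (rule meas[OF that])
  qed (use path J in auto)
qed

text \<open>The first conjunct keeps the second from being vacuous, and the second covers every
  version of the stochastic integral. The separate type \<open>'v\<close> lets uniqueness range over
  sample spaces of a type other than that of \<open>M\<close>.\<close>

theorem theorem2p2:
  fixes Q :: "real \<Rightarrow> real^'d^'d"
    and \<Sigma> :: "real \<Rightarrow> real^'p^'d"
    and r :: "real \<Rightarrow> real^'d"
    and E :: "real \<Rightarrow> real \<Rightarrow> real^'d^'d"
    and a b :: "real^'d"
    and T :: real
    and M :: "'w measure"
    and B :: "real \<Rightarrow> 'w \<Rightarrow> real^'p"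
    and F :: "real \<Rightarrow> 'w measure"
  assumes "continuous_on {0..} Q"
    and "continuous_on {0..} \<Sigma>"
    and "continuous_on {0..} r"
    and "evolution_matrices Q E"
    and "\<And>s t. 0 \<le> s \<Longrightarrow> s < t \<Longrightarrow> positive_definite (kappa E \<Sigma> s t)"
    and "0 < T"
    and "wiener_setup M (\<lambda>_. a) B"
    and "F = augmented_filtration M (\<lambda>_. a) B"
  shows "(\<exists>I. has_ito_integral M F B T (\<lambda>u _. matrix_inv (Gam E \<Sigma> u T) ** \<Sigma> u) I) \<and>
    (\<forall>I U. has_ito_integral M F B T (\<lambda>u _. matrix_inv (Gam E \<Sigma> u T) ** \<Sigma> u) I \<and>
       (\<forall>t\<in>{0..<T}. \<forall>\<omega>\<in>space M.
          U t \<omega> = n_bridge E \<Sigma> r T a b 0 t + Gam E \<Sigma> t T *v I t \<omega>) \<longrightarrow>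
       strong_solution M B T (bridge_drift Q E \<Sigma> r T b) (\<lambda>t _. \<Sigma> t) (\<lambda>_. a) U) \<and>
    strong_uniqueness TYPE('v) T (bridge_drift Q E \<Sigma> r T b) (\<lambda>t _. \<Sigma> t)"
proof -
  interpret linear_bridge Q \<Sigma> r E T using assms by unfold_locales
  interpret wiener M F B using wiener_setup_imp_wiener assms(7) unfolding assms(8) .
  obtain m where "fine_levels T (\<lambda>u. matrix_inv (Gam E \<Sigma> u T) ** \<Sigma> u) m"
    using fine_levels_exist[OF T integrand_continuous] by blast
  from has_ito_integral_dyadic_limit[OF T integrand_continuous this]
  have "\<exists>I. has_ito_integral M F B T (\<lambda>u _. matrix_inv (Gam E \<Sigma> u T) ** \<Sigma> u) I" by blast
  moreover have "strong_solution M B T (bridge_drift Q E \<Sigma> r T b) (\<lambda>t _. \<Sigma> t) (\<lambda>_. a) U"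
    if "has_ito_integral M F B T (\<lambda>u _. matrix_inv (Gam E \<Sigma> u T) ** \<Sigma> u) I"
      "\<forall>t\<in>{0..<T}. \<forall>\<omega>\<in>space M. U t \<omega> = n_bridge E \<Sigma> r T a b 0 t + Gam E \<Sigma> t T *v I t \<omega>" for I U
    using bridge_strong_solution[OF assms(7), of I U b] that unfolding assms(8) by blast
  moreover have "strong_uniqueness TYPE('v) T (bridge_drift Q E \<Sigma> r T b) (\<lambda>t _. \<Sigma> t)"
    by (rule linear_strong_uniqueness[OF T A_continuous continuous_on_subset[OF \<Sigma>] bridge_drift_eq]) auto
  ultimately show ?thesis by blast
qed

end
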